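(* Let $f,g\in C^1(\mathbb{R})$ be real-valued and strictly monotone on the support of a measurable function $\chi$ on $\mathbb{R}$. Let $\sigma,\tau\in C^0(\mathbb{R})$ be such that, for some $A>0$, we have $$\frac{|\sigma(\xi)|}{|f'(\xi)|^{1/2}}\leq A\,\frac{|\tau(\xi)|}{|g'(\xi)|^{1/2}}\qquad(\mathrm{I})$$ for all $\xi\in\operatorname{supp}\chi$ satisfying $f'(\xi)\neq0$ and $g'(\xi)\neq0$. Then (in dimension $n=1$) we have $$\left\|\chi(D_x)\sigma(D_x)e^{itf(D_x)}\varphi(x)\right\|_{L^2(\mathbb{R}_t)}\leq A\left\|\chi(D_x)\tau(D_x)e^{itg(D_x)}\varphi(\widetilde x)\right\|_{L^2(\mathbb{R}_t)}\qquad(\mathrm{II})$$ for all $x,\widetilde x\in\mathbb{R}$. Consequently, for general $n\geq1$ and for any measurable function $w$ on $\mathbb{R}^n$, we have $$\left\|w(x)\chi(D_j)\sigma(D_j)e^{itf(D_j)}\varphi(x)\right\|_{L^2(\mathbb{R}_t\times\mathbb{R}^n_x)}\leq A\left\|w(x)\chi(D_j)\tau(D_j)e^{itg(D_j)}\varphi(x)\right\|_{L^2(\mathbb{R}_t\times\mathbb{R}^n_x)},\qquad(\mathrm{III})$$ where $j=1,2,\ldots,n$. Moreover, if $\chi\in C^0(\mathbb{R})$ and $w\neq0$ on a set of $\mathbb{R}^n$ with positive measure, the converse is true, namely, if we have estimate (II) for all $\varphi$, for some $x,\widetilde x\in\mathbb{R}$, or if we have estimate (III) for all $\varphi$, and the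 norms are finite, then we also have inequality (I) (for all $\xi\in\operatorname{supp}\chi$ satisfying $f'(\xi)\neq0$ and $g'(\xi)\neq0$).
   Context: Notation: $D_j=\frac1i\frac{\partial}{\partial x_j}$ on $\mathbb{R}^n$; when $n=1$, $D_x=D_1$. For a function $a$ on $\mathbb{R}$, $a(D_j)$ denotes the Fourier multiplier on $\mathbb{R}^n$ with symbol $a(\xi_j)$, i.e. $a(D_j)\varphi(x)=(2\pi)^{-n}\int_{\mathbb{R}^n}e^{ix\cdot\xi}a(\xi_j)\widehat\varphi(\xi)\,d\xi$ with $\widehat\varphi(\xi)=\int_{\mathbb{R}^n}e^{-ix\cdot\xi}\varphi(x)\,dx$. The function $\varphi$ is an arbitrary initial datum, on $\mathbb{R}$ in (II) and on $\mathbb{R}^n$ in (III) (the paper does not specify its class). In (II) the points $x,\widetilde x$ are fixed and the norms are taken in $t$ only.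
   Formalization: In (II) and (III), φ is taken in L¹ with χσφ̂ and χτφ̂ integrable, and f′, g′ ≠ 0 almost everywhere on {χφ̂ ≠ 0}; without the last condition (II) fails, e.g. χ=σ=1, f(ξ)=ξ, τ=d, g′=d², A=1 with d the distance to a fat Cantor set. *)

theory Defs
  imports "HOL-Analysis.Analysis"
begin

abbreviation supp :: "(real \<Rightarrow> complex) \<Rightarrow> real set" where
  "supp chi \<equiv> closure {\<xi>. chi \<xi> \<noteq> 0}"

definition fourier :: "('a::euclidean_space \<Rightarrow> complex) \<Rightarrow> 'a \<Rightarrow> complex" where
  "fourier \<phi> \<xi> = (LINT x|lebesgue. exp (- (\<i> * complex_of_real (x \<bullet> \<xi>))) * \<phi> x)"

definition fourier_multiplier ::
    "('a::euclidean_space \<Rightarrow> complex) \<Rightarrow> ('a \<Rightarrow> complex) \<Rightarrow> 'a \<Rightarrow> complex" where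
  "fourier_multiplier m \<phi> x =
     complex_of_real (1 / (2 * pi) ^ DIM('a)) *
     (LINT \<xi>|lebesgue. exp (\<i> * complex_of_real (x \<bullet> \<xi>)) * m \<xi> * fourier \<phi> \<xi>)"

text \<open>In what follows \<open>p\<close> selects the frequency variable on which the one-dimensional symbols
  act: it is the identity for \<open>D\<^sub>x\<close> on the line and \<open>\<lambda>\<xi>. \<xi> $ j\<close> for \<open>D\<^sub>j\<close> on \<open>real ^ 'n\<close>.
  The composition of multipliers \<open>chi(D) \<sigma>(D) exp(i t f(D))\<close> is the multiplier with the
  product symbol.\<close>

definition evolution ::
    "('a::euclidean_space \<Rightarrow> real) \<Rightarrow> (real \<Rightarrow> complex) \<Rightarrow> (real \<Rightarrow> complex) \<Rightarrow> (real \<Rightarrow> real)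
      \<Rightarrow> ('a \<Rightarrow> complex) \<Rightarrow> real \<Rightarrow> 'a \<Rightarrow> complex" where
  "evolution p chi \<sigma> f \<phi> t =
     fourier_multiplier
       (\<lambda>\<xi>. chi (p \<xi>) * \<sigma> (p \<xi>) * exp (\<i> * complex_of_real (t * f (p \<xi>)))) \<phi>"

text \<open>Norms take values in \<open>[0, \<infinity>]\<close>, so that an estimate is also meaningful (and asserts
  something) when one of its sides is infinite.\<close>

definition L2norm :: "('a::euclidean_space \<Rightarrow> complex) \<Rightarrow> ennreal" where
  "L2norm u =
     (let I = (\<integral>\<^sup>+x. ennreal ((cmod (u x))\<^sup>2) \<partial>lebesgue)
      in if I = \<infinity> then \<infinity> else ennreal (sqrt (enn2real I)))"

definition symbol_bound ::
    "(real \<Rightarrow> real) \<Rightarrow> (real \<Rightarrow> real) \<Rightarrow> (real \<Rightarrow> complex) \<Rightarrow> (real \<Rightarrow> complex) \<Rightarrow> (real \<Rightarrow> complex)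
      \<Rightarrow> real \<Rightarrow> bool" where
  "symbol_bound f g chi \<sigma> \<tau> A \<longleftrightarrow>
     (\<forall>\<xi>\<in>supp chi. deriv f \<xi> \<noteq> 0 \<longrightarrow> deriv g \<xi> \<noteq> 0 \<longrightarrow>
        cmod (\<sigma> \<xi>) / sqrt \<bar>deriv f \<xi>\<bar> \<le> A * (cmod (\<tau> \<xi>) / sqrt \<bar>deriv g \<xi>\<bar>))"

text \<open>The initial data for which both sides of the estimates are well defined. The first three
  conditions make \<open>fourier \<phi>\<close> and the two multiplier integrals absolutely convergent (for every
  \<open>t\<close>, as the factors \<open>exp (i t f)\<close>, \<open>exp (i t g)\<close> have modulus one).

  The last condition is void when \<open>f'\<close> and \<open>g'\<close> vanish at most on a null subset of \<open>{chi \<noteq> 0}\<close>,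
  which the change of variables \<open>\<eta> = f(\<xi>)\<close>, \<open>\<eta> = g(\<xi>)\<close> behind the estimates takes for granted.
  Strict monotonicity does not imply it, and without it the comparison fails: let \<open>C\<close> be a
  compact set of positive measure with empty interior, \<open>d\<close> the distance to \<open>C\<close>, and take
  \<open>chi = \<sigma> = 1\<close>, \<open>f(\<xi>) = \<xi>\<close>, \<open>\<tau> = d\<close>, \<open>g' = d\<^sup>2\<close>, \<open>A = 1\<close>. The symbol bound holds with equality
  where \<open>g'\<close> is nonzero, but the squared norms on the two sides are
  \<open>(2 pi)\<^sup>-\<^sup>1\<close> times the integral of the squared modulus of \<open>fourier \<phi>\<close> over the whole line and
  over the complement of \<open>C\<close>, respectively.\<close>

definition admissible_datum ::
    "('a::euclidean_space \<Rightarrow> real) \<Rightarrow> (real \<Rightarrow> real) \<Rightarrow> (real \<Rightarrow> real) \<Rightarrow> (real \<Rightarrow> complex)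
      \<Rightarrow> (real \<Rightarrow> complex) \<Rightarrow> (real \<Rightarrow> complex) \<Rightarrow> ('a \<Rightarrow> complex) \<Rightarrow> bool" where
  "admissible_datum p f g chi \<sigma> \<tau> \<phi> \<longleftrightarrow>
     integrable lebesgue \<phi> \<and>
     integrable lebesgue (\<lambda>\<xi>. chi (p \<xi>) * \<sigma> (p \<xi>) * fourier \<phi> \<xi>) \<and>
     integrable lebesgue (\<lambda>\<xi>. chi (p \<xi>) * \<tau> (p \<xi>) * fourier \<phi> \<xi>) \<and>
     (AE \<xi> in lebesgue. chi (p \<xi>) * fourier \<phi> \<xi> \<noteq> 0 \<longrightarrow>
        deriv f (p \<xi>) \<noteq> 0 \<and> deriv g (p \<xi>) \<noteq> 0)"

text \<open>The data tested in the converse. Integrability of all moments makes the Fourier transform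
  smooth, so these are exactly the Schwartz functions whose Fourier transform is smooth with
  compact support. For continuous \<open>chi\<close>, \<open>\<sigma>\<close>, \<open>\<tau>\<close> the multiplier integrals converge absolutely for
  each of them. Assuming the estimate for this small class only makes the converse apply to
  every larger class of initial data.\<close>

definition test_datum :: "('a::euclidean_space \<Rightarrow> complex) \<Rightarrow> bool" where
  "test_datum \<phi> \<longleftrightarrow>
     continuous_on UNIV \<phi> \<and>
     (\<forall>k::nat. integrable lebesgue (\<lambda>x. norm x ^ k *\<^sub>R \<phi> x)) \<and>
     bounded {\<xi>. fourier \<phi> \<xi> \<noteq> 0}"

end

theory Submission
  imports Defs "HOL-Probability.Probability" "HOL-Computational_Algebra.Polynomial"
begin

text \<open>For fixed \<open>x\<close> the evolution is, as a function of time, an oscillatory integral: on the line it is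
\<open>1 / (2 pi)\<close> times the integral of \<open>exp (i t f(\<xi>)) h(\<xi>)\<close>, where
\<open>h(\<xi>) = exp (i x \<xi>) chi(\<xi>) \<sigma>(\<xi>) fourier \<phi> \<xi>\<close>. The substitution \<open>\<eta> = f(\<xi>)\<close> turns it into a Fourier
integral in \<open>\<eta>\<close>, and Plancherel's theorem gives its squared norm in \<open>t\<close> as the integral of
\<open>\<bar>h\<bar>\<^sup>2 / \<bar>f'\<bar>\<close>, up to the factor \<open>1 / (2 pi)\<close> (\<open>oscillatory_plancherel\<close>). The point \<open>x\<close> enters
\<open>h\<close> only through a factor of modulus one, and the symbol bound is the pointwise comparison of the
two integrands obtained for \<open>(\<sigma>, f)\<close> and \<open>(\<tau>, g)\<close>. This is the estimate on the line
(\<open>line_estimate\<close>).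

In several variables the same argument is applied at every \<open>x\<close> separately. Integrating out the
frequencies other than the selected one leaves an oscillatory integral on the line with amplitude
\<open>chi(\<eta>) \<sigma>(\<eta>) C\<^sub>x(\<eta>)\<close>, and \<open>C\<^sub>x\<close> depends on the datum only, so it is common to both sides. Tonelli's
theorem adds the weight (\<open>weighted_estimate\<close>).

For the converse, suppose that the symbol bound fails at a point. By continuity it fails on a whole
interval on which \<open>chi\<close>, \<open>f'\<close> and \<open>g'\<close> do not vanish. For a datum whose Fourier transform is a smooth
bump supported in that interval, the exact formula for both norms contradicts the assumed estimate
(\<open>line_converse\<close>). In several variables the datum is a product: the bump in the selected
frequency times bumps near the origin in the other ones. Both weighted norms are then the
one-dimensional norms multiplied by the same constant. That constant is finite because the norms are
assumed finite, and positive because a wave of low frequency has no zeros on a large box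
(\<open>weighted_converse\<close>).

The direct estimates only ask that the multiplier integrals converge, so the norms may be infinite.
Plancherel's theorem is therefore proved for every integrable function on the line, with both sides
in \<open>[0, \<infinity>]\<close> (\<open>plancherel\<close>).\<close>

section \<open>The Fourier transform of integrable functions on the line\<close>

lemma cis_measurable [measurable]: "cis \<in> borel_measurable borel"
  by (intro borel_measurable_continuous_onI continuous_intros)

lemma cnj_measurable [measurable]: "cnj \<in> borel_measurable borel"
  by (intro borel_measurable_continuous_onI continuous_intros)

text \<open>The Fourier transform of \<open>h\<close> at \<open>- t\<close>. With this sign it is, up to
normalization, the evolution with phase \<open>\<xi>\<close> at time \<open>t\<close>.\<close>

definition ft :: "(real \<Rightarrow> complex) \<Rightarrow> real \<Rightarrow> complex" where
  "ft h t = (LINT x|lborel. cis (t * x) * h x)"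

lemma integrable_cis_mult:
  fixes h :: "'a::euclidean_space \<Rightarrow> complex"
  assumes "integrable lborel h" and [measurable]: "p \<in> borel_measurable borel"
  shows "integrable lborel (\<lambda>x. cis (p x) * h x)"
proof -
  have [measurable]: "h \<in> borel_measurable borel" using assms by auto
  show ?thesis
    by (rule Bochner_Integration.integrable_bound[OF assms(1)]) (auto simp: norm_mult)
qed

lemma norm_cis_integral_le:
  fixes h :: "'a::euclidean_space \<Rightarrow> complex"
  assumes "integrable lborel h" 
  shows "norm (LINT x|lborel. cis (p x) * h x) \<le> (LINT x|lborel. norm (h x))"
proof -
  have "norm (LINT x|lborel. cis (p x) * h x) \<le> (LINT x|lborel. norm (cis (p x) * h x))"
    by (rule integral_norm_bound)
  then show ?thesis by (simp add: norm_mult)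
qed

lemma ft_measurable [measurable]:
  assumes [measurable]: "h \<in> borel_measurable borel"
  shows "ft h \<in> borel_measurable borel"
  unfolding ft_def by measurable

lemma norm_ft_le:
  assumes "integrable lborel h" 
  shows "norm (ft h t) \<le> (LINT x|lborel. norm (h x))"
  unfolding ft_def by (rule norm_cis_integral_le[OF assms])

lemma ft_cmult: "ft (\<lambda>x. c * h x) t = c * ft h t"
proof -
  have "(\<lambda>x. cis (t * x) * (c * h x)) = (\<lambda>x. c * (cis (t * x) * h x))" by (auto simp: ac_simps)
  then show ?thesis unfolding ft_def by simp
qed

lemma integrable_pair_mult:
  fixes a :: "'a::euclidean_space \<Rightarrow> complex" and b :: "'b::euclidean_space \<Rightarrow> complex"
  assumes a: "integrable lborel a" and b: "integrable lborel b"
    and [measurable]: "k \<in> borel_measurable (lborel \<Otimes>\<^sub>M lborel)" and k: "\<And>z. norm (k z) \<le> K"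
  shows "integrable (lborel \<Otimes>\<^sub>M lborel) (\<lambda>(x, y). k (x, y) * (a x * b y) :: complex)"
proof -
  have [measurable]: "a \<in> borel_measurable borel" "b \<in> borel_measurable borel" using a b by auto
  have 1: "integrable (lborel \<Otimes>\<^sub>M lborel) (\<lambda>(x, y). a x * b y)"
  proof (rule lborel_pair.Fubini_integrable)
    have "(\<lambda>x. LINT y|lborel. norm (case (x, y) of (x, y) \<Rightarrow> a x * b y))
       = (\<lambda>x. norm (a x) * (LINT y|lborel. norm (b y)))"
      by (auto simp: norm_mult)
    then show "integrable lborel (\<lambda>x. LINT y|lborel. norm (case (x, y) of (x, y) \<Rightarrow> a x * b y))"
      using a by auto
    show "AE x in lborel. integrable lborel (\<lambda>y. case (x, y) of (x, y) \<Rightarrow> a x * b y)"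
      using b by auto
  qed measurable
  then have 2: "integrable (lborel \<Otimes>\<^sub>M lborel) (\<lambda>z. K * norm (case z of (x, y) \<Rightarrow> a x * b y))"
    by auto
  have "0 \<le> K" using k norm_ge_zero order_trans by blast
  show ?thesis
    by (rule Bochner_Integration.integrable_bound[OF 2])
       (auto simp: norm_mult split_beta \<open>0 \<le> K\<close> intro!: mult_mono k)
qed

lemma ft_swap:
  assumes a: "integrable lborel a" and b: "integrable lborel b"
  shows "(LINT t|lborel. a t * ft b t) = (LINT s|lborel. ft a s * b s)"
proof -
  have [measurable]: "a \<in> borel_measurable borel" "b \<in> borel_measurable borel" using a b by auto
  have i: "integrable (lborel \<Otimes>\<^sub>M lborel) (\<lambda>(t, s). cis (fst (t, s) * snd (t, s)) * (a t * b s))"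
    by (rule integrable_pair_mult[where K = 1, OF a b]) auto
  have "(LINT t|lborel. a t * ft b t) = (LINT t|lborel. (LINT s|lborel. cis (t * s) * (a t * b s)))"
  proof (intro Bochner_Integration.integral_cong refl)
    fix t
    have "(\<lambda>s. cis (t * s) * (a t * b s)) = (\<lambda>s. a t * (cis (t * s) * b s))" by (auto simp: ac_simps)
    then show "a t * ft b t = (LINT s|lborel. cis (t * s) * (a t * b s))" unfolding ft_def by simp
  qed
  also have "\<dots> = (LINT s|lborel. (LINT t|lborel. cis (t * s) * (a t * b s)))"
    using lborel_pair.Fubini_integral[of "\<lambda>t s. cis (t * s) * (a t * b s)"] i by simp
  also have "\<dots> = (LINT s|lborel. ft a s * b s)"
  proof (intro Bochner_Integration.integral_cong refl)
    fix s
    have "(\<lambda>t. cis (t * s) * (a t * b s)) = (\<lambda>t. (cis (s * t) * a t) * b s)" by (auto simp: ac_simps)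
    then show "(LINT t|lborel. cis (t * s) * (a t * b s)) = ft a s * b s" unfolding ft_def by simp
  qed
  finally show ?thesis .
qed

abbreviation gaussian :: "real \<Rightarrow> real \<Rightarrow> real" where
  "gaussian e t \<equiv> exp (- (e * t)\<^sup>2 / 2)"

lemma gaussian_eq: "e > 0 \<Longrightarrow> gaussian e t = sqrt (2 * pi) / e * normal_density 0 (1 / e) t"
  by (simp add: normal_density_def real_sqrt_mult real_sqrt_divide power_mult_distrib field_simps)

lemma integrable_gaussian: "e > 0 \<Longrightarrow> integrable lborel (gaussian e)"
  by (subst gaussian_eq) auto

text \<open>The Gaussian is the density of the standard normal distribution up to scaling, so its transform is the
known characteristic function.\<close>

lemma ft_gaussian:
  assumes e: "e > 0"
  shows "ft (\<lambda>t. of_real (gaussian e t)) s = of_real (2 * pi * normal_density 0 e s)"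
proof -
  have "complex_of_real (exp (- (s / e)\<^sup>2 / 2)) = char std_normal_distribution (s / e)"
    by (simp add: char_std_normal_distribution)
  also have "\<dots> = (LINT x|lborel. std_normal_density x *\<^sub>R cis (s / e * x))"
    unfolding char_def by (subst integral_density) (auto simp: cis_conv_exp)
  also have "\<dots> = e *\<^sub>R (LINT x|lborel. std_normal_density (0 + e * x) *\<^sub>R cis (s / e * (0 + e * x)))"
    using lborel_integral_real_affine[of e "\<lambda>x. std_normal_density x *\<^sub>R cis (s / e * x)" 0] e by simp
  also have "(\<lambda>x. std_normal_density (0 + e * x) *\<^sub>R cis (s / e * (0 + e * x)))
      = (\<lambda>x. of_real (1 / sqrt (2 * pi)) * (cis (s * x) * of_real (gaussian e x)))"
    using e by (auto simp: std_normal_density_def scaleR_conv_of_real)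
  also have "(LINT x|lborel. of_real (1 / sqrt (2 * pi)) * (cis (s * x) * complex_of_real (gaussian e x))) =
       of_real (1 / sqrt (2 * pi)) * ft (\<lambda>t. of_real (gaussian e t)) s"
    unfolding ft_def by (rule integral_mult_right_zero)
  finally have *: "of_real (e / sqrt (2 * pi)) * ft (\<lambda>t. of_real (gaussian e t)) s 
      = complex_of_real (exp (- (s / e)\<^sup>2 / 2))" (is "_ * ?F = _")
    by (simp add: scaleR_conv_of_real)
  have "?F = of_real (sqrt (2 * pi) / e) * (of_real (e / sqrt (2 * pi)) * ?F)"
    using e by simp
  also have "\<dots> = of_real (sqrt (2 * pi) / e * exp (- (s / e)\<^sup>2 / 2))" unfolding * by simp
  also have "sqrt (2 * pi) / e * exp (- (s / e)\<^sup>2 / 2) = 2 * pi * normal_density 0 e s"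
    using e by (simp add: normal_density_def real_sqrt_mult power_divide field_simps)
  finally show ?thesis .
qed

definition mollify :: "real \<Rightarrow> (real \<Rightarrow> complex) \<Rightarrow> real \<Rightarrow> complex" where
  "mollify e H x = (LINT s|lborel. of_real (normal_density 0 e (s - x)) * H s)"

lemma integrable_gaussian_mult:
  assumes e: "e > 0" and [measurable]: "u \<in> borel_measurable borel" and u: "\<And>t. norm (u t) \<le> C"
  shows "integrable lborel (\<lambda>t. u t * complex_of_real (gaussian e t))"
proof (rule Bochner_Integration.integrable_bound)
  show "integrable lborel (\<lambda>t. C * gaussian e t)"
    using integrable_gaussian[OF e] by auto
  have "0 \<le> C" using u norm_ge_zero order_trans by blast
  then show "AE t in lborel. norm (u t * complex_of_real (gaussian e t)) \<le> norm (C * gaussian e t)"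
    by (auto simp: norm_mult intro!: mult_right_mono u)
qed measurable

text \<open>The transform of an integrable function need not be integrable; a Gaussian factor makes its inversion
integral converge, and by Fubini's theorem this replaces \<open>H\<close> by its convolution with a normal density.\<close>

lemma gaussian_inversion:
  assumes H: "integrable lborel H" and e: "e > 0"
  shows "ft (\<lambda>t. ft H t * of_real (gaussian e t)) (- x) = of_real (2 * pi) * mollify e H x"
proof -
  let ?a = "\<lambda>t. cis (- x * t) * complex_of_real (gaussian e t)"
  have ia: "integrable lborel ?a"
    by (rule integrable_gaussian_mult[where C = 1]) (auto simp: e)
  have fa: "ft ?a s = of_real (2 * pi) * of_real (normal_density 0 e (s - x))" for s
  proof -
    have "ft ?a s = (LINT t|lborel. cis ((s - x) * t) * of_real (gaussian e t))"
      unfolding ft_def by (simp add: mult.assoc[symmetric] cis_mult algebra_simps)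
    also have "\<dots> = ft (\<lambda>t. of_real (gaussian e t)) (s - x)" unfolding ft_def by simp
    finally show ?thesis using ft_gaussian[OF e, of "s - x"] by simp
  qed
  have "ft (\<lambda>t. ft H t * of_real (gaussian e t)) (- x) = (LINT t|lborel. ?a t * ft H t)"
    by (subst ft_def) (simp add: ac_simps)
  also have "\<dots> = (LINT s|lborel. ft ?a s * H s)" by (rule ft_swap[OF ia H])
  also have "\<dots> = of_real (2 * pi) * mollify e H x"
    unfolding fa mollify_def by (simp add: mult.assoc)
  finally show ?thesis .
qed

lemma mollify_tendsto:
  assumes [measurable]: "G \<in> borel_measurable borel" and G: "\<And>x. norm (G x) \<le> C"
    and cont: "isCont G x"
  shows "(\<lambda>n. mollify (1 / real (Suc n)) G x) \<longlonglongrightarrow> G x"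
proof -
  let ?N = "std_normal_density"
  have eq: "mollify e G x = (LINT y|lborel. of_real (?N y) * G (x + e * y))" if e: "e > 0" for e
  proof -
    have "mollify e G x = e *\<^sub>R (LINT y|lborel. of_real (normal_density 0 e (x + e * y - x)) * G (x + e * y))"
      unfolding mollify_def using lborel_integral_real_affine[of e "\<lambda>s. of_real (normal_density 0 e (s - x)) * G s" x] e
      by simp
    also have "(\<lambda>y. of_real (normal_density 0 e (x + e * y - x)) * G (x + e * y))
        = (\<lambda>y. of_real (1 / e) * (of_real (?N y) * G (x + e * y)))"
      using e by (auto simp: normal_density_def real_sqrt_mult power_mult_distrib field_simps)
    finally show ?thesis using e by (simp add: scaleR_conv_of_real)
  qed
  have "(\<lambda>n. LINT y|lborel. of_real (?N y) * G (x + 1 / real (Suc n) * y)) \<longlonglongrightarrow>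
     (LINT y|lborel. of_real (?N y) * G x)"
  proof (rule integral_dominated_convergence[where w = "\<lambda>y. ?N y * C"])
    show "AE y in lborel. (\<lambda>n. of_real (?N y) * G (x + 1 / real (Suc n) * y)) \<longlonglongrightarrow> of_real (?N y) * G x"
    proof (intro AE_I2 tendsto_intros)
      fix y
      have "(\<lambda>n. x + 1 / real (Suc n) * y) \<longlonglongrightarrow> x + 0 * y"
        using LIMSEQ_inverse_real_of_nat by (intro tendsto_intros) (simp add: inverse_eq_divide)
      then show "(\<lambda>n. G (x + 1 / real (Suc n) * y)) \<longlonglongrightarrow> G x"
        using isCont_tendsto_compose[OF cont] by simp
    qed
  qed (auto simp: norm_mult intro!: mult_left_mono G)
  also have "(LINT y|lborel. of_real (?N y) * G x) = G x"
    by (simp add: integral_complex_of_real)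
  finally show ?thesis by (simp add: eq)
qed

lemma ennreal_mult_le_half_sum_squares:
  fixes x y :: real
  assumes "x \<ge> 0" "y \<ge> 0"
  shows "ennreal (x * y) \<le> (ennreal (x\<^sup>2) + ennreal (y\<^sup>2)) / 2"
proof -
  have "x * y \<le> (x\<^sup>2 + y\<^sup>2) / 2" using sum_squares_bound[of x y] by simp
  then have "ennreal (x * y) \<le> ennreal ((x\<^sup>2 + y\<^sup>2) / 2)" by (rule ennreal_leI)
  also have "\<dots> = (ennreal (x\<^sup>2) + ennreal (y\<^sup>2)) / 2"
    by (simp add: ennreal_plus[symmetric] divide_ennreal[symmetric] del: ennreal_plus)
  finally show ?thesis .
qed

lemma ennreal_half_add_half: "(a::ennreal) / 2 + a / 2 = a"
proof -
  have "a / 2 + a / 2 = a * 2 / 2"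
    by (simp add: add_divide_distrib_ennreal[symmetric] mult_2_right)
  then show ?thesis by (simp add: ennreal_mult_divide_eq)
qed

lemma nn_integral_normal_density_shift:
  assumes "e > 0"
  shows "(\<integral>\<^sup>+s. ennreal (normal_density 0 e (s - x)) \<partial>lborel) = 1"
    "(\<integral>\<^sup>+s. ennreal (normal_density 0 e (x - s)) \<partial>lborel) = 1"
proof -
  have N: "(\<integral>\<^sup>+s. ennreal (normal_density 0 e s) \<partial>lborel) = 1"
    using assms by (subst nn_integral_eq_integral) auto
  show "(\<integral>\<^sup>+s. ennreal (normal_density 0 e (s - x)) \<partial>lborel) = 1"
    using nn_integral_real_affine[of "\<lambda>s. ennreal (normal_density 0 e s)" 1 "- x"] N by simp
  show "(\<integral>\<^sup>+s. ennreal (normal_density 0 e (x - s)) \<partial>lborel) = 1"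
    using nn_integral_real_affine[of "\<lambda>s. ennreal (normal_density 0 e s)" "-1" x] N by simp
qed

text \<open>By \<open>gaussian_inversion\<close> the left-hand side is \<open>2 pi\<close> times the integral of \<open>cnj (mollify e H) * H\<close>,
a double integral of \<open>\<bar>H(s)\<bar> \<bar>H(y)\<bar>\<close> against a kernel with both marginals equal to one. The inequality
\<open>2 a b \<le> a\<^sup>2 + b\<^sup>2\<close> bounds it without assuming that \<open>H\<close> is square integrable.\<close>

lemma plancherel_upper_gaussian:
  assumes H: "integrable lborel H" and e: "e > 0"
  shows "(\<integral>\<^sup>+t. ennreal ((norm (ft H t))\<^sup>2 * gaussian e t) \<partial>lborel)
     \<le> ennreal (2 * pi) * (\<integral>\<^sup>+s. ennreal ((norm (H s))\<^sup>2) \<partial>lborel)"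
proof -
  have [measurable]: "H \<in> borel_measurable borel" using H by auto
  define C where "C = (LINT x|lborel. norm (H x))"
  let ?N = "\<lambda>s y. normal_density 0 e (s - y)"
  let ?a = "\<lambda>t. cnj (ft H t) * complex_of_real (gaussian e t)"
  have ia: "integrable lborel ?a"
    by (rule integrable_gaussian_mult[where C = C]) (auto simp: e C_def norm_ft_le[OF H])
  have fa: "ft ?a s = cnj (of_real (2 * pi) * mollify e H s)" for s
  proof -
    have "cnj (ft ?a s) = (LINT t|lborel. cnj (cis (s * t) * ?a t))"
      unfolding ft_def[of ?a] by (rule Bochner_Integration.integral_cnj[symmetric])
    also have "\<dots> = (LINT t|lborel. cis (- s * t) * (ft H t * of_real (gaussian e t)))"
      by (simp add: cis_cnj)
    also have "\<dots> = ft (\<lambda>t. ft H t * of_real (gaussian e t)) (- s)"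
      unfolding ft_def[of "\<lambda>t. ft H t * of_real (gaussian e t)"] by simp
    finally have "cnj (ft ?a s) = of_real (2 * pi) * mollify e H s"
      using gaussian_inversion[OF H e, of s] by simp
    then show ?thesis by (metis complex_cnj_cnj)
  qed
  have int: "integrable lborel (\<lambda>t. (norm (ft H t))\<^sup>2 * gaussian e t)"
    by (rule Bochner_Integration.integrable_bound[where f = "\<lambda>t. C\<^sup>2 * gaussian e t"])
       (use integrable_gaussian[OF e] in
        \<open>auto intro!: mult_right_mono power_mono norm_ft_le[OF H] simp: C_def\<close>)
  have "complex_of_real (LINT t|lborel. (norm (ft H t))\<^sup>2 * gaussian e t) = (LINT t|lborel. ?a t * ft H t)"
    unfolding integral_complex_of_real[symmetric]
  proof (intro Bochner_Integration.integral_cong refl)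
    fix t
    have "complex_of_real ((norm (ft H t))\<^sup>2) = ft H t * cnj (ft H t)" by (rule complex_norm_square)
    then show "complex_of_real ((norm (ft H t))\<^sup>2 * gaussian e t) = ?a t * ft H t"
      unfolding of_real_mult by (metis mult.commute mult.left_commute)
  qed
  also have "\<dots> = (LINT s|lborel. ft ?a s * H s)" by (rule ft_swap[OF ia H])
  finally have "norm (complex_of_real (LINT t|lborel. (norm (ft H t))\<^sup>2 * gaussian e t)) = norm (LINT s|lborel. ft ?a s * H s)"
    by (rule arg_cong)
  moreover have "0 \<le> (LINT t|lborel. (norm (ft H t))\<^sup>2 * gaussian e t)"
    by (rule Bochner_Integration.integral_nonneg) simp
  ultimately have "ennreal (LINT t|lborel. (norm (ft H t))\<^sup>2 * gaussian e t) = ennreal (norm (LINT s|lborel. ft ?a s * H s))"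
    unfolding norm_of_real by (simp only: abs_of_nonneg)
  also have "\<dots> \<le> (\<integral>\<^sup>+s. ennreal (norm (ft ?a s * H s)) \<partial>lborel)"
    by (cases "integrable lborel (\<lambda>s. ft ?a s * H s)")
       (auto intro: integral_norm_bound_ennreal simp: not_integrable_integral_eq)
  also have "\<dots> \<le> (\<integral>\<^sup>+s. ennreal (2 * pi) * (\<integral>\<^sup>+y. ennreal (?N y s) * 
       ((ennreal ((norm (H y))\<^sup>2) + ennreal ((norm (H s))\<^sup>2)) / 2) \<partial>lborel) \<partial>lborel)"
  proof (intro nn_integral_mono)
    fix s
    have i: "integrable lborel (\<lambda>y. of_real (?N y s) * H y)"
    proof (rule Bochner_Integration.integrable_bound[where f = "\<lambda>y. (1 / sqrt (2 * pi * e\<^sup>2)) * norm (H y)"])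
      show "AE y in lborel. norm (of_real (?N y s) * H y) \<le> norm ((1 / sqrt (2 * pi * e\<^sup>2)) * norm (H y))"
      proof (intro AE_I2)
        fix y
        have "?N y s \<le> 1 / sqrt (2 * pi * e\<^sup>2)"
          unfolding normal_density_def by (rule mult_left_le) auto
        then show "norm (of_real (?N y s) * H y) \<le> norm ((1 / sqrt (2 * pi * e\<^sup>2)) * norm (H y))"
          unfolding norm_mult norm_of_real by (intro mult_mono) auto
      qed
    qed (use H in auto)
    have "ennreal (norm (mollify e H s)) \<le> (\<integral>\<^sup>+y. ennreal (norm (of_real (?N y s) * H y)) \<partial>lborel)"
      unfolding mollify_def by (rule integral_norm_bound_ennreal[OF i])
    then have "ennreal (norm (mollify e H s)) * ennreal (norm (H s)) \<le> (\<integral>\<^sup>+y. ennreal (norm (of_real (?N y s) * H y)) \<partial>lborel)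
      * ennreal (norm (H s))"
      by (rule mult_right_mono) simp
    also have "\<dots> = (\<integral>\<^sup>+y. ennreal (?N y s) * ennreal (norm (H y) * norm (H s)) \<partial>lborel)"
      by (subst nn_integral_multc[symmetric])
         (auto simp: norm_mult ennreal_mult' ac_simps intro!: nn_integral_cong)
    also have "\<dots> \<le> (\<integral>\<^sup>+y. ennreal (?N y s) * 
       ((ennreal ((norm (H y))\<^sup>2) + ennreal ((norm (H s))\<^sup>2)) / 2) \<partial>lborel)"
      by (intro nn_integral_mono mult_left_mono ennreal_mult_le_half_sum_squares) auto
    finally have "ennreal (2 * pi) * (ennreal (norm (mollify e H s)) * ennreal (norm (H s))) \<le> ennreal (2 * pi) * \<dots>"
      by (rule mult_left_mono) simp
    moreover have "ennreal (norm (ft ?a s * H s))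
        = ennreal (2 * pi) * (ennreal (norm (mollify e H s)) * ennreal (norm (H s)))"
      unfolding fa by (simp add: norm_mult ennreal_mult' mult.assoc)
    ultimately show "ennreal (norm (ft ?a s * H s)) \<le> ennreal (2 * pi) * (\<integral>\<^sup>+y. ennreal (?N y s) * 
       ((ennreal ((norm (H y))\<^sup>2) + ennreal ((norm (H s))\<^sup>2)) / 2) \<partial>lborel)"
      by simp
  qed
  also have "\<dots> = ennreal (2 * pi) * ((\<integral>\<^sup>+s. (\<integral>\<^sup>+y. ennreal (?N y s) * ennreal ((norm (H y))\<^sup>2) / 2 \<partial>lborel) \<partial>lborel)
      + (\<integral>\<^sup>+s. (\<integral>\<^sup>+y. ennreal (?N y s) * ennreal ((norm (H s))\<^sup>2) / 2 \<partial>lborel) \<partial>lborel))"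
    by (simp add: nn_integral_cmult[symmetric] nn_integral_add[symmetric] distrib_left
        add_divide_distrib_ennreal ennreal_times_divide)
  also have "(\<integral>\<^sup>+s. (\<integral>\<^sup>+y. ennreal (?N y s) * ennreal ((norm (H s))\<^sup>2) / 2 \<partial>lborel) \<partial>lborel)
     = (\<integral>\<^sup>+s. ennreal ((norm (H s))\<^sup>2) \<partial>lborel) / 2"
    by (subst nn_integral_divide[symmetric])
       (auto simp: nn_integral_divide nn_integral_multc nn_integral_normal_density_shift e intro!: nn_integral_cong)
  also have "(\<integral>\<^sup>+s. (\<integral>\<^sup>+y. ennreal (?N y s) * ennreal ((norm (H y))\<^sup>2) / 2 \<partial>lborel) \<partial>lborel)
     = (\<integral>\<^sup>+y. (\<integral>\<^sup>+s. ennreal (?N y s) * ennreal ((norm (H y))\<^sup>2) / 2 \<partial>lborel) \<partial>lborel)"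
    by (rule lborel_pair.Fubini') measurable
  also have "\<dots> = (\<integral>\<^sup>+s. ennreal ((norm (H s))\<^sup>2) \<partial>lborel) / 2"
    by (subst nn_integral_divide[symmetric])
       (auto simp: nn_integral_divide nn_integral_multc nn_integral_normal_density_shift e intro!: nn_integral_cong)
  finally show ?thesis
    using int by (subst nn_integral_eq_integral) (auto simp: ennreal_half_add_half)
qed

lemma plancherel_upper:
  assumes H: "integrable lborel H"
  shows "(\<integral>\<^sup>+t. ennreal ((norm (ft H t))\<^sup>2) \<partial>lborel)
     \<le> ennreal (2 * pi) * (\<integral>\<^sup>+s. ennreal ((norm (H s))\<^sup>2) \<partial>lborel)"
proof -
  have [measurable]: "H \<in> borel_measurable borel" using H by auto
  let ?g = "\<lambda>n. gaussian (1 / real (Suc n))"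
  have "(\<integral>\<^sup>+t. ennreal ((norm (ft H t))\<^sup>2) \<partial>lborel)
    = (\<integral>\<^sup>+t. liminf (\<lambda>n. ennreal ((norm (ft H t))\<^sup>2 * ?g n t)) \<partial>lborel)"
  proof (intro nn_integral_cong)
    fix t
    have "(\<lambda>n. 1 / real (Suc n)) \<longlonglongrightarrow> 0"
      using LIMSEQ_inverse_real_of_nat by (simp add: inverse_eq_divide)
    then have "(\<lambda>n. ennreal ((norm (ft H t))\<^sup>2 * ?g n t)) \<longlonglongrightarrow> ennreal ((norm (ft H t))\<^sup>2 * exp (- (0 * t)\<^sup>2 / 2))"
      by (intro tendsto_ennrealI tendsto_intros) auto
    then have "(\<lambda>n. ennreal ((norm (ft H t))\<^sup>2 * ?g n t)) \<longlonglongrightarrow> ennreal ((norm (ft H t))\<^sup>2)" by simp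
    then show "ennreal ((norm (ft H t))\<^sup>2) = liminf (\<lambda>n. ennreal ((norm (ft H t))\<^sup>2 * ?g n t))"
      by (rule lim_imp_Liminf[OF sequentially_bot, symmetric])
  qed
  also have "\<dots> \<le> liminf (\<lambda>n. \<integral>\<^sup>+t. ennreal ((norm (ft H t))\<^sup>2 * ?g n t) \<partial>lborel)"
    by (rule nn_integral_liminf) measurable
  also have "\<dots> \<le> ennreal (2 * pi) * (\<integral>\<^sup>+s. ennreal ((norm (H s))\<^sup>2) \<partial>lborel)"
    by (rule Liminf_le, simp) (intro always_eventually allI plancherel_upper_gaussian[OF H], simp)
  finally show ?thesis .
qed

text \<open>The upper bound is applied to the regularized transform, whose own transform is a mollification of
\<open>H\<close>. The mollifications converge pointwise, so Fatou's lemma gives the reverse inequality.\<close>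

lemma plancherel_lower_continuous:
  assumes H: "integrable lborel H" and C: "\<And>x. norm (H x) \<le> C" and cont: "continuous_on UNIV H"
  shows "ennreal (2 * pi) * (\<integral>\<^sup>+s. ennreal ((norm (H s))\<^sup>2) \<partial>lborel)
     \<le> (\<integral>\<^sup>+t. ennreal ((norm (ft H t))\<^sup>2) \<partial>lborel)" (is "_ * ?I \<le> ?J")
proof -
  have [measurable]: "H \<in> borel_measurable borel" using H by auto
  let ?e = "\<lambda>n. 1 / real (Suc n)"
  let ?m = "\<lambda>n. mollify (?e n) H"
  let ?a = "\<lambda>n t. ft H t * complex_of_real (gaussian (?e n) t)"
  have bound: "(\<integral>\<^sup>+x. ennreal ((norm (of_real (2 * pi) * ?m n x))\<^sup>2) \<partial>lborel) \<le> ennreal (2 * pi) * ?J" for n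
  proof -
    have ia: "integrable lborel (?a n)"
      by (rule integrable_gaussian_mult[where C = "LINT x|lborel. norm (H x)"])
         (auto simp: norm_ft_le[OF H])
    then have [measurable]: "?a n \<in> borel_measurable borel" by auto
    have "(\<integral>\<^sup>+x. ennreal ((norm (of_real (2 * pi) * ?m n x))\<^sup>2) \<partial>lborel) = (\<integral>\<^sup>+x. ennreal ((norm (ft (?a n) (- x)))\<^sup>2) \<partial>lborel)"
      by (subst gaussian_inversion[OF H]) auto
    also have "\<dots> = (\<integral>\<^sup>+x. ennreal ((norm (ft (?a n) x))\<^sup>2) \<partial>lborel)"
      using nn_integral_real_affine[of "\<lambda>x. ennreal ((norm (ft (?a n) x))\<^sup>2)" "-1" 0] by simp
    also have "\<dots> \<le> ennreal (2 * pi) * (\<integral>\<^sup>+t. ennreal ((norm (?a n t))\<^sup>2) \<partial>lborel)"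
      by (rule plancherel_upper[OF ia])
    also have "\<dots> \<le> ennreal (2 * pi) * ?J"
      by (intro mult_left_mono nn_integral_mono ennreal_leI power_mono) (auto simp: norm_mult mult_left_le)
    finally show ?thesis .
  qed
  have [measurable]: "?m n \<in> borel_measurable borel" for n
    unfolding mollify_def by measurable
  have "ennreal (2 * pi) * (ennreal (2 * pi) * ?I) = (\<integral>\<^sup>+x. ennreal ((norm (of_real (2 * pi) * H x))\<^sup>2) \<partial>lborel)"
    by (simp add: nn_integral_cmult[symmetric] ennreal_mult'[symmetric] norm_mult power2_eq_square ac_simps)
  also have "\<dots> = (\<integral>\<^sup>+x. liminf (\<lambda>n. ennreal ((norm (of_real (2 * pi) * ?m n x))\<^sup>2)) \<partial>lborel)"
  proof (intro nn_integral_cong)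
    fix x
    have "(\<lambda>n. ennreal ((norm (of_real (2 * pi) * ?m n x))\<^sup>2)) \<longlonglongrightarrow> ennreal ((norm (of_real (2 * pi) * H x))\<^sup>2)"
      by (intro tendsto_ennrealI tendsto_intros mollify_tendsto[OF _ C])
         (use cont in \<open>auto simp: continuous_on_eq_continuous_at\<close>)
    then show "ennreal ((norm (of_real (2 * pi) * H x))\<^sup>2) = liminf (\<lambda>n. ennreal ((norm (of_real (2 * pi) * ?m n x))\<^sup>2))"
      by (rule lim_imp_Liminf[OF sequentially_bot, symmetric])
  qed
  also have "\<dots> \<le> liminf (\<lambda>n. \<integral>\<^sup>+x. ennreal ((norm (of_real (2 * pi) * ?m n x))\<^sup>2) \<partial>lborel)"
    by (rule nn_integral_liminf) measurable
  also have "\<dots> \<le> ennreal (2 * pi) * ?J"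
    by (rule Liminf_le, simp) (intro always_eventually allI bound)
  finally show ?thesis
    by (subst (asm) ennreal_mult_le_mult_iff) auto
qed

text \<open>Averaging over short intervals reduces the lower bound to continuous functions: it makes \<open>H\<close> bounded
and continuous, it multiplies the transform by a factor of modulus at most one, and the averages
converge back to \<open>H\<close> almost everywhere by Lebesgue's differentiation theorem.\<close>

definition box_average :: "real \<Rightarrow> (real \<Rightarrow> complex) \<Rightarrow> real \<Rightarrow> complex" where
  "box_average h H x = (LINT s|lborel. indicator {0..h} s *\<^sub>R H (x + s)) /\<^sub>R h"

lemma box_average_shift:
  "box_average h H x = (LINT s:{x..x + h}|lborel. H s) /\<^sub>R h"
proof -
  have "(LINT s|lborel. indicator {x..x + h} s *\<^sub>R H s) 
     = (LINT s|lborel. indicator {x..x + h} (x + s) *\<^sub>R H (x + s))"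
    using lborel_integral_real_affine[of 1 "\<lambda>s. indicator {x..x + h} s *\<^sub>R H s" x] by simp
  also have "(\<lambda>s. indicator {x..x + h} (x + s) *\<^sub>R H (x + s)) = (\<lambda>s. indicator {0..h} s *\<^sub>R H (x + s))"
    by (auto simp: indicator_def)
  finally show ?thesis unfolding box_average_def set_lebesgue_integral_def by simp
qed

lemma norm_box_average_le:
  assumes H: "integrable lborel H" and h: "h > 0"
  shows "norm (box_average h H x) \<le> (LINT x|lborel. norm (H x)) / h"
proof -
  have "norm (LINT s:{x..x + h}|lborel. H s) \<le> (LINT s|lborel. norm (indicator {x..x + h} s *\<^sub>R H s))"
    unfolding set_lebesgue_integral_def by (rule integral_norm_bound)
  also have "\<dots> \<le> (LINT x|lborel. norm (H x))"
  proof (rule integral_mono)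
    show "integrable lborel (\<lambda>s. norm (indicator {x..x + h} s *\<^sub>R H s))"
      by (intro integrable_norm integrable_mult_indicator H) auto
  qed (use H in \<open>auto simp: indicator_def\<close>)
  finally show ?thesis using h by (simp add: box_average_shift divide_right_mono field_simps)
qed

lemma continuous_box_average:
  assumes H: "integrable lborel H" and h: "h > 0"
  shows "continuous_on UNIV (box_average h H)"
proof -
  have [measurable]: "H \<in> borel_measurable borel" using H by auto
  have "(\<lambda>n. LINT s:{X n..X n + h}|lborel. H s) \<longlonglongrightarrow> (LINT s:{x..x + h}|lborel. H s)" if X: "X \<longlonglongrightarrow> x" for X x
    unfolding set_lebesgue_integral_def
  proof (rule integral_dominated_convergence[where w = "\<lambda>s. norm (H s)"])
    have "AE s in lborel. s \<noteq> x \<and> s \<noteq> x + h"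
      using AE_lborel_singleton[of x] AE_lborel_singleton[of "x + h"] by auto
    then show "AE s in lborel. (\<lambda>n. indicator {X n..X n + h} s *\<^sub>R H s) \<longlonglongrightarrow> indicator {x..x + h} s *\<^sub>R H s"
    proof eventually_elim
      case (elim s)
      have Xh: "(\<lambda>n. X n + h) \<longlonglongrightarrow> x + h" using X by (intro tendsto_intros)
      have "eventually (\<lambda>n. (s \<in> {X n..X n + h}) = (s \<in> {x..x + h})) sequentially"
      proof -
        consider "s < x" | "x < s" "s < x + h" | "x + h < s" using elim by linarith
        then show ?thesis
        proof cases
          case 1
          then show ?thesis using order_tendstoD(1)[OF X 1] by (auto elim!: eventually_mono)
        next
          case 2
          show ?thesis using order_tendstoD(2)[OF X 2(1)] order_tendstoD(1)[OF Xh 2(2)] 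
            by eventually_elim (use 2 in auto)
        next
          case 3
          then show ?thesis using order_tendstoD(2)[OF Xh 3] by (auto elim!: eventually_mono)
        qed
      qed
      then have "eventually (\<lambda>n. indicator {X n..X n + h} s *\<^sub>R H s = indicator {x..x + h} s *\<^sub>R H s) sequentially"
        by eventually_elim (auto simp: indicator_def)
      then show ?case by (rule tendsto_eventually)
    qed
  qed (use H in \<open>auto simp: indicator_def\<close>)
  then have "isCont (box_average h H) x" for x
    unfolding box_average_shift[abs_def] continuous_at_sequentially
    by (auto simp: comp_def intro!: tendsto_intros)
  then show ?thesis by (simp add: continuous_on_eq_continuous_at)
qed

lemma integrable_box_average_pair:
  assumes H: "integrable lborel H"
  shows "integrable (lborel \<Otimes>\<^sub>M lborel) (\<lambda>(s, x). cis (t * x) * (indicator {0..h} s *\<^sub>R H (x + s)))"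
proof -
  have [measurable]: "H \<in> borel_measurable borel" using H by auto
  have sh: "integrable lborel (\<lambda>x. H (x + s))" for s
    using lborel_integrable_real_affine[OF H, of 1 s] by (simp add: add.commute)
  have shn: "(LINT x|lborel. norm (H (x + s))) = (LINT x|lborel. norm (H x))" for s
    using lborel_integral_real_affine[of 1 "\<lambda>x. norm (H x)" s] by (simp add: add.commute)
  show ?thesis
  proof (rule lborel_pair.Fubini_integrable)
    have "(\<lambda>s. LINT x|lborel. norm (case (s, x) of (s, x) \<Rightarrow> cis (t * x) * (indicator {0..h} s *\<^sub>R H (x + s))))
        = (\<lambda>s. indicator {0..h} s * (LINT x|lborel. norm (H x)))"
      by (auto simp: norm_mult shn)
    then show "integrable lborel (\<lambda>s. LINT x|lborel. norm (case (s, x) of (s, x) \<Rightarrow> cis (t * x) * (indicator {0..h} s *\<^sub>R H (x + s))))"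
      by (auto simp: emeasure_lborel_Icc_eq)
    show "AE s in lborel. integrable lborel (\<lambda>x. case (s, x) of (s, x) \<Rightarrow> cis (t * x) * (indicator {0..h} s *\<^sub>R H (x + s)))"
      by (auto intro!: integrable_cis_mult integrable_scaleR_right sh)
  qed measurable
qed

lemma integrable_box_average:
  assumes H: "integrable lborel H"
  shows "integrable lborel (box_average h H)"
  using lborel_pair.integrable_snd[OF integrable_box_average_pair[OF H, of 0 h]]
  unfolding box_average_def[abs_def] by auto

text \<open>Translating \<open>H\<close> by \<open>s\<close> multiplies the transform by \<open>cis (- t s)\<close>, so averaging over \<open>s\<close> multiplies it
by an average of numbers of modulus one.\<close>

lemma norm_ft_box_average_le:
  assumes H: "integrable lborel H" and h: "h > 0"
  shows "norm (ft (box_average h H) t) \<le> norm (ft H t)"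
proof -
  have [measurable]: "H \<in> borel_measurable borel" using H by auto
  have sh: "(LINT x|lborel. cis (t * x) * (indicator {0..h} s *\<^sub>R H (x + s))) = (indicator {0..h} s *\<^sub>R cis (- t * s)) * ft H t" for s
  proof -
    have "(LINT x|lborel. cis (t * x) * (indicator {0..h} s *\<^sub>R H (x + s)))
      = (LINT x|lborel. (indicator {0..h} s *\<^sub>R cis (- t * s)) * (cis (t * (s + x)) * H (s + x)))"
      by (intro Bochner_Integration.integral_cong) (auto simp: mult.assoc[symmetric] cis_mult distrib_left add.commute)
    also have "\<dots> = (indicator {0..h} s *\<^sub>R cis (- t * s)) * (LINT x|lborel. cis (t * (s + x)) * H (s + x))"
      by (rule integral_mult_right_zero)
    also have "(LINT x|lborel. cis (t * (s + x)) * H (s + x)) = ft H t"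
      unfolding ft_def using lborel_integral_real_affine[of 1 "\<lambda>x. cis (t * x) * H x" s] by simp
    finally show ?thesis .
  qed
  have "ft (box_average h H) t = (LINT x|lborel. (LINT s|lborel. cis (t * x) * (indicator {0..h} s *\<^sub>R H (x + s))) /\<^sub>R h)"
  proof -
    have "cis (t * x) * ((LINT s|lborel. indicator {0..h} s *\<^sub>R H (x + s)) /\<^sub>R h)
       = (LINT s|lborel. cis (t * x) * (indicator {0..h} s *\<^sub>R H (x + s))) /\<^sub>R h" for x
      by (subst integral_mult_right_zero) simp
    then show ?thesis unfolding ft_def box_average_def by (simp only:)
  qed
  also have "\<dots> = (LINT x|lborel. (LINT s|lborel. cis (t * x) * (indicator {0..h} s *\<^sub>R H (x + s)))) /\<^sub>R h"
    by simp
  also have "(LINT x|lborel. (LINT s|lborel. cis (t * x) * (indicator {0..h} s *\<^sub>R H (x + s))))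
    = (LINT s|lborel. (LINT x|lborel. cis (t * x) * (indicator {0..h} s *\<^sub>R H (x + s))))"
    by (rule lborel_pair.Fubini_integral[OF integrable_box_average_pair[OF H]])
  also have "\<dots> = (LINT s|lborel. indicator {0..h} s *\<^sub>R cis (- t * s)) * ft H t"
    unfolding sh by (rule integral_mult_left_zero)
  finally have "norm (ft (box_average h H) t) = norm (LINT s|lborel. indicator {0..h} s *\<^sub>R cis (- t * s)) * norm (ft H t) / h"
    using h by (simp add: norm_mult field_simps)
  also have "norm (LINT s|lborel. indicator {0..h} s *\<^sub>R cis (- t * s)) \<le> (LINT s|lborel. norm (indicator {0..h} s *\<^sub>R cis (- t * s)))"
    by (rule integral_norm_bound)
  also have "\<dots> = h" using h by simp
  finally show ?thesis using h by (simp add: mult_right_mono divide_right_mono field_simps)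
qed

lemma box_average_tendsto_AE:
  assumes H: "integrable lborel H"
  shows "AE x in lborel. (\<lambda>n. box_average (1 / real (Suc n)) H x) \<longlonglongrightarrow> H x"
proof -
  have "H integrable_on cbox a b" for a b
    using H by (metis integrable_on_lborel integrable_on_subcbox subset_UNIV)
  then obtain N where N: "negligible N"
    and lim: "\<And>x e. \<lbrakk>x \<notin> N; 0 < e\<rbrakk> \<Longrightarrow> \<exists>d>0. \<forall>h. 0 < h \<and> h < d \<longrightarrow>
                  norm (integral (cbox x (x + h *\<^sub>R One)) H /\<^sub>R h ^ DIM(real) - H x) < e"
    using integrable_ccontinuous_explicit[of H] by metis
  have eq: "integral (cbox x (x + h *\<^sub>R One)) H /\<^sub>R h ^ DIM(real) = box_average h H x" for x h
    unfolding box_average_shift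
    by (subst set_borel_integral_eq_integral) (use H in \<open>auto simp: set_integrable_def intro!: integrable_mult_indicator\<close>)
  have "AE x in lebesgue. x \<notin> N"
    using N by (simp add: AE_not_in negligible_iff_null_sets)
  then have "AE x in lborel. x \<notin> N" by (simp add: AE_completion_iff)
  then show ?thesis
  proof eventually_elim
    case (elim x)
    show ?case
    proof (rule LIMSEQ_I)
      fix e :: real assume "e > 0"
      then obtain d where d: "d > 0" "\<And>h. 0 < h \<Longrightarrow> h < d \<Longrightarrow> norm (box_average h H x - H x) < e"
        using lim[OF elim] unfolding eq by metis
      obtain n0 where n0: "1 / real (Suc n0) < d"
        using reals_Archimedean[OF d(1)] by (auto simp: inverse_eq_divide)
      have "norm (box_average (1 / real (Suc n)) H x - H x) < e" if "n \<ge> n0" for n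
      proof (rule d(2))
        have "1 / real (Suc n) \<le> 1 / real (Suc n0)" using that by (simp add: frac_le)
        then show "1 / real (Suc n) < d" using n0 by linarith
      qed simp
      then show "\<exists>n0. \<forall>n\<ge>n0. norm (box_average (1 / real (Suc n)) H x - H x) < e" by blast
    qed
  qed
qed

theorem plancherel:
  assumes H: "integrable lborel H"
  shows "(\<integral>\<^sup>+t. ennreal ((norm (ft H t))\<^sup>2) \<partial>lborel)
     = ennreal (2 * pi) * (\<integral>\<^sup>+s. ennreal ((norm (H s))\<^sup>2) \<partial>lborel)"
proof (rule antisym)
  have [measurable]: "H \<in> borel_measurable borel" using H by auto
  let ?b = "\<lambda>n. box_average (1 / real (Suc n)) H"
  have [measurable]: "?b n \<in> borel_measurable borel" for n
    using integrable_box_average[OF H] by auto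
  have "ennreal (2 * pi) * (\<integral>\<^sup>+s. ennreal ((norm (H s))\<^sup>2) \<partial>lborel)
     = (\<integral>\<^sup>+x. liminf (\<lambda>n. ennreal (2 * pi) * ennreal ((norm (?b n x))\<^sup>2)) \<partial>lborel)"
  proof (subst nn_integral_cmult[symmetric], simp, intro nn_integral_cong_AE)
    show "AE x in lborel. ennreal (2 * pi) * ennreal ((norm (H x))\<^sup>2) = liminf (\<lambda>n. ennreal (2 * pi) * ennreal ((norm (?b n x))\<^sup>2))"
      using box_average_tendsto_AE[OF H]
    proof eventually_elim
      case (elim x)
      then have "(\<lambda>n. ennreal (2 * pi) * ennreal ((norm (?b n x))\<^sup>2)) \<longlonglongrightarrow> ennreal (2 * pi) * ennreal ((norm (H x))\<^sup>2)"
        by (intro ennreal_tendsto_cmult tendsto_ennrealI tendsto_intros) auto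
      then show ?case by (rule lim_imp_Liminf[OF sequentially_bot, symmetric])
    qed
  qed
  also have "\<dots> \<le> liminf (\<lambda>n. \<integral>\<^sup>+x. ennreal (2 * pi) * ennreal ((norm (?b n x))\<^sup>2) \<partial>lborel)"
    by (rule nn_integral_liminf) measurable
  also have "\<dots> \<le> (\<integral>\<^sup>+t. ennreal ((norm (ft H t))\<^sup>2) \<partial>lborel)"
  proof (rule Liminf_le, simp, intro always_eventually allI)
    fix n
    have "(\<integral>\<^sup>+x. ennreal (2 * pi) * ennreal ((norm (?b n x))\<^sup>2) \<partial>lborel) \<le> (\<integral>\<^sup>+t. ennreal ((norm (ft (?b n) t))\<^sup>2) \<partial>lborel)"
      by (subst nn_integral_cmult)
         (auto intro!: plancherel_lower_continuous integrable_box_average continuous_box_average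
            norm_box_average_le H simp del: of_nat_Suc)
    also have "\<dots> \<le> (\<integral>\<^sup>+t. ennreal ((norm (ft H t))\<^sup>2) \<partial>lborel)"
      by (intro nn_integral_mono ennreal_leI power_mono norm_ft_box_average_le H) auto
    finally show "(\<integral>\<^sup>+x. ennreal (2 * pi) * ennreal ((norm (?b n x))\<^sup>2) \<partial>lborel) \<le> (\<integral>\<^sup>+t. ennreal ((norm (ft H t))\<^sup>2) \<partial>lborel)" .
  qed
  finally show "ennreal (2 * pi) * (\<integral>\<^sup>+s. ennreal ((norm (H s))\<^sup>2) \<partial>lborel) \<le> (\<integral>\<^sup>+t. ennreal ((norm (ft H t))\<^sup>2) \<partial>lborel)" .
qed (rule plancherel_upper[OF H])

section \<open>Oscillatory integrals with a nonlinear phase\<close>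

text \<open>The transforms above are taken with respect to \<open>lborel\<close>, the evolution with respect to its
completion. The next three lemmas pass from one to the other.\<close>

lemma borel_version:
  fixes F :: "'a::euclidean_space \<Rightarrow> complex"
  assumes "F \<in> borel_measurable lebesgue"
  obtains F' where "F' \<in> borel_measurable borel" "AE x in lborel. F x = F' x"
proof -
  have "(\<lambda>x. Re (F x)) \<in> borel_measurable lebesgue" "(\<lambda>x. Im (F x)) \<in> borel_measurable lebesgue"
    using assms by simp_all
  then obtain a b where [measurable]: "a \<in> borel_measurable lborel" "b \<in> borel_measurable lborel"
    and ae: "AE x in lborel. Re (F x) = a x" "AE x in lborel. Im (F x) = b x"
    using completion_ex_borel_measurable_real by metis
  show ?thesis
  proof
    show "(\<lambda>x. Complex (a x) (b x)) \<in> borel_measurable borel"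
      unfolding Complex_eq by measurable
    show "AE x in lborel. F x = Complex (a x) (b x)"
      using ae by eventually_elim (simp add: complex_eq_iff)
  qed
qed

lemma nn_integral_lebesgue_eq:
  assumes "F' \<in> borel_measurable borel" "AE x in lborel. F x = F' x"
  shows "(\<integral>\<^sup>+x. F x \<partial>lebesgue) = (\<integral>\<^sup>+x. F' x \<partial>lborel)"
proof -
  have "(\<integral>\<^sup>+x. F x \<partial>lebesgue) = (\<integral>\<^sup>+x. F' x \<partial>lebesgue)"
    by (intro nn_integral_cong_AE AE_completion assms)
  then show ?thesis using assms by (simp add: nn_integral_completion)
qed

lemma borel_version_integral:
  fixes F F' :: "'a::euclidean_space \<Rightarrow> complex"
  assumes F': "F' \<in> borel_measurable borel" and ae: "AE x in lborel. F x = F' x"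
  shows "integrable lebesgue F \<longleftrightarrow> integrable lborel F'" "integral\<^sup>L lebesgue F = integral\<^sup>L lborel F'"
proof -
  have F'l: "F' \<in> borel_measurable lebesgue" using F' by (intro measurable_completion) simp
  have m: "F \<in> borel_measurable lebesgue"
  proof (rule measurableI)
    fix X :: "complex set" assume "X \<in> sets borel"
    then have X: "F' -` X \<inter> space lebesgue \<in> sets lebesgue" using F'l by (intro measurable_sets)
    show "F -` X \<inter> space lebesgue \<in> sets lebesgue"
    proof (rule completion.in_sets_AE[OF _ X])
      show "AE x in lebesgue. x \<in> F' -` X \<inter> space lebesgue \<longleftrightarrow> x \<in> F -` X \<inter> space lebesgue"
        by (rule AE_completion) (use ae in eventually_elim, simp)
    qed simp
  qed simp
  have "integrable lebesgue F \<longleftrightarrow> integrable lebesgue F'"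
    by (intro integrable_cong_AE m AE_completion ae F'l)
  then show "integrable lebesgue F \<longleftrightarrow> integrable lborel F'"
    using F' by (simp add: integrable_completion)
  have "integral\<^sup>L lebesgue F = integral\<^sup>L lebesgue F'"
    by (intro integral_cong_AE m AE_completion ae F'l)
  then show "integral\<^sup>L lebesgue F = integral\<^sup>L lborel F'"
    using F' by (simp add: integral_completion)
qed

lemma lebesgue_absolutely_integrable_iff:
  fixes u :: "real \<Rightarrow> 'b::euclidean_space"
  assumes "\<And>x. x \<notin> S \<Longrightarrow> u x = 0"
  shows "u absolutely_integrable_on S \<longleftrightarrow> integrable lebesgue u"
    "integrable lebesgue u \<Longrightarrow> integral S u = integral\<^sup>L lebesgue u"
proof -
  have eq: "(\<lambda>x. indicator S x *\<^sub>R u x) = u" using assms by (auto simp: indicator_def)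
  show iff: "u absolutely_integrable_on S \<longleftrightarrow> integrable lebesgue u"
    unfolding set_integrable_def eq ..
  assume "integrable lebesgue u"
  then have "(LINT x:S|lebesgue. u x) = integral S u"
    using iff by (intro set_lebesgue_integral_eq_integral(2)) simp
  then show "integral S u = integral\<^sup>L lebesgue u"
    unfolding set_lebesgue_integral_def eq by simp
qed

text \<open>The substitution rule in a form that also covers the failure of integrability on both sides. It is
used for complex integrands and for their squared moduli.\<close>

lemma change_of_variables_lebesgue:
  fixes u v :: "real \<Rightarrow> 'b::euclidean_space"
  assumes S: "S \<in> sets lebesgue" and der: "\<And>x. (f has_real_derivative f' x) (at x)"
    and inj: "inj_on f S"
    and u: "\<And>y. y \<notin> f ` S \<Longrightarrow> u y = 0" and v: "\<And>x. x \<notin> S \<Longrightarrow> v x = 0"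
    and eq: "\<And>x. x \<in> S \<Longrightarrow> \<bar>f' x\<bar> *\<^sub>R u (f x) = v x"
  shows "integrable lebesgue u \<longleftrightarrow> integrable lebesgue v"
    "integral\<^sup>L lebesgue u = integral\<^sup>L lebesgue v"
proof -
  have d: "\<And>x. x \<in> S \<Longrightarrow> (f has_field_derivative f' x) (at x within S)"
    using der has_field_derivative_at_within by blast
  have "(\<lambda>x. \<bar>f' x\<bar> *\<^sub>R u (f x)) absolutely_integrable_on S \<longleftrightarrow> v absolutely_integrable_on S"
    unfolding set_integrable_def
    by (intro Bochner_Integration.integrable_cong refl) (auto simp: eq indicator_def)
  then show iff: "integrable lebesgue u \<longleftrightarrow> integrable lebesgue v"
    using absolutely_integrable_change_of_variables_real[OF S d inj, of u]
      lebesgue_absolutely_integrable_iff(1)[of "f ` S" u, OF u] lebesgue_absolutely_integrable_iff(1)[of S v, OF v]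
    by blast
  show "integral\<^sup>L lebesgue u = integral\<^sup>L lebesgue v"
  proof (cases "integrable lebesgue u")
    case True
    have "integral S (\<lambda>x. \<bar>f' x\<bar> *\<^sub>R u (f x)) = integral (f ` S) u"
      using has_absolute_integral_change_of_variables_real[OF S d inj, of u "integral (f ` S) u"] True
        lebesgue_absolutely_integrable_iff(1)[of "f ` S" u, OF u] by blast
    moreover have "integral S (\<lambda>x. \<bar>f' x\<bar> *\<^sub>R u (f x)) = integral S v"
      by (intro Henstock_Kurzweil_Integration.integral_cong) (auto simp: eq)
    ultimately show ?thesis
      using lebesgue_absolutely_integrable_iff(2)[of "f ` S" u, OF u] lebesgue_absolutely_integrable_iff(2)[of S v, OF v]
        True iff by simp
  next
    case False
    then show ?thesis using iff by (simp add: not_integrable_integral_eq)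
  qed
qed

text \<open>Where \<open>f' \<noteq> 0\<close> the substitution \<open>\<eta> = f(x)\<close> carries \<open>h(x) dx\<close> to \<open>H(\<eta>) d\<eta>\<close> with
\<open>H(f(x)) = h(x) / \<bar>f'(x)\<bar>\<close>. The oscillatory integral becomes \<open>ft H\<close>, and one of the two factors
\<open>1 / \<bar>f'\<bar>\<close> in \<open>\<bar>H\<bar>\<^sup>2\<close> is used up when the substitution is undone in \<open>plancherel\<close>.\<close>

lemma oscillatory_plancherel:
  assumes h: "integrable lborel h" and der: "\<And>x. (f has_real_derivative f' x) (at x)"
    and [measurable]: "f' \<in> borel_measurable borel" "T \<in> sets borel" and inj: "inj_on f T"
    and supp: "AE x in lborel. h x \<noteq> 0 \<longrightarrow> x \<in> T \<and> f' x \<noteq> 0"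
  shows "(\<integral>\<^sup>+t. ennreal ((norm (LINT x|lborel. cis (t * f x) * h x))\<^sup>2) \<partial>lborel)
     = ennreal (2 * pi) * (\<integral>\<^sup>+x. ennreal ((norm (h x))\<^sup>2 / \<bar>f' x\<bar>) \<partial>lborel)"
proof -
  have [measurable]: "h \<in> borel_measurable borel" using h by auto
  have "continuous_on UNIV f" using der DERIV_isCont by (auto simp: continuous_on_eq_continuous_at)
  then have [measurable]: "f \<in> borel_measurable borel" by (rule borel_measurable_continuous_onI)
  define S where "S = {x \<in> T. f' x \<noteq> 0}"
  have S[measurable]: "S \<in> sets borel" unfolding S_def by measurable
  have injS: "inj_on f S" using inj by (rule inj_on_subset) (auto simp: S_def)
  \<comment> \<open>discarding a null set makes the support condition hold everywhere\<close>
  define k where "k x = (if x \<in> S then h x else 0)" for x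
  have hk: "AE x in lborel. h x = k x" using supp by eventually_elim (auto simp: k_def S_def)
  have k_meas[measurable]: "k \<in> borel_measurable borel" unfolding k_def by measurable
  have k: "integrable lborel k"
    by (rule integrable_cong_AE_imp[OF h]) (use hk in \<open>auto simp: eq_commute\<close>)
  define H where "H y = (if y \<in> f ` S then k (the_inv_into S f y) /\<^sub>R \<bar>f' (the_inv_into S f y)\<bar> else 0)" for y
  have Hf: "H (f x) = k x /\<^sub>R \<bar>f' x\<bar>" if "x \<in> S" for x
    using that injS by (simp add: H_def the_inv_into_f_f)
  have H0: "H y = 0" if "y \<notin> f ` S" for y using that by (simp add: H_def)
  have k0: "k x = 0" if "x \<notin> S" for x using that by (simp add: k_def)
  have f'0: "f' x \<noteq> 0" if "x \<in> S" for x using that by (simp add: S_def)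
  have Sl: "S \<in> sets lebesgue" by (simp add: S sets_completionI_sets)
  note cov = change_of_variables_lebesgue[OF Sl der injS]
  have kl: "integrable lebesgue k" using k by (simp add: integrable_completion)
  have "integrable lebesgue H \<longleftrightarrow> integrable lebesgue k"
    by (rule cov) (auto simp: H0 k0 Hf f'0)
  then have Hl: "integrable lebesgue H" using kl by simp
  obtain G where G_meas[measurable]: "G \<in> borel_measurable borel" and HG: "AE y in lborel. H y = G y"
    using borel_version[of H] borel_measurable_integrable[OF Hl] by blast
  have G: "integrable lborel G" using borel_version_integral(1)[OF G_meas HG] Hl by simp
  have ftG: "ft G t = (LINT x|lborel. cis (t * f x) * h x)" for t
  proof -
    have "ft G t = (LINT y|lebesgue. cis (t * y) * H y)"
      unfolding ft_def using HG by (intro borel_version_integral(2)[symmetric]) auto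
    also have "\<dots> = (LINT x|lebesgue. cis (t * f x) * k x)"
      by (rule cov) (auto simp: H0 k0 Hf f'0)
    also have "\<dots> = (LINT x|lborel. cis (t * f x) * k x)"
      by (intro integral_completion) measurable
    also have "\<dots> = (LINT x|lborel. cis (t * f x) * h x)"
      using hk by (intro integral_cong_AE) auto
    finally show ?thesis .
  qed
  let ?u = "\<lambda>y. (norm (H y))\<^sup>2" and ?v = "\<lambda>x. (norm (k x))\<^sup>2 / \<bar>f' x\<bar>"
  have um: "?u \<in> borel_measurable lebesgue" using Hl by auto
  have vm: "?v \<in> borel_measurable lebesgue" by (intro measurable_completion) measurable
  have uv: "\<bar>f' x\<bar> *\<^sub>R ?u (f x) = ?v x" if "x \<in> S" for x
    using f'0[OF that] by (simp add: Hf[OF that] power_mult_distrib power2_eq_square field_simps)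
  have uv_int: "integrable lebesgue ?u \<longleftrightarrow> integrable lebesgue ?v" "integral\<^sup>L lebesgue ?u = integral\<^sup>L lebesgue ?v"
    by (rule cov, auto simp: H0 k0 uv simp del: real_scaleR_def)+
  have "(\<integral>\<^sup>+y. ennreal (?u y) \<partial>lebesgue) = (\<integral>\<^sup>+x. ennreal (?v x) \<partial>lebesgue)"
  proof (cases "integrable lebesgue ?u")
    case True
    then show ?thesis using uv_int by (simp add: nn_integral_eq_integral)
  next
    case False
    then have "(\<integral>\<^sup>+y. ennreal (?u y) \<partial>lebesgue) = \<infinity>" "(\<integral>\<^sup>+x. ennreal (?v x) \<partial>lebesgue) = \<infinity>"
      using uv_int um vm by (auto simp: integrable_iff_bounded less_top[symmetric])
    then show ?thesis by simp
  qed
  also have "(\<integral>\<^sup>+y. ennreal (?u y) \<partial>lebesgue) = (\<integral>\<^sup>+y. ennreal ((norm (G y))\<^sup>2) \<partial>lborel)"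
    by (rule nn_integral_lebesgue_eq) (use HG in \<open>auto elim: eventually_mono\<close>)
  also have "(\<integral>\<^sup>+x. ennreal (?v x) \<partial>lebesgue) = (\<integral>\<^sup>+x. ennreal ((norm (h x))\<^sup>2 / \<bar>f' x\<bar>) \<partial>lborel)"
    by (rule nn_integral_lebesgue_eq) (use hk in \<open>auto elim: eventually_mono\<close>)
  finally show ?thesis
    using plancherel[OF G] by (simp add: ftG)
qed

lemma oscillatory_comparison:
  assumes h: "integrable lborel h" and k: "integrable lborel k"
    and f: "\<And>x. (f has_real_derivative f' x) (at x)" "f' \<in> borel_measurable borel" "inj_on f T"
    and g: "\<And>x. (g has_real_derivative g' x) (at x)" "g' \<in> borel_measurable borel" "inj_on g T"
    and T: "T \<in> sets borel"
    and supp: "AE x in lborel. h x \<noteq> 0 \<longrightarrow> x \<in> T \<and> f' x \<noteq> 0" "AE x in lborel. k x \<noteq> 0 \<longrightarrow> x \<in> T \<and> g' x \<noteq> 0"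
    and le: "AE x in lborel. (norm (h x))\<^sup>2 / \<bar>f' x\<bar> \<le> A\<^sup>2 * ((norm (k x))\<^sup>2 / \<bar>g' x\<bar>)"
  shows "(\<integral>\<^sup>+t. ennreal ((norm (LINT x|lborel. cis (t * f x) * h x))\<^sup>2) \<partial>lborel)
    \<le> ennreal (A\<^sup>2) * (\<integral>\<^sup>+t. ennreal ((norm (LINT x|lborel. cis (t * g x) * k x))\<^sup>2) \<partial>lborel)"
proof -
  have [measurable]: "h \<in> borel_measurable borel" "k \<in> borel_measurable borel" "f' \<in> borel_measurable borel" "g' \<in> borel_measurable borel"
    using h k f g by auto
  have "(\<integral>\<^sup>+x. ennreal ((norm (h x))\<^sup>2 / \<bar>f' x\<bar>) \<partial>lborel) \<le> (\<integral>\<^sup>+x. ennreal (A\<^sup>2) * ennreal ((norm (k x))\<^sup>2 / \<bar>g' x\<bar>) \<partial>lborel)"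
    by (intro nn_integral_mono_AE, use le in eventually_elim) (auto simp: ennreal_mult'[symmetric] intro!: ennreal_leI)
  also have "\<dots> = ennreal (A\<^sup>2) * (\<integral>\<^sup>+x. ennreal ((norm (k x))\<^sup>2 / \<bar>g' x\<bar>) \<partial>lborel)"
    by (rule nn_integral_cmult) measurable
  finally have "ennreal (2 * pi) * (\<integral>\<^sup>+x. ennreal ((norm (h x))\<^sup>2 / \<bar>f' x\<bar>) \<partial>lborel)
    \<le> ennreal (2 * pi) * (ennreal (A\<^sup>2) * (\<integral>\<^sup>+x. ennreal ((norm (k x))\<^sup>2 / \<bar>g' x\<bar>) \<partial>lborel))"
    by (rule mult_left_mono) simp
  then show ?thesis
    unfolding oscillatory_plancherel[OF h f(1,2) T f(3) supp(1)] oscillatory_plancherel[OF k g(1,2) T g(3) supp(2)]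
    by (simp only: mult.left_commute)
qed

section \<open>Separating one frequency variable\<close>

lemma exp_i_eq_cis: "exp (\<i> * complex_of_real r) = cis r" "exp (- (\<i> * complex_of_real r)) = cis (- r)"
  by (simp_all add: cis_conv_exp)

lemma fourier_measurable:
  fixes \<phi> :: "'a::euclidean_space \<Rightarrow> complex"
  assumes "integrable lebesgue \<phi>"
  shows "fourier \<phi> \<in> borel_measurable borel"
proof -
  obtain \<phi>' where [measurable]: "\<phi>' \<in> borel_measurable borel" and ae: "AE x in lborel. \<phi> x = \<phi>' x"
    using borel_version[of \<phi>] borel_measurable_integrable[OF assms] by blast
  have "fourier \<phi> \<xi> = (LINT x|lborel. cis (- (x \<bullet> \<xi>)) * \<phi>' x)" for \<xi>
    unfolding fourier_def exp_i_eq_cis using ae by (intro borel_version_integral(2)) auto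
  then have "fourier \<phi> = (\<lambda>\<xi>. LINT x|lborel. cis (- (x \<bullet> \<xi>)) * \<phi>' x)" by auto
  then show ?thesis by simp
qed

lemma evolution_borel:
  fixes \<phi> :: "'a::euclidean_space \<Rightarrow> complex"
  assumes [measurable]: "p \<in> borel_measurable borel" "f \<in> borel_measurable borel" "K \<in> borel_measurable borel"
    and K: "AE \<xi> in lborel. chi (p \<xi>) * m (p \<xi>) * fourier \<phi> \<xi> = K \<xi>"
  shows "evolution p chi m f \<phi> t x
    = of_real (1 / (2 * pi) ^ DIM('a)) * (LINT \<xi>|lborel. cis (x \<bullet> \<xi>) * (cis (t * f (p \<xi>)) * K \<xi>))"
  unfolding evolution_def fourier_multiplier_def exp_i_eq_cis
  by (rule arg_cong[where f = "\<lambda>z. _ * z"], rule borel_version_integral(2), measurable)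
     (use K in \<open>eventually_elim, simp add: ac_simps\<close>)

lemma nn_integral_translate:
  fixes F :: "'a::euclidean_space \<Rightarrow> ennreal"
  assumes [measurable]: "F \<in> borel_measurable borel"
  shows "(\<integral>\<^sup>+x. F (c + x) \<partial>lborel) = (\<integral>\<^sup>+x. F x \<partial>lborel)"
  by (subst (2) lborel_distr_plus[of c, symmetric]) (simp add: nn_integral_distr)

text \<open>Frequencies are split into the coordinate along \<open>b\<close> and the rest without changing the space: the map
\<open>replace_coord b\<close> gives the point \<open>\<xi>\<close> the new coordinate \<open>\<eta>\<close>, and \<open>\<xi>\<close> is kept in a strip of width one so
that its forgotten coordinate contributes the factor one. The image of this measure is Lebesgue
measure (\<open>distr_replace_coord\<close>), by Fubini's theorem and translation invariance.\<close>

definition replace_coord :: "'a::euclidean_space \<Rightarrow> real \<times> 'a \<Rightarrow> 'a" where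
  "replace_coord b = (\<lambda>(\<eta>, \<xi>). \<xi> + (\<eta> - \<xi> \<bullet> b) *\<^sub>R b)"

definition strip_measure :: "'a::euclidean_space \<Rightarrow> (real \<times> 'a) measure" where
  "strip_measure b = density (lborel \<Otimes>\<^sub>M lborel) (\<lambda>(\<eta>, \<xi>). ennreal (indicator {0..1} (\<xi> \<bullet> b)))"

lemma replace_coord_measurable [measurable]: "replace_coord b \<in> borel_measurable (borel \<Otimes>\<^sub>M borel)"
  unfolding replace_coord_def by measurable

lemma replace_coord_inner: "b \<in> Basis \<Longrightarrow> replace_coord b (\<eta>, \<xi>) \<bullet> b = \<eta>"
  by (simp add: replace_coord_def inner_simps)

lemma nn_integral_replace_coord:
  fixes F :: "'a::euclidean_space \<Rightarrow> ennreal"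
  assumes b: "b \<in> Basis" and [measurable]: "F \<in> borel_measurable borel"
  shows "(\<integral>\<^sup>+\<eta>. (\<integral>\<^sup>+\<xi>. ennreal (indicator {0..1} (\<xi> \<bullet> b)) * F (replace_coord b (\<eta>, \<xi>)) \<partial>lborel) \<partial>lborel)
    = (\<integral>\<^sup>+\<xi>. F \<xi> \<partial>lborel)"
proof -
  let ?\<rho> = "\<lambda>r::real. ennreal (indicator {0..1} r)"
  have "(\<integral>\<^sup>+\<eta>. (\<integral>\<^sup>+\<xi>. ?\<rho> (\<xi> \<bullet> b) * F (replace_coord b (\<eta>, \<xi>)) \<partial>lborel) \<partial>lborel)
    = (\<integral>\<^sup>+\<xi>. (\<integral>\<^sup>+\<eta>. ?\<rho> (\<xi> \<bullet> b) * F (\<xi> + (\<eta> - \<xi> \<bullet> b) *\<^sub>R b) \<partial>lborel) \<partial>lborel)"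
    unfolding replace_coord_def split by (rule lborel_pair.Fubini') measurable
  also have "\<dots> = (\<integral>\<^sup>+\<xi>. (\<integral>\<^sup>+\<eta>. ?\<rho> (\<xi> \<bullet> b) * F (\<xi> + \<eta> *\<^sub>R b) \<partial>lborel) \<partial>lborel)"
  proof (rule nn_integral_cong)
    fix \<xi> :: 'a
    show "(\<integral>\<^sup>+\<eta>. ?\<rho> (\<xi> \<bullet> b) * F (\<xi> + (\<eta> - \<xi> \<bullet> b) *\<^sub>R b) \<partial>lborel) = (\<integral>\<^sup>+\<eta>. ?\<rho> (\<xi> \<bullet> b) * F (\<xi> + \<eta> *\<^sub>R b) \<partial>lborel)"
      using nn_integral_real_affine[of "\<lambda>\<eta>. ?\<rho> (\<xi> \<bullet> b) * F (\<xi> + (\<eta> - \<xi> \<bullet> b) *\<^sub>R b)" 1 "\<xi> \<bullet> b"]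
      by simp
  qed
  also have "\<dots> = (\<integral>\<^sup>+\<eta>. (\<integral>\<^sup>+\<xi>. ?\<rho> (\<xi> \<bullet> b) * F (\<xi> + \<eta> *\<^sub>R b) \<partial>lborel) \<partial>lborel)"
    by (rule lborel_pair.Fubini') measurable
  also have "\<dots> = (\<integral>\<^sup>+\<eta>. (\<integral>\<^sup>+\<xi>. ?\<rho> (\<xi> \<bullet> b - \<eta>) * F \<xi> \<partial>lborel) \<partial>lborel)"
  proof (rule nn_integral_cong)
    fix \<eta> :: real
    show "(\<integral>\<^sup>+\<xi>. ?\<rho> (\<xi> \<bullet> b) * F (\<xi> + \<eta> *\<^sub>R b) \<partial>lborel) = (\<integral>\<^sup>+\<xi>. ?\<rho> (\<xi> \<bullet> b - \<eta>) * F \<xi> \<partial>lborel)"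
      using nn_integral_translate[of "\<lambda>\<xi>. ?\<rho> (\<xi> \<bullet> b) * F (\<xi> + \<eta> *\<^sub>R b)" "- \<eta> *\<^sub>R b"] b by (simp add: inner_simps)
  qed
  also have "\<dots> = (\<integral>\<^sup>+\<xi>. (\<integral>\<^sup>+\<eta>. ?\<rho> (\<xi> \<bullet> b - \<eta>) * F \<xi> \<partial>lborel) \<partial>lborel)"
    by (rule lborel_pair.Fubini') measurable
  also have "\<dots> = (\<integral>\<^sup>+\<xi>. F \<xi> \<partial>lborel)"
  proof (rule nn_integral_cong)
    fix \<xi> :: 'a
    have "(\<integral>\<^sup>+\<eta>. ?\<rho> (\<xi> \<bullet> b - \<eta>) \<partial>lborel) = (\<integral>\<^sup>+\<eta>. indicator {\<xi> \<bullet> b - 1..\<xi> \<bullet> b} \<eta> \<partial>lborel)"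
      by (intro nn_integral_cong) (auto simp: indicator_def)
    then show "(\<integral>\<^sup>+\<eta>. ?\<rho> (\<xi> \<bullet> b - \<eta>) * F \<xi> \<partial>lborel) = F \<xi>"
      by (subst nn_integral_multc) auto
  qed
  finally show ?thesis .
qed

lemma distr_replace_coord:
  assumes b: "b \<in> Basis"
  shows "distr (strip_measure b) lborel (replace_coord b) = (lborel :: 'a::euclidean_space measure)"
proof (rule measure_eqI)
  fix X assume "X \<in> sets (distr (strip_measure b) lborel (replace_coord b) :: 'a measure)"
  then have [measurable]: "X \<in> sets borel" by simp
  have *: "replace_coord b -` X \<inter> space (strip_measure b) \<in> sets (lborel \<Otimes>\<^sub>M lborel)"
  proof -
    have "replace_coord b \<in> borel_measurable (lborel \<Otimes>\<^sub>M lborel)" by measurable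
    from measurable_sets[OF this, of X] show ?thesis by (simp add: strip_measure_def)
  qed
  have "emeasure (distr (strip_measure b) lborel (replace_coord b)) X
    = (\<integral>\<^sup>+z. (case z of (\<eta>, \<xi>) \<Rightarrow> ennreal (indicator {0..1} (\<xi> \<bullet> b))) * indicator (replace_coord b -` X \<inter> space (strip_measure b)) z \<partial>(lborel \<Otimes>\<^sub>M lborel))"
    using * by (subst emeasure_distr) (auto simp: strip_measure_def emeasure_density)
  also have "\<dots> = (\<integral>\<^sup>+z. (case z of (\<eta>, \<xi>) \<Rightarrow> ennreal (indicator {0..1} (\<xi> \<bullet> b)) * indicator X (replace_coord b (\<eta>, \<xi>))) \<partial>(lborel \<Otimes>\<^sub>M lborel))"
    by (intro nn_integral_cong) (auto simp: strip_measure_def space_pair_measure indicator_def)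
  also have "\<dots> = (\<integral>\<^sup>+\<eta>. (\<integral>\<^sup>+\<xi>. ennreal (indicator {0..1} (\<xi> \<bullet> b)) * indicator X (replace_coord b (\<eta>, \<xi>)) \<partial>lborel) \<partial>lborel)"
    by (subst lborel.nn_integral_fst[symmetric]) auto
  also have "\<dots> = (\<integral>\<^sup>+\<xi>. indicator X \<xi> \<partial>lborel)"
    by (rule nn_integral_replace_coord[OF b]) auto
  finally show "emeasure (distr (strip_measure b) lborel (replace_coord b)) X = emeasure lborel X"
    by simp
qed simp

lemma AE_replace_coord:
  assumes b: "b \<in> Basis" and [measurable]: "Measurable.pred borel P" and P: "AE \<xi> in lborel. P \<xi>"
  shows "AE \<eta> in lborel. AE \<xi> in lborel. \<xi> \<bullet> b \<in> {0..1} \<longrightarrow> P (replace_coord b (\<eta>, \<xi>))"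
proof -
  have "AE \<xi> in distr (strip_measure b) lborel (replace_coord b). P \<xi>"
    unfolding distr_replace_coord[OF b] by (rule P)
  then have "AE z in strip_measure b. P (replace_coord b z)"
    by (subst (asm) AE_distr_iff) (auto simp: strip_measure_def)
  then have "AE z in lborel \<Otimes>\<^sub>M lborel. 0 < (case z of (\<eta>, \<xi>) \<Rightarrow> ennreal (indicator {0..1} (\<xi> \<bullet> b))) \<longrightarrow> P (replace_coord b z)"
    unfolding strip_measure_def by (subst (asm) AE_density) auto
  then have "AE z in lborel \<Otimes>\<^sub>M lborel. snd z \<bullet> b \<in> {0..1} \<longrightarrow> P (replace_coord b z)"
    by eventually_elim (auto simp: indicator_def)
  from lborel_pair.AE_pair[OF this] show ?thesis by simp
qed

lemma AE_inner_Basis: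
  assumes b: "b \<in> Basis" and P: "AE \<eta> in lborel. P \<eta>"
  shows "AE \<xi> in (lborel :: 'a::euclidean_space measure). P (\<xi> \<bullet> b)"
proof -
  from P obtain N where N: "N \<in> null_sets lborel" "{\<eta>. \<not> P \<eta>} \<subseteq> N"
    by (auto elim!: AE_E simp: null_sets_def)
  then have [measurable]: "N \<in> sets borel" by auto
  have "(\<integral>\<^sup>+\<xi>. indicator N (\<xi> \<bullet> b) \<partial>(lborel :: 'a measure)) =
    (\<integral>\<^sup>+\<eta>. (\<integral>\<^sup>+\<xi>. ennreal (indicator {0..1} (\<xi> \<bullet> b)) * indicator N \<eta> \<partial>(lborel :: 'a measure)) \<partial>lborel)"
    by (subst nn_integral_replace_coord[OF b, symmetric]) (auto simp: replace_coord_inner[OF b])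
  also have "\<dots> = (\<integral>\<^sup>+\<eta>. 0 \<partial>(lborel :: real measure))"
  proof (rule nn_integral_cong_AE)
    have "AE \<eta> in lborel. \<eta> \<notin> N" using N by (intro AE_not_in)
    then show "AE \<eta> in lborel. (\<integral>\<^sup>+\<xi>. ennreal (indicator {0..1} (\<xi> \<bullet> b)) * indicator N \<eta> \<partial>(lborel :: 'a measure)) = 0"
      by eventually_elim simp
  qed
  finally have "AE \<xi> in (lborel :: 'a measure). indicator N (\<xi> \<bullet> b) = (0::ennreal)"
    by (subst nn_integral_0_iff_AE[symmetric]) auto
  then show ?thesis
  proof eventually_elim
    case (elim \<xi>)
    then show ?case using N(2) by (auto simp: indicator_def split: if_splits)
  qed
qed

lemma integral_replace_coord:
  fixes F :: "'a::euclidean_space \<Rightarrow> complex"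
  assumes b: "b \<in> Basis" and F: "integrable lborel F"
  shows "integrable lborel (\<lambda>\<eta>. LINT \<xi>|lborel. indicator {0..1} (\<xi> \<bullet> b) *\<^sub>R F (replace_coord b (\<eta>, \<xi>)))"
    "(LINT \<eta>|lborel. LINT \<xi>|lborel. indicator {0..1} (\<xi> \<bullet> b) *\<^sub>R F (replace_coord b (\<eta>, \<xi>))) = integral\<^sup>L lborel F"
proof -
  have [measurable]: "F \<in> borel_measurable borel" using F by auto
  let ?\<rho> = "\<lambda>(\<eta>::real, \<xi>::'a). indicator {0..1} (\<xi> \<bullet> b) :: real"
  have strip: "strip_measure b = density (lborel \<Otimes>\<^sub>M lborel) ?\<rho>"
    unfolding strip_measure_def by (simp add: split_beta')
  have m: "replace_coord b \<in> measurable (strip_measure b) lborel"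
    by (simp add: strip_measure_def)
  have "integrable (strip_measure b) (\<lambda>z. F (replace_coord b z))"
    using F distr_replace_coord[OF b] by (subst integrable_distr_eq[OF m, symmetric]) auto
  then have i: "integrable (lborel \<Otimes>\<^sub>M lborel) (\<lambda>z. ?\<rho> z *\<^sub>R F (replace_coord b z))"
    unfolding strip by (subst (asm) integrable_density) auto
  then have i': "integrable (lborel \<Otimes>\<^sub>M lborel) (\<lambda>(\<eta>, \<xi>). indicator {0..1} (\<xi> \<bullet> b) *\<^sub>R F (replace_coord b (\<eta>, \<xi>)))"
    by (simp add: split_beta')
  show "integrable lborel (\<lambda>\<eta>. LINT \<xi>|lborel. indicator {0..1} (\<xi> \<bullet> b) *\<^sub>R F (replace_coord b (\<eta>, \<xi>)))"
    using lborel_pair.integrable_fst[OF i'] by simp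
  have "integral\<^sup>L lborel F = integral\<^sup>L (strip_measure b) (\<lambda>z. F (replace_coord b z))"
    by (subst distr_replace_coord[OF b, symmetric], rule integral_distr[OF m]) simp
  also have "\<dots> = (LINT z|(lborel \<Otimes>\<^sub>M lborel). ?\<rho> z *\<^sub>R F (replace_coord b z))"
    unfolding strip by (subst integral_density) auto
  also have "\<dots> = (LINT \<eta>|lborel. LINT \<xi>|lborel. indicator {0..1} (\<xi> \<bullet> b) *\<^sub>R F (replace_coord b (\<eta>, \<xi>)))"
    using lborel_pair.integral_fst[OF i'] by (simp add: split_beta')
  finally show "(LINT \<eta>|lborel. LINT \<xi>|lborel. indicator {0..1} (\<xi> \<bullet> b) *\<^sub>R F (replace_coord b (\<eta>, \<xi>))) = integral\<^sup>L lborel F" ..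
qed

section \<open>The estimates under the symbol bound\<close>

lemma C1_real_deriv:
  fixes f :: "real \<Rightarrow> real"
  assumes "f C1_differentiable_on UNIV"
  shows "(f has_real_derivative deriv f x) (at x)" "continuous_on UNIV (deriv f)"
proof -
  obtain D where D: "\<And>x. (f has_vector_derivative D x) (at x)" "continuous_on UNIV D"
    using assms by (auto simp: C1_differentiable_on_def)
  then have r: "(f has_real_derivative D x) (at x)" for x
    by (simp add: has_real_derivative_iff_has_vector_derivative)
  then have "deriv f = D" using DERIV_imp_deriv by blast
  with r D show "(f has_real_derivative deriv f x) (at x)" "continuous_on UNIV (deriv f)" by auto
qed

lemma L2norm_le_cmult:
  assumes "(\<integral>\<^sup>+x. ennreal ((cmod (u x))\<^sup>2) \<partial>lebesgue) \<le> ennreal (A\<^sup>2) * (\<integral>\<^sup>+x. ennreal ((cmod (v x))\<^sup>2) \<partial>lebesgue)"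
    (is "?I \<le> _ * ?J") and A: "A > 0"
  shows "L2norm u \<le> ennreal A * L2norm v"
proof (cases ?J)
  case (real b)
  then have "?I \<le> ennreal (A\<^sup>2 * b)" using assms(1) by (simp add: ennreal_mult)
  then obtain a where a: "?I = ennreal a" "0 \<le> a" "a \<le> A\<^sup>2 * b"
    using real by (cases ?I) (auto simp: top_unique)
  then have "sqrt a \<le> A * sqrt b"
    using A real_sqrt_le_mono[OF a(3)] by (simp add: real_sqrt_mult)
  then show ?thesis
    using a real A by (simp add: L2norm_def ennreal_mult[symmetric] ennreal_leI)
next
  case top
  then show ?thesis using A by (simp add: L2norm_def ennreal_mult_top)
qed

lemma nn_integral_le_of_L2norm_le:
  assumes le: "L2norm u \<le> ennreal A * L2norm v" and A: "A > 0" and fin: "L2norm u < \<infinity>" "L2norm v < \<infinity>"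
  shows "(\<integral>\<^sup>+x. ennreal ((cmod (u x))\<^sup>2) \<partial>lebesgue) \<le> ennreal (A\<^sup>2) * (\<integral>\<^sup>+x. ennreal ((cmod (v x))\<^sup>2) \<partial>lebesgue)"
    (is "?I \<le> _ * ?J") and "(\<integral>\<^sup>+x. ennreal ((cmod (u x))\<^sup>2) \<partial>lebesgue) < \<infinity>"
proof -
  obtain a b where ab: "?I = ennreal a" "0 \<le> a" "?J = ennreal b" "0 \<le> b"
    using fin by (cases ?I; cases ?J) (auto simp: L2norm_def)
  then have "sqrt a \<le> A * sqrt b"
    using le A by (simp add: L2norm_def ennreal_mult[symmetric])
  then have "(sqrt a)\<^sup>2 \<le> (A * sqrt b)\<^sup>2" by (rule power_mono) (use ab in simp)
  then show "?I \<le> ennreal (A\<^sup>2) * ?J" "?I < \<infinity>"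
    using ab by (simp_all add: ennreal_mult[symmetric] power_mult_distrib ennreal_leI)
qed

lemma nn_integral_weighted_spacetime:
  fixes u :: "real \<Rightarrow> 'a::euclidean_space \<Rightarrow> complex"
  assumes [measurable]: "case_prod u \<in> borel_measurable (borel \<Otimes>\<^sub>M borel)" "w' \<in> borel_measurable borel"
    and w: "AE x in lborel. w x = w' x"
  shows "(\<integral>\<^sup>+z. ennreal ((cmod (case z of (t, x) \<Rightarrow> w x * u t x))\<^sup>2) \<partial>lebesgue)
    = (\<integral>\<^sup>+x. ennreal ((cmod (w' x))\<^sup>2) * (\<integral>\<^sup>+t. ennreal ((cmod (u t x))\<^sup>2) \<partial>lborel) \<partial>lborel)"
proof -
  let ?F = "\<lambda>(t, x). ennreal ((cmod (w' x * u t x))\<^sup>2)"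
  have F: "?F \<in> borel_measurable (lborel \<Otimes>\<^sub>M lborel)" by measurable
  have ae: "AE z in lborel \<Otimes>\<^sub>M lborel. w (snd z :: 'a) = w' (snd (z :: real \<times> 'a))"
  proof -
    obtain N where N: "N \<in> null_sets lborel" "{x. w x \<noteq> w' x} \<subseteq> N"
      using w by (auto elim!: AE_E simp: null_sets_def)
    then have [measurable]: "N \<in> sets borel" by auto
    have "AE z in lborel \<Otimes>\<^sub>M lborel. snd (z :: real \<times> 'a) \<notin> N"
    proof (rule lborel_pair.AE_pair_measure)
      show "AE t in lborel. AE x in lborel. snd (t::real, x) \<notin> N"
        using AE_not_in[OF N(1)] by simp
    qed measurable
    then show ?thesis
    proof eventually_elim
      case (elim z)
      then show ?case using N(2) by auto
    qed
  qed
  have "(\<integral>\<^sup>+z. ennreal ((cmod (case z of (t, x) \<Rightarrow> w x * u t x))\<^sup>2) \<partial>lebesgue) = (\<integral>\<^sup>+z. ?F z \<partial>lborel)"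
  proof (rule nn_integral_lebesgue_eq)
    have "?F \<in> borel_measurable (borel \<Otimes>\<^sub>M borel)" by measurable
    then show "?F \<in> borel_measurable borel" by (simp only: borel_prod)
    show "AE z in lborel. ennreal ((cmod (case z of (t, x) \<Rightarrow> w x * u t x))\<^sup>2) = ?F z"
      unfolding lborel_prod[symmetric] using ae by eventually_elim auto
  qed
  also have "\<dots> = (\<integral>\<^sup>+x. (\<integral>\<^sup>+t. ?F (t, x) \<partial>lborel) \<partial>lborel)"
    unfolding lborel_prod[symmetric] by (rule lborel_pair.nn_integral_snd[OF F, symmetric])
  also have "\<dots> = (\<integral>\<^sup>+x. ennreal ((cmod (w' x))\<^sup>2) * (\<integral>\<^sup>+t. ennreal ((cmod (u t x))\<^sup>2) \<partial>lborel) \<partial>lborel)"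
    by (simp add: norm_mult power_mult_distrib ennreal_mult nn_integral_cmult)
  finally show ?thesis .
qed

lemma nn_integral_cmod_cmult:
  assumes [measurable]: "u \<in> borel_measurable M"
  shows "(\<integral>\<^sup>+t. ennreal ((cmod (c * u t))\<^sup>2) \<partial>M) = ennreal ((cmod c)\<^sup>2) * (\<integral>\<^sup>+t. ennreal ((cmod (u t))\<^sup>2) \<partial>M)"
  by (simp add: norm_mult power_mult_distrib ennreal_mult nn_integral_cmult)

locale symbol_pair =
  fixes f g :: "real \<Rightarrow> real" and chi \<sigma> \<tau> :: "real \<Rightarrow> complex" and A :: real
  assumes f: "f C1_differentiable_on UNIV" and g: "g C1_differentiable_on UNIV"
    and chi: "chi \<in> borel_measurable lebesgue"
    and f_inj: "inj_on f (supp chi)" and g_inj: "inj_on g (supp chi)"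
    and \<sigma>: "continuous_on UNIV \<sigma>" and \<tau>: "continuous_on UNIV \<tau>"
    and A: "A > 0"
begin

lemmas f_deriv = C1_real_deriv(1)[OF f] and g_deriv = C1_real_deriv(1)[OF g]

lemma measurable_data [measurable]:
  "f \<in> borel_measurable borel" "g \<in> borel_measurable borel"
  "deriv f \<in> borel_measurable borel" "deriv g \<in> borel_measurable borel"
  "\<sigma> \<in> borel_measurable borel" "\<tau> \<in> borel_measurable borel"
proof -
  have "continuous_on UNIV f" "continuous_on UNIV g"
    using DERIV_isCont[OF f_deriv] DERIV_isCont[OF g_deriv] by (simp_all add: continuous_on_eq_continuous_at)
  then show "f \<in> borel_measurable borel" "g \<in> borel_measurable borel"
    "deriv f \<in> borel_measurable borel" "deriv g \<in> borel_measurable borel"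
    "\<sigma> \<in> borel_measurable borel" "\<tau> \<in> borel_measurable borel"
    using C1_real_deriv(2)[OF f] C1_real_deriv(2)[OF g] \<sigma> \<tau>
    by (simp_all only: borel_measurable_continuous_onI)
qed

lemma supp_borel [measurable]: "supp chi \<in> sets borel"
  by (intro borel_closed) auto

text \<open>The squared symbol bound, multiplied by \<open>\<bar>chi C\<bar>\<^sup>2\<close>, compares the two integrands provided by
\<open>oscillatory_plancherel\<close>. The amplitudes \<open>C\<close> and \<open>D\<close> may differ by a factor of modulus one, which is
what allows different points \<open>x\<close> and \<open>x'\<close> on the line.\<close>

lemma symbol_comparison:
  assumes bound: "symbol_bound f g chi \<sigma> \<tau> A"
    and chi': "AE \<eta> in lborel. chi \<eta> = chi' \<eta>"
    and h: "integrable lborel (\<lambda>\<eta>. chi' \<eta> * \<sigma> \<eta> * C \<eta>)" and k: "integrable lborel (\<lambda>\<eta>. chi' \<eta> * \<tau> \<eta> * D \<eta>)"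
    and CD: "AE \<eta> in lborel. cmod (C \<eta>) = cmod (D \<eta>)"
    and nd: "AE \<eta> in lborel. chi' \<eta> * C \<eta> \<noteq> 0 \<longrightarrow> deriv f \<eta> \<noteq> 0 \<and> deriv g \<eta> \<noteq> 0"
  shows "(\<integral>\<^sup>+t. ennreal ((cmod (LINT \<eta>|lborel. cis (t * f \<eta>) * (chi' \<eta> * \<sigma> \<eta> * C \<eta>)))\<^sup>2) \<partial>lborel)
    \<le> ennreal (A\<^sup>2) * (\<integral>\<^sup>+t. ennreal ((cmod (LINT \<eta>|lborel. cis (t * g \<eta>) * (chi' \<eta> * \<tau> \<eta> * D \<eta>)))\<^sup>2) \<partial>lborel)"
proof (rule oscillatory_comparison[where f' = "deriv f" and g' = "deriv g" and T = "supp chi", OF h k f_deriv _ f_inj g_deriv _ g_inj])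
  have in_supp: "\<eta> \<in> supp chi" if "chi \<eta> \<noteq> 0" for \<eta>
    using closure_subset[of "{\<xi>. chi \<xi> \<noteq> 0}"] that by (simp add: subset_iff)
  show "AE \<eta> in lborel. chi' \<eta> * \<sigma> \<eta> * C \<eta> \<noteq> 0 \<longrightarrow> \<eta> \<in> supp chi \<and> deriv f \<eta> \<noteq> 0"
    using chi' nd by eventually_elim (use in_supp in auto)
  show "AE \<eta> in lborel. chi' \<eta> * \<tau> \<eta> * D \<eta> \<noteq> 0 \<longrightarrow> \<eta> \<in> supp chi \<and> deriv g \<eta> \<noteq> 0"
    using chi' nd CD by eventually_elim (use in_supp in auto)
  show "AE \<eta> in lborel. (cmod (chi' \<eta> * \<sigma> \<eta> * C \<eta>))\<^sup>2 / \<bar>deriv f \<eta>\<bar>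
      \<le> A\<^sup>2 * ((cmod (chi' \<eta> * \<tau> \<eta> * D \<eta>))\<^sup>2 / \<bar>deriv g \<eta>\<bar>)"
    using chi' nd CD
  proof eventually_elim
    case (elim \<eta>)
    show ?case
    proof (cases "chi' \<eta> * C \<eta> = 0")
      case True
      then show ?thesis using elim by auto
    next
      case False
      then have "cmod (\<sigma> \<eta>) / sqrt \<bar>deriv f \<eta>\<bar> \<le> A * (cmod (\<tau> \<eta>) / sqrt \<bar>deriv g \<eta>\<bar>)"
        using bound elim in_supp[of \<eta>] by (auto simp: symbol_bound_def)
      then have "(cmod (\<sigma> \<eta>) / sqrt \<bar>deriv f \<eta>\<bar>)\<^sup>2 \<le> (A * (cmod (\<tau> \<eta>) / sqrt \<bar>deriv g \<eta>\<bar>))\<^sup>2"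
        by (rule power_mono) simp
      then have "(cmod (\<sigma> \<eta>))\<^sup>2 / \<bar>deriv f \<eta>\<bar> \<le> A\<^sup>2 * ((cmod (\<tau> \<eta>))\<^sup>2 / \<bar>deriv g \<eta>\<bar>)"
        by (simp add: power_divide power_mult_distrib)
      then have "(cmod (chi' \<eta>) * cmod (C \<eta>))\<^sup>2 * ((cmod (\<sigma> \<eta>))\<^sup>2 / \<bar>deriv f \<eta>\<bar>)
        \<le> (cmod (chi' \<eta>) * cmod (C \<eta>))\<^sup>2 * (A\<^sup>2 * ((cmod (\<tau> \<eta>))\<^sup>2 / \<bar>deriv g \<eta>\<bar>))"
        by (rule mult_left_mono) simp
      then show ?thesis
        unfolding norm_mult elim(3)[symmetric] by (simp add: power_mult_distrib ac_simps)
    qed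
  qed
qed (intro measurable_data supp_borel)+

theorem line_estimate:
  fixes \<phi> :: "real \<Rightarrow> complex"
  assumes bound: "symbol_bound f g chi \<sigma> \<tau> A" and adm: "admissible_datum (\<lambda>\<xi>. \<xi>) f g chi \<sigma> \<tau> \<phi>"
  shows "L2norm (\<lambda>t. evolution (\<lambda>\<xi>. \<xi>) chi \<sigma> f \<phi> t x)
    \<le> ennreal A * L2norm (\<lambda>t. evolution (\<lambda>\<xi>. \<xi>) chi \<tau> g \<phi> t x')"
proof (rule L2norm_le_cmult[OF _ A])
  obtain chi' where [measurable]: "chi' \<in> borel_measurable borel" and chi': "AE \<eta> in lborel. chi \<eta> = chi' \<eta>"
    using borel_version[OF chi] by blast
  have \<phi>: "integrable lebesgue \<phi>" using adm by (simp add: admissible_datum_def)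
  note [measurable] = fourier_measurable[OF \<phi>]
  have K: "AE \<eta> in lborel. chi \<eta> * m \<eta> * fourier \<phi> \<eta> = chi' \<eta> * m \<eta> * fourier \<phi> \<eta>" for m
    using chi' by eventually_elim simp
  have int: "integrable lborel (\<lambda>\<eta>. chi' \<eta> * m \<eta> * (cis (y * \<eta>) * fourier \<phi> \<eta>))"
    if "integrable lebesgue (\<lambda>\<eta>. chi \<eta> * m \<eta> * fourier \<phi> \<eta>)" "m \<in> borel_measurable borel" for m y
  proof -
    have [measurable]: "m \<in> borel_measurable borel" by fact
    have "integrable lborel (\<lambda>\<eta>. chi' \<eta> * m \<eta> * fourier \<phi> \<eta>)"
      using borel_version_integral(1)[OF _ K[of m]] that by simp
    then have "integrable lborel (\<lambda>\<eta>. cis (y * \<eta>) * (chi' \<eta> * m \<eta> * fourier \<phi> \<eta>))"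
      by (rule integrable_cis_mult) simp
    then show ?thesis by (simp add: ac_simps)
  qed
  have eq: "(\<integral>\<^sup>+t. ennreal ((cmod (evolution (\<lambda>\<xi>. \<xi>) chi m p \<phi> t y))\<^sup>2) \<partial>lebesgue)
     = ennreal ((cmod (of_real (1 / (2 * pi))))\<^sup>2)
       * (\<integral>\<^sup>+t. ennreal ((cmod (LINT \<eta>|lborel. cis (t * p \<eta>) * (chi' \<eta> * m \<eta> * (cis (y * \<eta>) * fourier \<phi> \<eta>))))\<^sup>2) \<partial>lborel)"
    if "m \<in> borel_measurable borel" "p \<in> borel_measurable borel" for m p y
  proof -
    have [measurable]: "m \<in> borel_measurable borel" "p \<in> borel_measurable borel" by fact+
    have "evolution (\<lambda>\<xi>. \<xi>) chi m p \<phi> t y = of_real (1 / (2 * pi))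
        * (LINT \<eta>|lborel. cis (t * p \<eta>) * (chi' \<eta> * m \<eta> * (cis (y * \<eta>) * fourier \<phi> \<eta>)))" for t
      by (subst evolution_borel[where K = "\<lambda>\<eta>. chi' \<eta> * m \<eta> * fourier \<phi> \<eta>"]) (use K in \<open>auto simp: ac_simps\<close>)
    then show ?thesis
      by (simp only: nn_integral_completion) (rule nn_integral_cmod_cmult, measurable)
  qed
  have "(\<integral>\<^sup>+t. ennreal ((cmod (LINT \<eta>|lborel. cis (t * f \<eta>) * (chi' \<eta> * \<sigma> \<eta> * (cis (x * \<eta>) * fourier \<phi> \<eta>))))\<^sup>2) \<partial>lborel)
    \<le> ennreal (A\<^sup>2) * (\<integral>\<^sup>+t. ennreal ((cmod (LINT \<eta>|lborel. cis (t * g \<eta>) * (chi' \<eta> * \<tau> \<eta> * (cis (x' * \<eta>) * fourier \<phi> \<eta>))))\<^sup>2) \<partial>lborel)"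
  proof (rule symbol_comparison[OF bound chi'])
    have "AE \<eta> in lborel. chi \<eta> * fourier \<phi> \<eta> \<noteq> 0 \<longrightarrow> deriv f \<eta> \<noteq> 0 \<and> deriv g \<eta> \<noteq> 0"
      using adm by (simp add: admissible_datum_def AE_completion_iff)
    then show "AE \<eta> in lborel. chi' \<eta> * (cis (x * \<eta>) * fourier \<phi> \<eta>) \<noteq> 0 \<longrightarrow> deriv f \<eta> \<noteq> 0 \<and> deriv g \<eta> \<noteq> 0"
      using chi' by eventually_elim auto
  qed (use adm in \<open>auto simp: admissible_datum_def norm_mult intro!: int\<close>)
  from mult_left_mono[OF this, of "ennreal ((cmod (of_real (1 / (2 * pi))))\<^sup>2)"]
  show "(\<integral>\<^sup>+t. ennreal ((cmod (evolution (\<lambda>\<xi>. \<xi>) chi \<sigma> f \<phi> t x))\<^sup>2) \<partial>lebesgue)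
    \<le> ennreal (A\<^sup>2) * (\<integral>\<^sup>+t. ennreal ((cmod (evolution (\<lambda>\<xi>. \<xi>) chi \<tau> g \<phi> t x'))\<^sup>2) \<partial>lebesgue)"
    unfolding eq[OF measurable_data(5,1)] eq[OF measurable_data(6,2)] mult.left_commute[of "ennreal (A\<^sup>2)"] by simp
qed

theorem weighted_estimate:
  fixes \<phi> :: "'a::euclidean_space \<Rightarrow> complex"
  assumes b: "b \<in> Basis" and w: "w \<in> borel_measurable lebesgue"
    and bound: "symbol_bound f g chi \<sigma> \<tau> A" and adm: "admissible_datum (\<lambda>\<xi>. \<xi> \<bullet> b) f g chi \<sigma> \<tau> \<phi>"
  shows "L2norm (\<lambda>(t, x). w x * evolution (\<lambda>\<xi>. \<xi> \<bullet> b) chi \<sigma> f \<phi> t x)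
    \<le> ennreal A * L2norm (\<lambda>(t, x). w x * evolution (\<lambda>\<xi>. \<xi> \<bullet> b) chi \<tau> g \<phi> t x)"
proof (rule L2norm_le_cmult[OF _ A])
  obtain chi' where [measurable]: "chi' \<in> borel_measurable borel" and chi': "AE \<eta> in lborel. chi \<eta> = chi' \<eta>"
    using borel_version[OF chi] by blast
  obtain w' where [measurable]: "w' \<in> borel_measurable borel" and w': "AE x in lborel. w x = w' x"
    using borel_version[OF w] by blast
  have \<phi>: "integrable lebesgue \<phi>" using adm by (simp add: admissible_datum_def)
  note [measurable] = fourier_measurable[OF \<phi>]
  have chi'b: "AE \<xi> in lborel. chi (\<xi> \<bullet> b) = chi' (\<xi> \<bullet> b)"
    by (rule AE_inner_Basis[OF b chi'])
  have K: "AE \<xi> in lborel. chi (\<xi> \<bullet> b) * m (\<xi> \<bullet> b) * fourier \<phi> \<xi> = chi' (\<xi> \<bullet> b) * m (\<xi> \<bullet> b) * fourier \<phi> \<xi>" for m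
    using chi'b by eventually_elim simp
  \<comment> \<open>the amplitude left after integrating out the other frequencies; at almost every
    \<open>\<eta>\<close> where that integral diverges the factor \<open>chi' \<eta> * m \<eta>\<close> vanishes, so the default value 0 is harmless\<close>
  define C where "C x \<eta> = (LINT \<xi>|lborel. indicator {0..1} (\<xi> \<bullet> b) *\<^sub>R
     (cis (x \<bullet> replace_coord b (\<eta>, \<xi>)) * fourier \<phi> (replace_coord b (\<eta>, \<xi>))))" for x \<eta>
  let ?c = "complex_of_real (1 / (2 * pi) ^ DIM('a))"
  have reduce: "evolution (\<lambda>\<xi>. \<xi> \<bullet> b) chi m p \<phi> t x = ?c * (LINT \<eta>|lborel. cis (t * p \<eta>) * (chi' \<eta> * m \<eta> * C x \<eta>))"
      "integrable lborel (\<lambda>\<eta>. chi' \<eta> * m \<eta> * C x \<eta>)"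
      "(\<lambda>(t, x). evolution (\<lambda>\<xi>. \<xi> \<bullet> b) chi m p \<phi> t x) \<in> borel_measurable (borel \<Otimes>\<^sub>M borel)"
    if "m \<in> borel_measurable borel" "p \<in> borel_measurable borel"
      "integrable lebesgue (\<lambda>\<xi>. chi (\<xi> \<bullet> b) * m (\<xi> \<bullet> b) * fourier \<phi> \<xi>)" for m p t x
  proof -
    have [measurable]: "m \<in> borel_measurable borel" "p \<in> borel_measurable borel" by fact+
    let ?F = "\<lambda>q t \<xi>. cis (x \<bullet> \<xi>) * (cis (t * q (\<xi> \<bullet> b)) * (chi' (\<xi> \<bullet> b) * m (\<xi> \<bullet> b) * fourier \<phi> \<xi>))"
    have "integrable lborel (\<lambda>\<xi>. chi' (\<xi> \<bullet> b) * m (\<xi> \<bullet> b) * fourier \<phi> \<xi>)"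
      using borel_version_integral(1)[OF _ K[of m]] that by simp
    then have int: "integrable lborel (?F p t)" for t
      by (intro integrable_cis_mult) auto
    have slice: "(LINT \<xi>|lborel. indicator {0..1} (\<xi> \<bullet> b) *\<^sub>R ?F p t (replace_coord b (\<eta>, \<xi>)))
       = cis (t * p \<eta>) * (chi' \<eta> * m \<eta> * C x \<eta>)" for \<eta> t
    proof -
      have "(\<lambda>\<xi>. indicator {0..1} (\<xi> \<bullet> b) *\<^sub>R ?F p t (replace_coord b (\<eta>, \<xi>)))
        = (\<lambda>\<xi>. (cis (t * p \<eta>) * (chi' \<eta> * m \<eta>)) * (indicator {0..1} (\<xi> \<bullet> b) *\<^sub>R
           (cis (x \<bullet> replace_coord b (\<eta>, \<xi>)) * fourier \<phi> (replace_coord b (\<eta>, \<xi>)))))"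
        unfolding replace_coord_inner[OF b] by (auto simp: ac_simps)
      then show ?thesis unfolding C_def by (simp only: integral_mult_right_zero mult.assoc)
    qed
    show "evolution (\<lambda>\<xi>. \<xi> \<bullet> b) chi m p \<phi> t x = ?c * (LINT \<eta>|lborel. cis (t * p \<eta>) * (chi' \<eta> * m \<eta> * C x \<eta>))"
      using integral_replace_coord(2)[OF b int[of t]] unfolding slice
      by (subst evolution_borel[where K = "\<lambda>\<xi>. chi' (\<xi> \<bullet> b) * m (\<xi> \<bullet> b) * fourier \<phi> \<xi>"]) (use K in auto)
    show "integrable lborel (\<lambda>\<eta>. chi' \<eta> * m \<eta> * C x \<eta>)"
      using integral_replace_coord(1)[OF b int[of 0]] unfolding slice by simp
    have "(\<lambda>(t, x). evolution (\<lambda>\<xi>. \<xi> \<bullet> b) chi m p \<phi> t x) = (\<lambda>(t, x). ?c * (LINT \<xi>|lborel.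
         cis (x \<bullet> \<xi>) * (cis (t * p (\<xi> \<bullet> b)) * (chi' (\<xi> \<bullet> b) * m (\<xi> \<bullet> b) * fourier \<phi> \<xi>))))"
      by (subst evolution_borel[where K = "\<lambda>\<xi>. chi' (\<xi> \<bullet> b) * m (\<xi> \<bullet> b) * fourier \<phi> \<xi>"]) (use K in auto)
    then show "(\<lambda>(t, x). evolution (\<lambda>\<xi>. \<xi> \<bullet> b) chi m p \<phi> t x) \<in> borel_measurable (borel \<Otimes>\<^sub>M borel)"
      by simp
  qed
  have nd: "AE \<eta> in lborel. chi' \<eta> * C x \<eta> \<noteq> 0 \<longrightarrow> deriv f \<eta> \<noteq> 0 \<and> deriv g \<eta> \<noteq> 0" for x
  proof -
    have "AE \<xi> in lborel. chi (\<xi> \<bullet> b) * fourier \<phi> \<xi> \<noteq> 0 \<longrightarrow> deriv f (\<xi> \<bullet> b) \<noteq> 0 \<and> deriv g (\<xi> \<bullet> b) \<noteq> 0"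
      using adm by (simp add: admissible_datum_def AE_completion_iff)
    then have "AE \<xi> in lborel. chi' (\<xi> \<bullet> b) * fourier \<phi> \<xi> \<noteq> 0 \<longrightarrow> deriv f (\<xi> \<bullet> b) \<noteq> 0 \<and> deriv g (\<xi> \<bullet> b) \<noteq> 0"
      using chi'b by eventually_elim auto
    from AE_replace_coord[OF b _ this] have "AE \<eta> in lborel. AE \<xi> in lborel. \<xi> \<bullet> b \<in> {0..1} \<longrightarrow>
        chi' \<eta> * fourier \<phi> (replace_coord b (\<eta>, \<xi>)) \<noteq> 0 \<longrightarrow> deriv f \<eta> \<noteq> 0 \<and> deriv g \<eta> \<noteq> 0"
      unfolding replace_coord_inner[OF b] by simp
    then show ?thesis
    proof eventually_elim
      case (elim \<eta>)
      show ?case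
      proof (rule impI, rule ccontr)
        assume *: "chi' \<eta> * C x \<eta> \<noteq> 0" "\<not> (deriv f \<eta> \<noteq> 0 \<and> deriv g \<eta> \<noteq> 0)"
        have "C x \<eta> = 0" unfolding C_def
          by (rule integral_eq_zero_AE, use elim in eventually_elim) (use * in \<open>auto simp: indicator_def\<close>)
        with * show False by simp
      qed
    qed
  qed
  have adm': "integrable lebesgue (\<lambda>\<xi>. chi (\<xi> \<bullet> b) * \<sigma> (\<xi> \<bullet> b) * fourier \<phi> \<xi>)"
    "integrable lebesgue (\<lambda>\<xi>. chi (\<xi> \<bullet> b) * \<tau> (\<xi> \<bullet> b) * fourier \<phi> \<xi>)"
    using adm by (auto simp: admissible_datum_def)
  note rs = reduce[OF measurable_data(5,1) adm'(1)] and rt = reduce[OF measurable_data(6,2) adm'(2)]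
  have C_meas[measurable]: "C x \<in> borel_measurable borel" for x
    unfolding C_def by measurable
  have pointwise: "(\<integral>\<^sup>+t. ennreal ((cmod (evolution (\<lambda>\<xi>. \<xi> \<bullet> b) chi \<sigma> f \<phi> t x))\<^sup>2) \<partial>lborel)
    \<le> ennreal (A\<^sup>2) * (\<integral>\<^sup>+t. ennreal ((cmod (evolution (\<lambda>\<xi>. \<xi> \<bullet> b) chi \<tau> g \<phi> t x))\<^sup>2) \<partial>lborel)" for x
  proof -
    have "(\<integral>\<^sup>+t. ennreal ((cmod (LINT \<eta>|lborel. cis (t * f \<eta>) * (chi' \<eta> * \<sigma> \<eta> * C x \<eta>)))\<^sup>2) \<partial>lborel)
      \<le> ennreal (A\<^sup>2) * (\<integral>\<^sup>+t. ennreal ((cmod (LINT \<eta>|lborel. cis (t * g \<eta>) * (chi' \<eta> * \<tau> \<eta> * C x \<eta>)))\<^sup>2) \<partial>lborel)"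
      by (rule symbol_comparison[OF bound chi' rs(2) rt(2) _ nd]) simp
    then have "ennreal ((cmod ?c)\<^sup>2) * (\<integral>\<^sup>+t. ennreal ((cmod (LINT \<eta>|lborel. cis (t * f \<eta>) * (chi' \<eta> * \<sigma> \<eta> * C x \<eta>)))\<^sup>2) \<partial>lborel)
      \<le> ennreal ((cmod ?c)\<^sup>2) * (ennreal (A\<^sup>2) * (\<integral>\<^sup>+t. ennreal ((cmod (LINT \<eta>|lborel. cis (t * g \<eta>) * (chi' \<eta> * \<tau> \<eta> * C x \<eta>)))\<^sup>2) \<partial>lborel))"
      by (rule mult_left_mono) simp
    then show ?thesis
      unfolding rs(1) rt(1)
      by (subst (1 2) nn_integral_cmod_cmult) (measurable, simp only: mult.left_commute)
  qed
  have [measurable]: "(\<lambda>x. \<integral>\<^sup>+t. ennreal ((cmod (evolution (\<lambda>\<xi>. \<xi> \<bullet> b) chi \<tau> g \<phi> t x))\<^sup>2) \<partial>lborel) \<in> borel_measurable borel"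
  proof -
    have [measurable]: "(\<lambda>(x, t). evolution (\<lambda>\<xi>. \<xi> \<bullet> b) chi \<tau> g \<phi> t x) \<in> borel_measurable (borel \<Otimes>\<^sub>M borel)"
      using measurable_compose[OF measurable_pair_swap' rt(3)] by (simp add: split_beta')
    show ?thesis by measurable
  qed
  show "(\<integral>\<^sup>+z. ennreal ((cmod (case z of (t, x) \<Rightarrow> w x * evolution (\<lambda>\<xi>. \<xi> \<bullet> b) chi \<sigma> f \<phi> t x))\<^sup>2) \<partial>lebesgue)
    \<le> ennreal (A\<^sup>2) * (\<integral>\<^sup>+z. ennreal ((cmod (case z of (t, x) \<Rightarrow> w x * evolution (\<lambda>\<xi>. \<xi> \<bullet> b) chi \<tau> g \<phi> t x))\<^sup>2) \<partial>lebesgue)"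
    unfolding nn_integral_weighted_spacetime[OF rs(3) \<open>w' \<in> borel_measurable borel\<close> w']
      nn_integral_weighted_spacetime[OF rt(3) \<open>w' \<in> borel_measurable borel\<close> w']
    by (subst nn_integral_cmult[symmetric], measurable)
       (intro nn_integral_mono, subst mult.left_commute, intro mult_left_mono pointwise, simp)
qed

end

section \<open>Smooth bumps and the decay of their transforms\<close>

text \<open>The functions \<open>P(1/x) exp (- 1/x)\<close>, extended by zero, form a class closed under differentiation. One
lemma about the whole class therefore replaces a treatment of derivatives of all orders.\<close>

definition flat_exp :: "real poly \<Rightarrow> real \<Rightarrow> real" where
  "flat_exp P x = (if x > 0 then poly P (1 / x) * exp (- (1 / x)) else 0)"

definition flat_deriv :: "real poly \<Rightarrow> real poly" where
  "flat_deriv P = [:0, 0, 1:] * (P - pderiv P)"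

lemma flat_exp_tendsto_0: "(flat_exp P \<longlongrightarrow> 0) (at 0)"
proof -
  have "((\<lambda>y. \<Sum>i\<le>degree P. coeff P i * (y ^ i / exp y)) \<longlongrightarrow> (0::real)) at_top"
    by (intro tendsto_null_sum tendsto_mult_right_zero tendsto_power_div_exp_0)
  moreover have "(\<lambda>y. \<Sum>i\<le>degree P. coeff P i * (y ^ i / exp y)) = (\<lambda>y. poly P y * exp (- y))"
    by (auto simp: poly_altdef sum_distrib_right exp_minus divide_inverse mult.assoc)
  ultimately have "((\<lambda>y. poly P y * exp (- y)) \<longlongrightarrow> 0) at_top" by simp
  from filterlim_compose[OF this filterlim_inverse_at_top_right]
  have lim: "((\<lambda>x. poly P (1 / x) * exp (- (1 / x))) \<longlongrightarrow> 0) (at_right 0)"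
    by (simp add: inverse_eq_divide)
  have "eventually (\<lambda>x. poly P (1 / x) * exp (- (1 / x)) = flat_exp P x) (at_right 0)"
    unfolding eventually_at_right_field by (auto simp: flat_exp_def intro: exI[of _ 1])
  then have "(flat_exp P \<longlongrightarrow> 0) (at_right 0)" using lim by (rule Lim_transform_eventually[rotated])
  moreover have "(flat_exp P \<longlongrightarrow> 0) (at_left 0)"
  proof (rule tendsto_eventually)
    show "eventually (\<lambda>x. flat_exp P x = 0) (at_left 0)"
      unfolding eventually_at_left_field by (auto simp: flat_exp_def intro: exI[of _ "-1"])
  qed
  ultimately show ?thesis by (simp add: filterlim_at_split)
qed

text \<open>At the origin the difference quotient is again a function of the class, with \<open>P\<close> multiplied by the
variable, so it tends to zero.\<close>

lemma flat_exp_has_derivative: "(flat_exp P has_real_derivative flat_exp (flat_deriv P) x) (at x)"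
proof -
  consider "x < 0" | "x = 0" | "x > 0" by linarith
  then show ?thesis
  proof cases
    case 1
    then have "((\<lambda>_. 0) has_real_derivative flat_exp (flat_deriv P) x) (at x)"
      by (simp add: flat_exp_def)
    then show ?thesis
      by (rule has_field_derivative_transform_within_open[where S = "{..<0}"]) (use 1 in \<open>auto simp: flat_exp_def\<close>)
  next
    case 2
    have "(flat_exp ([:0, 1:] * P) \<longlongrightarrow> 0) (at 0)" by (rule flat_exp_tendsto_0)
    moreover have "flat_exp ([:0, 1:] * P) = (\<lambda>h. (flat_exp P (0 + h) - flat_exp P 0) / h)"
      by (auto simp: flat_exp_def)
    ultimately show ?thesis
      using 2 unfolding DERIV_def by (simp add: flat_exp_def)
  next
    case 3
    have "((\<lambda>x. poly P (1 / x) * exp (- (1 / x))) has_real_derivative flat_exp (flat_deriv P) x) (at x)"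
      using 3 by (auto intro!: derivative_eq_intros poly_DERIV simp: flat_exp_def flat_deriv_def field_simps power2_eq_square)
    then show ?thesis
      by (rule has_field_derivative_transform_within_open[where S = "{0<..}"]) (use 3 in \<open>auto simp: flat_exp_def\<close>)
  qed
qed

text \<open>For \<open>P = Q = 1\<close> this is the usual bump on \<open>(l, r)\<close>; the other polynomials occur in its derivatives.\<close>

definition bump :: "real \<Rightarrow> real \<Rightarrow> real poly \<Rightarrow> real poly \<Rightarrow> real \<Rightarrow> real" where
  "bump l r P Q s = flat_exp P (s - l) * flat_exp Q (r - s)"

lemma bump_zero: "s \<notin> {l<..<r} \<Longrightarrow> bump l r P Q s = 0"
  by (auto simp: bump_def flat_exp_def)

lemma bump_pos: "l < s \<Longrightarrow> s < r \<Longrightarrow> bump l r 1 1 s > 0"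
  by (simp add: bump_def flat_exp_def)

lemma bump_has_derivative:
  "(bump l r P Q has_real_derivative bump l r (flat_deriv P) Q s - bump l r P (flat_deriv Q) s) (at s)"
proof -
  have 1: "((\<lambda>s. flat_exp P (s - l)) has_real_derivative flat_exp (flat_deriv P) (s - l)) (at s)"
  proof -
    have "((\<lambda>s. s - l) has_real_derivative 1) (at s)" by (auto intro!: derivative_eq_intros)
    from DERIV_chain2[where f = "flat_exp P" and g = "\<lambda>s. s - l", OF flat_exp_has_derivative this] show ?thesis by simp
  qed
  have 2: "((\<lambda>s. flat_exp Q (r - s)) has_real_derivative - flat_exp (flat_deriv Q) (r - s)) (at s)"
  proof -
    have "((\<lambda>s. r - s) has_real_derivative - 1) (at s)" by (auto intro!: derivative_eq_intros)
    from DERIV_chain2[where f = "flat_exp Q" and g = "\<lambda>s. r - s", OF flat_exp_has_derivative this] show ?thesis by simp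
  qed
  show ?thesis
    unfolding bump_def[abs_def] using DERIV_mult[OF 1 2] by (simp add: algebra_simps)
qed

lemma bump_continuous: "continuous_on A (bump l r P Q)"
  by (meson DERIV_isCont bump_has_derivative continuous_at_imp_continuous_on)

lemma bump_measurable [measurable]: "bump l r P Q \<in> borel_measurable borel"
  by (intro borel_measurable_continuous_onI bump_continuous)

lemma integrable_bump_mult:
  fixes k :: "real \<Rightarrow> complex"
  assumes "continuous_on {l..r} k"
  shows "integrable lborel (\<lambda>s. k s * of_real (bump l r P Q s))"
proof -
  have "integrable lborel (\<lambda>s. indicator {l..r} s *\<^sub>R (k s * of_real (bump l r P Q s)))"
    by (intro borel_integrable_compact continuous_intros assms bump_continuous) simp
  also have "(\<lambda>s. indicator {l..r} s *\<^sub>R (k s * of_real (bump l r P Q s))) = (\<lambda>s. k s * of_real (bump l r P Q s))"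
    using bump_zero[of _ l r P Q] by (fastforce simp: indicator_def)
  finally show ?thesis .
qed

lemma integrable_bump: "integrable lborel (\<lambda>s. complex_of_real (bump l r P Q s))"
  using integrable_bump_mult[of l r "\<lambda>_. 1"] by simp

lemma bump_bounded: "\<exists>C. \<forall>s. \<bar>bump l r P Q s\<bar> \<le> C"
proof -
  have "bounded (bump l r P Q ` {l..r})"
    by (intro compact_imp_bounded compact_continuous_image bump_continuous) simp
  then obtain C where C: "\<And>s. s \<in> {l..r} \<Longrightarrow> \<bar>bump l r P Q s\<bar> \<le> C"
    unfolding bounded_iff by (metis imageI real_norm_def)
  have "\<bar>bump l r P Q s\<bar> \<le> max C 0" for s
  proof (cases "s \<in> {l..r}")
    case True
    then show ?thesis using C[OF True] by simp
  next
    case False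
    then show ?thesis by (subst bump_zero) auto
  qed
  then show ?thesis by blast
qed

abbreviation ft_bump :: "real \<Rightarrow> real \<Rightarrow> real poly \<Rightarrow> real poly \<Rightarrow> real \<Rightarrow> complex" where
  "ft_bump l r P Q \<equiv> ft (\<lambda>s. of_real (bump l r P Q s))"

lemma ft_bump_by_parts:
  assumes "l \<le> r"
  shows "\<i> * of_real x * ft_bump l r P Q x = ft_bump l r P (flat_deriv Q) x - ft_bump l r (flat_deriv P) Q x"
proof -
  let ?G = "\<lambda>P Q s. complex_of_real (bump l r P Q s)"
  let ?f = "\<lambda>s. \<i> * of_real x * (cis (x * s) * ?G P Q s) + (cis (x * s) * ?G (flat_deriv P) Q s - cis (x * s) * ?G P (flat_deriv Q) s)"
  have i: "integrable lborel (\<lambda>s. cis (x * s) * ?G P Q s)" for P Q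
    by (intro integrable_cis_mult integrable_bump) simp
  have der: "((\<lambda>s. cis (x * s) * ?G P Q s) has_vector_derivative ?f s) (at s within {l..r})" for s
  proof -
    have 1: "((\<lambda>s. ?G P Q s) has_vector_derivative of_real (bump l r (flat_deriv P) Q s - bump l r P (flat_deriv Q) s)) (at s)"
      using bump_has_derivative by (intro has_vector_derivative_of_real) (simp add: has_real_derivative_iff_has_vector_derivative)
    have 2: "((\<lambda>s. cis (x * s)) has_vector_derivative (\<i> * of_real x * cis (x * s))) (at s)"
    proof -
      have "((\<lambda>z. exp (\<i> * of_real x * z)) has_field_derivative \<i> * of_real x * exp (\<i> * of_real x * of_real s)) (at (complex_of_real s))"
        by (auto intro!: derivative_eq_intros)
      from has_vector_derivative_real_field[OF this, of UNIV] show ?thesis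
        unfolding cis_conv_exp of_real_mult mult.assoc .
    qed
    have eq: "cis (x * s) * of_real (bump l r (flat_deriv P) Q s - bump l r P (flat_deriv Q) s)
        + \<i> * of_real x * cis (x * s) * ?G P Q s = ?f s"
      by (simp add: right_diff_distrib mult.assoc)
    show ?thesis
      using has_vector_derivative_mult[OF 2 1] unfolding eq by (rule has_vector_derivative_at_within)
  qed
  have "0 = (LINT s|lborel. indicator {l..r} s *\<^sub>R ?f s)"
  proof -
    have "(LINT s|lborel. indicator {l..r} s *\<^sub>R ?f s) = cis (x * r) * ?G P Q r - cis (x * l) * ?G P Q l"
      by (rule integral_FTC_atLeastAtMost[OF assms der]) (intro continuous_intros bump_continuous)
    then show ?thesis by (simp add: bump_zero)
  qed
  also have "(\<lambda>s. indicator {l..r} s *\<^sub>R ?f s) = ?f"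
    using bump_zero[of _ l r] by (fastforce simp: indicator_def)
  also have "(LINT s|lborel. ?f s) = \<i> * of_real x * ft_bump l r P Q x + (ft_bump l r (flat_deriv P) Q x - ft_bump l r P (flat_deriv Q) x)"
    unfolding ft_def using i by simp
  finally show ?thesis by (simp add: algebra_simps)
qed

text \<open>Each integration by parts gains a factor \<open>1 / \<bar>x\<bar>\<close> and stays within the class, so the induction runs
over all polynomials at once.\<close>

lemma ft_bump_decay:
  assumes "l \<le> r"
  shows "\<exists>C. \<forall>x. \<bar>x\<bar> ^ n * cmod (ft_bump l r P Q x) \<le> C"
proof (induction n arbitrary: P Q)
  case 0
  show ?case using norm_ft_le[OF integrable_bump, of l r P Q] by (intro exI) (auto intro: order_trans)
next
  case (Suc n)
  obtain C where C: "\<And>x. \<bar>x\<bar> ^ n * cmod (ft_bump l r P (flat_deriv Q) x) \<le> C" using Suc by blast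
  obtain D where D: "\<And>x. \<bar>x\<bar> ^ n * cmod (ft_bump l r (flat_deriv P) Q x) \<le> D" using Suc by blast
  have "\<bar>x\<bar> ^ Suc n * cmod (ft_bump l r P Q x) \<le> C + D" for x
  proof -
    have "\<bar>x\<bar> ^ Suc n * cmod (ft_bump l r P Q x) = \<bar>x\<bar> ^ n * cmod (\<i> * of_real x * ft_bump l r P Q x)"
      by (simp add: norm_mult)
    also have "\<dots> = \<bar>x\<bar> ^ n * cmod (ft_bump l r P (flat_deriv Q) x - ft_bump l r (flat_deriv P) Q x)"
      by (simp only: ft_bump_by_parts[OF assms])
    also have "\<dots> \<le> \<bar>x\<bar> ^ n * (cmod (ft_bump l r P (flat_deriv Q) x) + cmod (ft_bump l r (flat_deriv P) Q x))"
      by (intro mult_left_mono norm_triangle_ineq4) simp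
    also have "\<dots> \<le> C + D" using C[of x] D[of x] by (simp add: distrib_left)
    finally show ?thesis .
  qed
  then show ?case by blast
qed

lemma integrable_moment_ft_bump:
  assumes "l \<le> r"
  shows "integrable lborel (\<lambda>x. of_real ((1 + \<bar>x\<bar>) ^ k) * ft_bump l r P Q x)"
proof -
  let ?u = "ft_bump l r P Q"
  obtain C where C: "\<And>x. \<bar>x\<bar> ^ (k + 2) * cmod (?u x) \<le> C" using ft_bump_decay[OF assms] by blast
  obtain D where D: "\<And>x. \<bar>x\<bar> ^ 0 * cmod (?u x) \<le> D" using ft_bump_decay[OF assms] by blast
  have bound: "(1 + \<bar>x\<bar>) ^ k * cmod (?u x) \<le> 2 ^ (k + 2) * (C + D) * inverse (1 + x\<^sup>2)" for x
  proof -
    have "(1 + \<bar>x\<bar>) ^ (k + 2) \<le> (2 * max 1 \<bar>x\<bar>) ^ (k + 2)" by (intro power_mono) auto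
    also have "\<dots> = 2 ^ (k + 2) * max 1 \<bar>x\<bar> ^ (k + 2)" by (rule power_mult_distrib)
    also have "max 1 \<bar>x\<bar> ^ (k + 2) \<le> 1 + \<bar>x\<bar> ^ (k + 2)" by (auto simp: max_def)
    finally have *: "(1 + \<bar>x\<bar>) ^ (k + 2) \<le> 2 ^ (k + 2) * (1 + \<bar>x\<bar> ^ (k + 2))" by simp
    have "(1 + \<bar>x\<bar>) ^ k * (1 + x\<^sup>2) \<le> (1 + \<bar>x\<bar>) ^ k * (1 + \<bar>x\<bar>)\<^sup>2"
      by (intro mult_left_mono) (auto simp: power2_eq_square algebra_simps)
    also have "\<dots> = (1 + \<bar>x\<bar>) ^ (k + 2)" by (rule power_add[symmetric])
    also note *
    finally have "(1 + \<bar>x\<bar>) ^ k * (1 + x\<^sup>2) * cmod (?u x) \<le> 2 ^ (k + 2) * (1 + \<bar>x\<bar> ^ (k + 2)) * cmod (?u x)"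
      by (rule mult_right_mono) simp
    also have "\<dots> = 2 ^ (k + 2) * (cmod (?u x) + \<bar>x\<bar> ^ (k + 2) * cmod (?u x))" by (simp add: algebra_simps)
    also have "\<dots> \<le> 2 ^ (k + 2) * (C + D)" using C[of x] D[of x] by (intro mult_left_mono) auto
    finally have "((1 + \<bar>x\<bar>) ^ k * cmod (?u x)) * (1 + x\<^sup>2) \<le> 2 ^ (k + 2) * (C + D)" by (simp add: ac_simps)
    moreover have "1 + x\<^sup>2 > 0" by (simp add: add_pos_nonneg)
    ultimately show ?thesis by (simp add: divide_inverse[symmetric] pos_le_divide_eq)
  qed
  have "integrable lborel (\<lambda>x. inverse (1 + x\<^sup>2) :: real)"
    using integrable_inverse_1_plus_square by (simp add: set_integrable_def)
  then have "integrable lborel (\<lambda>x. 2 ^ (k + 2) * (C + D) * inverse (1 + x\<^sup>2) :: real)"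
    by (rule integrable_mult_right)
  then show ?thesis
  proof (rule Bochner_Integration.integrable_bound)
    show "AE x in lborel. norm (of_real ((1 + \<bar>x\<bar>) ^ k) * ?u x) \<le> norm (2 ^ (k + 2) * (C + D) * inverse (1 + x\<^sup>2) :: real)"
    proof (intro AE_I2)
      fix x :: real
      have "norm (complex_of_real ((1 + \<bar>x\<bar>) ^ k) * ?u x) = (1 + \<bar>x\<bar>) ^ k * cmod (?u x)"
        unfolding norm_mult norm_of_real by simp
      also have "\<dots> \<le> norm (2 ^ (k + 2) * (C + D) * inverse (1 + x\<^sup>2))"
        using bound[of x] by (simp only: real_norm_def order_trans[OF _ abs_ge_self])
      finally show "norm (of_real ((1 + \<bar>x\<bar>) ^ k) * ?u x) \<le> norm (2 ^ (k + 2) * (C + D) * inverse (1 + x\<^sup>2) :: real)" .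
    qed
  qed measurable
qed

lemma integrable_ft_bump: "l \<le> r \<Longrightarrow> integrable lborel (ft_bump l r P Q)"
  using integrable_moment_ft_bump[of l r 0] by simp

text \<open>The limit of \<open>gaussian_inversion\<close> as the Gaussian factor tends to one.\<close>

theorem fourier_inversion:
  assumes H: "integrable lborel H" and C: "\<And>x. norm (H x) \<le> C" and cont: "continuous_on UNIV H"
    and u: "integrable lborel (ft H)"
  shows "ft (ft H) (- x) = of_real (2 * pi) * H x"
proof -
  have [measurable]: "H \<in> borel_measurable borel" using H by auto
  let ?e = "\<lambda>n. 1 / real (Suc n)"
  let ?a = "\<lambda>n t. ft H t * of_real (gaussian (?e n) t)"
  have e0: "?e \<longlonglongrightarrow> 0"
    using LIMSEQ_inverse_real_of_nat by (simp add: inverse_eq_divide)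
  have "(\<lambda>n. ft (?a n) (- x)) \<longlonglongrightarrow> ft (ft H) (- x)"
    unfolding ft_def[of "?a _"] ft_def[of "ft H"]
  proof (rule integral_dominated_convergence[where w = "\<lambda>t. norm (ft H t)"])
    show "AE t in lborel. (\<lambda>n. cis (- x * t) * ?a n t) \<longlonglongrightarrow> cis (- x * t) * ft H t"
    proof (intro AE_I2)
      fix t
      have "(\<lambda>n. cis (- x * t) * ?a n t) \<longlonglongrightarrow> cis (- x * t) * (ft H t * of_real (exp (- (0 * t)\<^sup>2 / 2)))"
        by (intro tendsto_intros e0) auto
      then show "(\<lambda>n. cis (- x * t) * ?a n t) \<longlonglongrightarrow> cis (- x * t) * ft H t" by simp
    qed
    show "AE t in lborel. norm (cis (- x * t) * ?a n t) \<le> norm (ft H t)" for n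
      by (intro AE_I2) (simp add: norm_mult mult_left_le)
  qed (use u in auto)
  moreover have "(\<lambda>n. ft (?a n) (- x)) \<longlonglongrightarrow> of_real (2 * pi) * H x"
  proof -
    have "ft (?a n) (- x) = of_real (2 * pi) * mollify (?e n) H x" for n
      by (rule gaussian_inversion[OF H]) simp
    moreover have "(\<lambda>n. of_real (2 * pi) * mollify (?e n) H x) \<longlonglongrightarrow> of_real (2 * pi) * H x"
      using cont by (intro tendsto_intros mollify_tendsto[OF _ C]) (auto simp: continuous_on_eq_continuous_at)
    ultimately show ?thesis by (simp only:)
  qed
  ultimately show ?thesis by (rule LIMSEQ_unique)
qed

lemma ft_ft_bump:
  assumes "l \<le> r"
  shows "ft (ft_bump l r P Q) (- x) = of_real (2 * pi) * of_real (bump l r P Q x)"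
proof -
  obtain C where "\<And>s. \<bar>bump l r P Q s\<bar> \<le> C" using bump_bounded by blast
  then show ?thesis
    by (intro fourier_inversion[where C = C] integrable_bump integrable_ft_bump assms continuous_intros bump_continuous) auto
qed

section \<open>Product data\<close>

lemma lborel_prod_integral:
  fixes F :: "'a::euclidean_space \<Rightarrow> real \<Rightarrow> complex"
  assumes F: "\<And>i. i \<in> Basis \<Longrightarrow> integrable lborel (F i)"
  shows "integrable lborel (\<lambda>x::'a. \<Prod>i\<in>Basis. F i (x \<bullet> i))"
    "(LINT x|lborel. (\<Prod>i\<in>Basis. F i (x \<bullet> i))) = (\<Prod>i\<in>Basis. (LINT s|lborel. F i s))"
proof -
  interpret product_sigma_finite "\<lambda>_::'a. lborel :: real measure" ..
  have Fi: "(\<lambda>x::'a. F i (x \<bullet> i)) \<in> borel_measurable borel" if "i \<in> Basis" for i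
  proof -
    have [measurable]: "F i \<in> borel_measurable borel" using F[OF that] by auto
    show ?thesis by measurable
  qed
  let ?T = "\<lambda>f. \<Sum>i\<in>Basis. f i *\<^sub>R i :: 'a"
  have T: "?T \<in> measurable (\<Pi>\<^sub>M i\<in>Basis. lborel) borel" by measurable
  have m: "(\<lambda>x::'a. \<Prod>i\<in>Basis. F i (x \<bullet> i)) \<in> borel_measurable borel" by (rule borel_measurable_prod[OF Fi])
  have comp: "(\<lambda>f. \<Prod>i\<in>Basis. F i (?T f \<bullet> i)) = (\<lambda>f. \<Prod>i\<in>Basis. F i (f i))"
    by (intro ext prod.cong refl) simp
  show "integrable lborel (\<lambda>x::'a. \<Prod>i\<in>Basis. F i (x \<bullet> i))"
    by (subst lborel_eq, subst integrable_distr_eq[OF T m], subst comp, intro product_integrable_prod F) auto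
  show "(LINT x|lborel. (\<Prod>i\<in>Basis. F i (x \<bullet> i))) = (\<Prod>i\<in>Basis. (LINT s|lborel. F i s))"
    by (subst lborel_eq, subst integral_distr[OF T m], subst comp, intro product_integral_prod F) auto
qed

lemma cis_inner_prod:
  fixes x y :: "'a::euclidean_space"
  shows "cis (x \<bullet> y) = (\<Prod>i\<in>Basis. cis ((x \<bullet> i) * (y \<bullet> i)))"
  by (simp add: euclidean_inner[of x y] cis_conv_exp sum_distrib_left exp_sum)

text \<open>The inverse Fourier transform of the bump on \<open>(l, r)\<close>.\<close>

definition wave :: "real \<Rightarrow> real \<Rightarrow> real \<Rightarrow> complex" where
  "wave l r y = of_real (1 / (2 * pi)) * ft_bump l r 1 1 y"

definition product_datum :: "('a::euclidean_space \<Rightarrow> real) \<Rightarrow> ('a \<Rightarrow> real) \<Rightarrow> 'a \<Rightarrow> complex" where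
  "product_datum l r x = (\<Prod>i\<in>Basis. wave (l i) (r i) (x \<bullet> i))"

lemma continuous_ft:
  assumes H: "integrable lborel H"
  shows "continuous_on UNIV (ft H)"
proof -
  have [measurable]: "H \<in> borel_measurable borel" using H by auto
  have "(\<lambda>n. ft H (X n)) \<longlonglongrightarrow> ft H x" if X: "X \<longlonglongrightarrow> x" for X x
    unfolding ft_def
  proof (rule integral_dominated_convergence[where w = "\<lambda>s. norm (H s)"])
    show "AE s in lborel. (\<lambda>n. cis (X n * s) * H s) \<longlonglongrightarrow> cis (x * s) * H s"
      by (intro AE_I2 tendsto_intros X)
  qed (use H in \<open>auto simp: norm_mult\<close>)
  then have "isCont (ft H) x" for x
    unfolding continuous_at_sequentially by (auto simp: comp_def)
  then show ?thesis by (simp add: continuous_on_eq_continuous_at)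
qed

lemma wave_continuous: "continuous_on UNIV (wave l r)"
  unfolding wave_def[abs_def] by (intro continuous_intros continuous_ft integrable_bump)

lemma wave_measurable [measurable]: "wave l r \<in> borel_measurable borel"
  by (intro borel_measurable_continuous_onI wave_continuous)

lemma integrable_wave_moment:
  assumes "l \<le> r"
  shows "integrable lborel (\<lambda>y. of_real ((1 + \<bar>y\<bar>) ^ k) * wave l r y)"
  using integrable_mult_right[OF integrable_moment_ft_bump[OF assms, of k 1 1], of "of_real (1 / (2 * pi))"]
  unfolding wave_def by (simp add: mult.left_commute)

lemma integrable_wave: "l \<le> r \<Longrightarrow> integrable lborel (wave l r)"
  using integrable_wave_moment[of l r 0] by simp

lemma ft_wave:
  assumes "l \<le> r"
  shows "ft (wave l r) (- s) = of_real (bump l r 1 1 s)"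
proof -
  have "ft (wave l r) (- s) = of_real (1 / (2 * pi)) * ft (ft_bump l r 1 1) (- s)"
    unfolding wave_def[abs_def] by (rule ft_cmult)
  also have "\<dots> = of_real (bump l r 1 1 s)"
    unfolding ft_ft_bump[OF assms] by simp
  finally show ?thesis .
qed

lemma not_AE_outside_interval:
  assumes "l < (r::real)"
  shows "\<not> (AE s in lborel. s \<notin> {l<..<r})"
proof
  assume "AE s in lborel. s \<notin> {l<..<r}"
  then have "emeasure lborel {l<..<r} = 0"
    by (subst AE_iff_measurable[symmetric, where P = "\<lambda>s. s \<notin> {l<..<r}"]) auto
  then show False using assms by simp
qed

text \<open>All frequencies of the wave are below \<open>d\<close>, so at a point with \<open>\<bar>y\<bar> d < 1\<close> every phase lies within
\<open>pi / 2\<close> of zero and the real parts add up without cancellation.\<close>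

lemma wave_nonzero:
  assumes "\<bar>y\<bar> * d < 1" and d: "d > 0"
  shows "wave (- d) d y \<noteq> 0"
proof -
  let ?u = "\<lambda>s. cos (y * s) * bump (- d) d 1 1 s"
  have Re_eq: "Re (ft_bump (- d) d 1 1 y) = (LINT s|lborel. ?u s)"
  proof -
    have "integrable lborel (\<lambda>s. cis (y * s) * complex_of_real (bump (- d) d 1 1 s))"
      by (intro integrable_cis_mult integrable_bump) simp
    then show ?thesis unfolding ft_def by (subst integral_Re[symmetric]) auto
  qed
  have int: "integrable lborel ?u"
  proof -
    have "integrable lborel (\<lambda>s. Re (cis (y * s) * complex_of_real (bump (- d) d 1 1 s)))"
      by (intro integrable_Re integrable_cis_mult integrable_bump) simp
    then show ?thesis by simp
  qed
  have pos: "?u s > 0" if "s \<in> {-d<..<d}" for s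
  proof -
    have "\<bar>y * s\<bar> \<le> \<bar>y\<bar> * d" using that by (auto simp: abs_mult intro!: mult_left_mono)
    then have "\<bar>y * s\<bar> < pi / 2" using assms pi_gt3 by linarith
    then have "cos (y * s) > 0" by (intro cos_gt_zero_pi) auto
    then show ?thesis using that bump_pos[of "- d" s d] by simp
  qed
  have nonneg: "?u s \<ge> 0" for s
    using pos[of s] bump_zero[of s "- d" d 1 1] by (cases "s \<in> {-d<..<d}") auto
  have "(LINT s|lborel. ?u s) \<noteq> 0"
  proof
    assume "(LINT s|lborel. ?u s) = 0"
    then have "AE s in lborel. ?u s = 0"
      using integral_nonneg_eq_0_iff_AE[OF int] nonneg by simp
    then have "AE s in lborel. s \<notin> {-d<..<d}"
      by eventually_elim (use pos in fastforce)
    then show False using not_AE_outside_interval[of "- d" d] d by (meson neg_less_0_iff_less order.strict_trans)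
  qed
  then have "ft_bump (- d) d 1 1 y \<noteq> 0" using Re_eq by auto
  then show ?thesis by (simp add: wave_def)
qed

lemma fourier_product_datum:
  fixes l r :: "'a::euclidean_space \<Rightarrow> real"
  assumes lr: "\<And>i. i \<in> Basis \<Longrightarrow> l i \<le> r i"
  shows "fourier (product_datum l r) \<xi> = (\<Prod>i\<in>Basis. of_real (bump (l i) (r i) 1 1 (\<xi> \<bullet> i)))"
proof -
  have "fourier (product_datum l r) \<xi> = (LINT x|lborel. cis (- (x \<bullet> \<xi>)) * product_datum l r x)"
    unfolding fourier_def exp_i_eq_cis product_datum_def by (intro integral_completion) measurable
  also have "\<dots> = (LINT x|lborel. (\<Prod>i\<in>Basis. cis (- (\<xi> \<bullet> i) * (x \<bullet> i)) * wave (l i) (r i) (x \<bullet> i)))"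
  proof (intro Bochner_Integration.integral_cong refl)
    fix x :: 'a
    have "cis (- (x \<bullet> \<xi>)) = (\<Prod>i\<in>Basis. cis (- (\<xi> \<bullet> i) * (x \<bullet> i)))"
      using cis_inner_prod[of "- \<xi>" x] by (simp add: inner_commute)
    then show "cis (- (x \<bullet> \<xi>)) * product_datum l r x = (\<Prod>i\<in>Basis. cis (- (\<xi> \<bullet> i) * (x \<bullet> i)) * wave (l i) (r i) (x \<bullet> i))"
      by (simp add: product_datum_def prod.distrib)
  qed
  also have "\<dots> = (\<Prod>i\<in>Basis. (LINT s|lborel. cis (- (\<xi> \<bullet> i) * s) * wave (l i) (r i) s))"
    by (rule lborel_prod_integral) (intro integrable_cis_mult integrable_wave lr, simp_all)
  also have "\<dots> = (\<Prod>i\<in>Basis. of_real (bump (l i) (r i) 1 1 (\<xi> \<bullet> i)))"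
  proof (intro prod.cong refl)
    fix i :: 'a assume "i \<in> Basis"
    from ft_wave[OF lr[OF this], of "\<xi> \<bullet> i"]
    show "(LINT s|lborel. cis (- (\<xi> \<bullet> i) * s) * wave (l i) (r i) s) = of_real (bump (l i) (r i) 1 1 (\<xi> \<bullet> i))"
      unfolding ft_def .
  qed
  finally show ?thesis .
qed

text \<open>Bounding \<open>norm x\<close> by a product over the coordinates lets the moments of a product datum factorize.\<close>

lemma norm_le_prod_coords:
  fixes x :: "'a::euclidean_space"
  shows "norm x \<le> (\<Prod>i\<in>Basis. 1 + \<bar>x \<bullet> i\<bar>)"
proof -
  have *: "1 + (\<Sum>i\<in>B. \<bar>x \<bullet> i\<bar>) \<le> (\<Prod>i\<in>B. 1 + \<bar>x \<bullet> i\<bar>)" if "finite B" for B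
    using that
  proof induction
    case (insert j B)
    have "1 + (\<Sum>i\<in>insert j B. \<bar>x \<bullet> i\<bar>) \<le> (1 + \<bar>x \<bullet> j\<bar>) * (1 + (\<Sum>i\<in>B. \<bar>x \<bullet> i\<bar>))"
      using insert by (simp add: algebra_simps sum_nonneg)
    also have "\<dots> \<le> (1 + \<bar>x \<bullet> j\<bar>) * (\<Prod>i\<in>B. 1 + \<bar>x \<bullet> i\<bar>)"
      using insert by (intro mult_left_mono) auto
    finally show ?case using insert by simp
  qed simp
  have "norm x \<le> (\<Sum>i\<in>Basis. \<bar>x \<bullet> i\<bar>)" by (rule norm_le_l1)
  with *[of Basis] show ?thesis by simp
qed

lemma test_datum_product_datum:
  fixes l r :: "'a::euclidean_space \<Rightarrow> real"
  assumes lr: "\<And>i. i \<in> Basis \<Longrightarrow> l i \<le> r i"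
  shows "test_datum (product_datum l r)"
  unfolding test_datum_def
proof (intro conjI allI)
  have c: "continuous_on UNIV (\<lambda>x::'a. wave (l i) (r i) (x \<bullet> i))" for i
    by (rule continuous_on_compose2[OF wave_continuous]) (auto intro!: continuous_intros)
  show "continuous_on UNIV (product_datum l r)"
    unfolding product_datum_def[abs_def] by (intro continuous_intros c)
  have m[measurable]: "product_datum l r \<in> borel_measurable borel"
    unfolding product_datum_def[abs_def] by measurable
  fix k :: nat
  have "integrable lborel (\<lambda>x::'a. \<Prod>i\<in>Basis. of_real ((1 + \<bar>x \<bullet> i\<bar>) ^ k) * wave (l i) (r i) (x \<bullet> i))"
    by (rule lborel_prod_integral) (intro integrable_wave_moment lr)
  then have "integrable lborel (\<lambda>x::'a. norm x ^ k *\<^sub>R product_datum l r x)"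
  proof (rule Bochner_Integration.integrable_bound)
    show "AE x in lborel. norm (norm x ^ k *\<^sub>R product_datum l r x)
      \<le> norm (\<Prod>i\<in>Basis. complex_of_real ((1 + \<bar>x \<bullet> i\<bar>) ^ k) * wave (l i) (r i) (x \<bullet> i))"
    proof (intro AE_I2)
      fix x :: 'a
      have "norm x ^ k \<le> (\<Prod>i\<in>Basis. (1 + \<bar>x \<bullet> i\<bar>) ^ k)"
        using power_mono[OF norm_le_prod_coords norm_ge_zero, of x k] by (simp add: prod_power_distrib)
      then have "norm x ^ k * norm (product_datum l r x) \<le> (\<Prod>i\<in>Basis. (1 + \<bar>x \<bullet> i\<bar>) ^ k) * norm (product_datum l r x)"
        by (rule mult_right_mono) simp
      also have "\<dots> = norm (\<Prod>i\<in>Basis. complex_of_real ((1 + \<bar>x \<bullet> i\<bar>) ^ k) * wave (l i) (r i) (x \<bullet> i))"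
        unfolding product_datum_def prod_norm[symmetric] norm_mult norm_of_real prod.distrib[symmetric]
        by (intro prod.cong refl) simp
      finally show "norm (norm x ^ k *\<^sub>R product_datum l r x)
        \<le> norm (\<Prod>i\<in>Basis. complex_of_real ((1 + \<bar>x \<bullet> i\<bar>) ^ k) * wave (l i) (r i) (x \<bullet> i))"
        by simp
    qed
  qed measurable
  then show "integrable lebesgue (\<lambda>x::'a. norm x ^ k *\<^sub>R product_datum l r x)"
    by (subst integrable_completion) auto
  have "{\<xi>. fourier (product_datum l r) \<xi> \<noteq> 0} \<subseteq> cbox (\<Sum>i\<in>Basis. l i *\<^sub>R i) (\<Sum>i\<in>Basis. r i *\<^sub>R i)"
  proof
    fix \<xi> :: 'a assume "\<xi> \<in> {\<xi>. fourier (product_datum l r) \<xi> \<noteq> 0}"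
    then have nz: "bump (l i) (r i) 1 1 (\<xi> \<bullet> i) \<noteq> 0" if "i \<in> Basis" for i
      using that by (simp add: fourier_product_datum[OF lr])
    have "l i \<le> \<xi> \<bullet> i \<and> \<xi> \<bullet> i \<le> r i" if "i \<in> Basis" for i
    proof (rule ccontr)
      assume "\<not> (l i \<le> \<xi> \<bullet> i \<and> \<xi> \<bullet> i \<le> r i)"
      then have "\<xi> \<bullet> i \<notin> {l i<..<r i}" by auto
      then show False using nz[OF that] bump_zero by blast
    qed
    then show "\<xi> \<in> cbox (\<Sum>i\<in>Basis. l i *\<^sub>R i) (\<Sum>i\<in>Basis. r i *\<^sub>R i)"
      by (simp add: mem_box)
  qed
  then show "bounded {\<xi>. fourier (product_datum l r) \<xi> \<noteq> 0}"
    using bounded_cbox bounded_subset by blast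
qed

text \<open>The factors of a product datum that the multipliers in the direction \<open>b\<close> leave unchanged.\<close>

definition other_waves :: "'a::euclidean_space \<Rightarrow> ('a \<Rightarrow> real) \<Rightarrow> ('a \<Rightarrow> real) \<Rightarrow> 'a \<Rightarrow> complex" where
  "other_waves b l r x = (\<Prod>i\<in>Basis - {b}. wave (l i) (r i) (x \<bullet> i))"

lemma other_waves_measurable [measurable]: "other_waves b l r \<in> borel_measurable borel"
  unfolding other_waves_def[abs_def] by measurable

lemma evolution_product_datum:
  fixes l r :: "'a::euclidean_space \<Rightarrow> real"
  assumes b: "b \<in> Basis" and lr: "\<And>i. i \<in> Basis \<Longrightarrow> l i \<le> r i"
    and chi: "continuous_on UNIV chi" and m: "continuous_on UNIV m" and f: "continuous_on UNIV f"
  shows "evolution (\<lambda>\<xi>. \<xi> \<bullet> b) chi m f (product_datum l r) t x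
    = other_waves b l r x * (of_real (1 / (2 * pi)) * (LINT s|lborel. cis (t * f s) *
        (cis ((x \<bullet> b) * s) * (chi s * m s * of_real (bump (l b) (r b) 1 1 s)))))"
    "(\<lambda>(t, x). evolution (\<lambda>\<xi>. \<xi> \<bullet> b) chi m f (product_datum l r) t x) \<in> borel_measurable (borel \<Otimes>\<^sub>M borel)"
proof -
  have [measurable]: "chi \<in> borel_measurable borel" "m \<in> borel_measurable borel" "f \<in> borel_measurable borel"
    using chi m f by (auto intro: borel_measurable_continuous_onI)
  let ?\<beta> = "\<lambda>i s. complex_of_real (bump (l i) (r i) 1 1 s)"
  let ?K = "\<lambda>\<xi>. chi (\<xi> \<bullet> b) * m (\<xi> \<bullet> b) * (\<Prod>i\<in>Basis. ?\<beta> i (\<xi> \<bullet> i))"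
  have evo: "evolution (\<lambda>\<xi>. \<xi> \<bullet> b) chi m f (product_datum l r) t x
    = of_real (1 / (2 * pi) ^ DIM('a)) * (LINT \<xi>|lborel. cis (x \<bullet> \<xi>) * (cis (t * f (\<xi> \<bullet> b)) * ?K \<xi>))" for t x
    by (rule evolution_borel) (simp_all add: fourier_product_datum[OF lr])
  show "(\<lambda>(t, x). evolution (\<lambda>\<xi>. \<xi> \<bullet> b) chi m f (product_datum l r) t x) \<in> borel_measurable (borel \<Otimes>\<^sub>M borel)"
    unfolding evo by measurable
  define F where "F i s = (if i = b then cis (t * f s) * (cis ((x \<bullet> b) * s) * (chi s * m s * ?\<beta> b s)) else cis ((x \<bullet> i) * s) * ?\<beta> i s)" for i s
  have F: "integrable lborel (F i)" for i
  proof (cases "i = b")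
    case True
    have "integrable lborel (\<lambda>s. chi s * m s * ?\<beta> b s)"
      by (intro integrable_bump_mult continuous_intros continuous_on_subset[OF chi] continuous_on_subset[OF m]) auto
    then have "integrable lborel (\<lambda>s. cis (t * f s) * (cis ((x \<bullet> b) * s) * (chi s * m s * ?\<beta> b s)))"
      by (intro integrable_cis_mult) auto
    then show ?thesis using True by (simp add: F_def[abs_def])
  next
    case False
    then show ?thesis by (simp add: F_def[abs_def] integrable_cis_mult integrable_bump)
  qed
  have "cis (x \<bullet> \<xi>) * (cis (t * f (\<xi> \<bullet> b)) * ?K \<xi>) = (\<Prod>i\<in>Basis. F i (\<xi> \<bullet> i))" for \<xi>
  proof -
    have "(\<Prod>i\<in>Basis. F i (\<xi> \<bullet> i)) = F b (\<xi> \<bullet> b) * (\<Prod>i\<in>Basis - {b}. cis ((x \<bullet> i) * (\<xi> \<bullet> i)) * ?\<beta> i (\<xi> \<bullet> i))"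
      by (subst prod.remove[OF _ b]) (auto simp: F_def intro!: prod.cong)
    then show ?thesis
      unfolding cis_inner_prod[of x \<xi>]
      by (simp add: prod.remove[OF _ b] F_def prod.distrib ac_simps)
  qed
  then have "evolution (\<lambda>\<xi>. \<xi> \<bullet> b) chi m f (product_datum l r) t x
    = of_real (1 / (2 * pi) ^ DIM('a)) * (\<Prod>i\<in>Basis. (LINT s|lborel. F i s))"
    unfolding evo by (simp only: lborel_prod_integral(2)[OF F])
  also have "\<dots> = (\<Prod>i\<in>Basis. of_real (1 / (2 * pi)) * (LINT s|lborel. F i s))"
    by (simp only: prod.distrib prod_constant of_real_power power_one_over[symmetric])
  also have "\<dots> = (of_real (1 / (2 * pi)) * (LINT s|lborel. F b s)) * other_waves b l r x"
  proof -
    have "of_real (1 / (2 * pi)) * (LINT s|lborel. F i s) = wave (l i) (r i) (x \<bullet> i)" if "i \<in> Basis - {b}" for i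
      using that by (simp add: F_def wave_def ft_def)
    then show ?thesis
      unfolding other_waves_def prod.remove[OF finite_Basis b] by (simp only: cong: prod.cong)
  qed
  finally show "evolution (\<lambda>\<xi>. \<xi> \<bullet> b) chi m f (product_datum l r) t x
    = other_waves b l r x * (of_real (1 / (2 * pi)) * (LINT s|lborel. cis (t * f s) *
        (cis ((x \<bullet> b) * s) * (chi s * m s * of_real (bump (l b) (r b) 1 1 s)))))"
    by (simp add: F_def mult.commute)
qed

text \<open>The point \<open>x\<close> enters the remaining one-dimensional integral through \<open>cis ((x \<bullet> b) * s)\<close> only, so the
energy depends on \<open>x\<close> through \<open>other_waves\<close> alone. The constant is \<open>2 pi\<close> from Plancherel's theorem times
\<open>(1 / (2 pi))\<^sup>2\<close> from the multiplier.\<close>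

lemma energy_product_datum:
  fixes l r :: "'a::euclidean_space \<Rightarrow> real"
  assumes b: "b \<in> Basis" and lr: "\<And>i. i \<in> Basis \<Longrightarrow> l i \<le> r i"
    and chi: "continuous_on UNIV chi" and m: "continuous_on UNIV m"
    and f: "f C1_differentiable_on UNIV" and inj: "inj_on f {l b..r b}"
    and nd: "\<And>s. s \<in> {l b..r b} \<Longrightarrow> deriv f s \<noteq> 0"
  shows "(\<integral>\<^sup>+t. ennreal ((cmod (evolution (\<lambda>\<xi>. \<xi> \<bullet> b) chi m f (product_datum l r) t x))\<^sup>2) \<partial>lborel)
    = ennreal ((cmod (other_waves b l r x))\<^sup>2) * (ennreal (1 / (2 * pi)) *
       (\<integral>\<^sup>+s. ennreal ((cmod (chi s * m s * of_real (bump (l b) (r b) 1 1 s)))\<^sup>2 / \<bar>deriv f s\<bar>) \<partial>lborel))"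
proof -
  note der = C1_real_deriv[OF f]
  have fc: "continuous_on UNIV f"
    using der(1) DERIV_isCont by (auto simp: continuous_on_eq_continuous_at)
  have [measurable]: "chi \<in> borel_measurable borel" "m \<in> borel_measurable borel" "f \<in> borel_measurable borel" "deriv f \<in> borel_measurable borel"
    using chi m fc der(2) by (auto intro: borel_measurable_continuous_onI)
  let ?k = "\<lambda>s. chi s * m s * complex_of_real (bump (l b) (r b) 1 1 s)"
  let ?h = "\<lambda>s. cis ((x \<bullet> b) * s) * ?k s"
  have h: "integrable lborel ?h"
    by (intro integrable_cis_mult integrable_bump_mult continuous_intros continuous_on_subset[OF chi] continuous_on_subset[OF m]) auto
  have "(\<integral>\<^sup>+t. ennreal ((cmod (LINT s|lborel. cis (t * f s) * ?h s))\<^sup>2) \<partial>lborel)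
     = ennreal (2 * pi) * (\<integral>\<^sup>+s. ennreal ((norm (?h s))\<^sup>2 / \<bar>deriv f s\<bar>) \<partial>lborel)"
  proof (rule oscillatory_plancherel[where T = "{l b..r b}", OF h der(1)])
    show "AE s in lborel. ?h s \<noteq> 0 \<longrightarrow> s \<in> {l b..r b} \<and> deriv f s \<noteq> 0"
    proof (intro AE_I2 impI)
      fix s assume "?h s \<noteq> 0"
      then have "bump (l b) (r b) 1 1 s \<noteq> 0" by auto
      then have "s \<in> {l b<..<r b}" using bump_zero by blast
      then have "s \<in> {l b..r b}" by simp
      then show "s \<in> {l b..r b} \<and> deriv f s \<noteq> 0" using nd by blast
    qed
  qed (use inj in measurable)
  also have "\<dots> = ennreal (2 * pi) * (\<integral>\<^sup>+s. ennreal ((cmod (?k s))\<^sup>2 / \<bar>deriv f s\<bar>) \<partial>lborel)"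
    by (simp add: norm_mult)
  finally have P: "(\<integral>\<^sup>+t. ennreal ((cmod (LINT s|lborel. cis (t * f s) * ?h s))\<^sup>2) \<partial>lborel) = \<dots>" .
  have [measurable]: "(\<lambda>t. LINT s|lborel. cis (t * f s) * ?h s) \<in> borel_measurable lborel" by measurable
  have c: "ennreal ((cmod (of_real (1 / (2 * pi))))\<^sup>2) * ennreal (2 * pi) = ennreal (1 / (2 * pi))"
    by (simp add: ennreal_mult[symmetric] power2_eq_square norm_divide)
  have cP: "ennreal ((cmod (of_real (1 / (2 * pi))))\<^sup>2) * (\<integral>\<^sup>+t. ennreal ((cmod (LINT s|lborel. cis (t * f s) * ?h s))\<^sup>2) \<partial>lborel)
    = ennreal (1 / (2 * pi)) * (\<integral>\<^sup>+s. ennreal ((cmod (?k s))\<^sup>2 / \<bar>deriv f s\<bar>) \<partial>lborel)"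
    unfolding P c[symmetric] by (rule mult.assoc[symmetric])
  have evo: "evolution (\<lambda>\<xi>. \<xi> \<bullet> b) chi m f (product_datum l r) t x
    = other_waves b l r x * (of_real (1 / (2 * pi)) * (LINT s|lborel. cis (t * f s) * ?h s))" for t
    by (rule evolution_product_datum(1)[OF b lr chi m fc])
  show ?thesis
    unfolding evo
    by (subst nn_integral_cmod_cmult, measurable, subst nn_integral_cmod_cmult, measurable)
       (simp only: cP)
qed

section \<open>Necessity of the symbol bound\<close>

definition bump_energy :: "(real \<Rightarrow> complex) \<Rightarrow> (real \<Rightarrow> complex) \<Rightarrow> (real \<Rightarrow> real) \<Rightarrow> real \<Rightarrow> real \<Rightarrow> ennreal" where
  "bump_energy chi m f l r =
     (\<integral>\<^sup>+s. ennreal ((cmod (chi s * m s * of_real (bump l r 1 1 s)))\<^sup>2 / \<bar>deriv f s\<bar>) \<partial>lborel)"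

context symbol_pair
begin

text \<open>Squaring and clearing denominators turns the failure of the bound into an open condition on the
frequency. The point where it fails lies only in the closure of \<open>{chi \<noteq> 0}\<close>, but an open set meeting
the closure also meets the set itself.\<close>

lemma symbol_bound_failure:
  assumes chi_cont: "continuous_on UNIV chi" and fail: "\<not> symbol_bound f g chi \<sigma> \<tau> A"
  obtains l r where "l < r"
    "\<And>s. s \<in> {l..r} \<Longrightarrow> chi s \<noteq> 0 \<and> deriv f s \<noteq> 0 \<and> deriv g s \<noteq> 0"
    "\<And>s. s \<in> {l..r} \<Longrightarrow> A\<^sup>2 * ((cmod (\<tau> s))\<^sup>2 / \<bar>deriv g s\<bar>) < (cmod (\<sigma> s))\<^sup>2 / \<bar>deriv f s\<bar>"
proof -
  have cont: "continuous_on UNIV (deriv f)" "continuous_on UNIV (deriv g)"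
    using C1_real_deriv(2) f g by auto
  obtain \<xi> where \<xi>: "\<xi> \<in> supp chi" "deriv f \<xi> \<noteq> 0" "deriv g \<xi> \<noteq> 0"
    and gt: "A * (cmod (\<tau> \<xi>) / sqrt \<bar>deriv g \<xi>\<bar>) < cmod (\<sigma> \<xi>) / sqrt \<bar>deriv f \<xi>\<bar>"
    using fail by (auto simp: symbol_bound_def not_le)
  have "(A * (cmod (\<tau> \<xi>) / sqrt \<bar>deriv g \<xi>\<bar>))\<^sup>2 < (cmod (\<sigma> \<xi>) / sqrt \<bar>deriv f \<xi>\<bar>)\<^sup>2"
    using gt A by (intro power_strict_mono) auto
  then have gt2: "A\<^sup>2 * (cmod (\<tau> \<xi>))\<^sup>2 * \<bar>deriv f \<xi>\<bar> < (cmod (\<sigma> \<xi>))\<^sup>2 * \<bar>deriv g \<xi>\<bar>"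
    using \<xi> by (simp add: power_divide power_mult_distrib field_simps)
  define U where "U = {s. deriv f s \<noteq> 0} \<inter> {s. deriv g s \<noteq> 0}
      \<inter> {s. A\<^sup>2 * (cmod (\<tau> s))\<^sup>2 * \<bar>deriv f s\<bar> < (cmod (\<sigma> s))\<^sup>2 * \<bar>deriv g s\<bar>}"
  have "open U"
    unfolding U_def by (intro open_Int open_Collect_neq open_Collect_less continuous_intros cont \<sigma> \<tau>)
  moreover have "\<xi> \<in> U \<inter> supp chi" using \<xi> gt2 by (simp add: U_def)
  ultimately have "U \<inter> {s. chi s \<noteq> 0} \<noteq> {}"
    using open_Int_closure_eq_empty[of U "{s. chi s \<noteq> 0}"] by blast
  moreover have "open (U \<inter> {s. chi s \<noteq> 0})"
    using \<open>open U\<close> by (intro open_Int open_Collect_neq chi_cont continuous_intros)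
  ultimately obtain y e where e: "e > 0" "cball y e \<subseteq> U \<inter> {s. chi s \<noteq> 0}"
    by (meson ex_in_conv open_contains_cball)
  show ?thesis
  proof
    show "y - e < y + e" using e by simp
    fix s assume "s \<in> {y - e..y + e}"
    then have "s \<in> U" "chi s \<noteq> 0" using e(2) by (auto simp: cball_eq_atLeastAtMost)
    then show "chi s \<noteq> 0 \<and> deriv f s \<noteq> 0 \<and> deriv g s \<noteq> 0"
      and "A\<^sup>2 * ((cmod (\<tau> s))\<^sup>2 / \<bar>deriv g s\<bar>) < (cmod (\<sigma> s))\<^sup>2 / \<bar>deriv f s\<bar>"
      by (auto simp: U_def field_simps)
  qed
qed

lemma bump_energy_gap:
  assumes chi_cont: "continuous_on UNIV chi" and lr: "l < r"
    and nd: "\<And>s. s \<in> {l..r} \<Longrightarrow> chi s \<noteq> 0 \<and> deriv f s \<noteq> 0 \<and> deriv g s \<noteq> 0"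
    and gap: "\<And>s. s \<in> {l..r} \<Longrightarrow> A\<^sup>2 * ((cmod (\<tau> s))\<^sup>2 / \<bar>deriv g s\<bar>) < (cmod (\<sigma> s))\<^sup>2 / \<bar>deriv f s\<bar>"
  shows "ennreal (A\<^sup>2) * bump_energy chi \<tau> g l r < bump_energy chi \<sigma> f l r"
proof -
  have [measurable]: "chi \<in> borel_measurable borel"
    by (rule borel_measurable_continuous_onI[OF chi_cont])
  let ?u = "\<lambda>s. (cmod (chi s * \<sigma> s * of_real (bump l r 1 1 s)))\<^sup>2 / \<bar>deriv f s\<bar>"
  let ?v = "\<lambda>s. A\<^sup>2 * ((cmod (chi s * \<tau> s * of_real (bump l r 1 1 s)))\<^sup>2 / \<bar>deriv g s\<bar>)"
  have less: "?v s < ?u s" if "s \<in> {l<..<r}" for s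
  proof -
    let ?c = "(cmod (chi s) * bump l r 1 1 s)\<^sup>2"
    have s: "s \<in> {l..r}" using that by auto
    have "?c > 0" using nd[OF s] bump_pos[of l s r] that by simp
    then have "?c * (A\<^sup>2 * ((cmod (\<tau> s))\<^sup>2 / \<bar>deriv g s\<bar>)) < ?c * ((cmod (\<sigma> s))\<^sup>2 / \<bar>deriv f s\<bar>)"
      using gap[OF s] by (rule mult_strict_left_mono[rotated])
    then show ?thesis
      by (simp add: norm_mult power_mult_distrib ac_simps)
  qed
  have zero: "?v s = 0 \<and> ?u s = 0" if "s \<notin> {l<..<r}" for s
    using bump_zero[OF that] by simp
  have le: "?v s \<le> ?u s" for s
    using less[of s] zero[of s] by (cases "s \<in> {l<..<r}") auto
  have "integrable lborel (\<lambda>s. indicator {l..r} s *\<^sub>R ?u s)"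
  proof (rule borel_integrable_compact)
    show "continuous_on {l..r} ?u"
      by (intro continuous_intros bump_continuous continuous_on_subset[OF chi_cont] continuous_on_subset[OF \<sigma>]
          continuous_on_subset[OF C1_real_deriv(2)[OF f]]) (use nd in auto)
  qed simp
  moreover have "(\<lambda>s. indicator {l..r} s *\<^sub>R ?u s) = ?u"
  proof
    fix s
    show "indicator {l..r} s *\<^sub>R ?u s = ?u s"
      using zero[of s] by (cases "s \<in> {l..r}") auto
  qed
  ultimately have "integrable lborel ?u" by simp
  then have fin: "(\<integral>\<^sup>+s. ennreal (?u s) \<partial>lborel) < \<infinity>"
    by (simp add: nn_integral_eq_integral)
  have "(\<integral>\<^sup>+s. ennreal (?v s) \<partial>lborel) < (\<integral>\<^sup>+s. ennreal (?u s) \<partial>lborel)"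
  proof (rule nn_integral_less)
    have "(\<integral>\<^sup>+s. ennreal (?v s) \<partial>lborel) \<le> (\<integral>\<^sup>+s. ennreal (?u s) \<partial>lborel)"
      by (intro nn_integral_mono ennreal_leI le)
    then show "(\<integral>\<^sup>+s. ennreal (?v s) \<partial>lborel) \<noteq> \<infinity>" using fin by (auto simp: top_unique)
    show "AE s in lborel. ennreal (?v s) \<le> ennreal (?u s)" by (intro AE_I2 ennreal_leI le)
    show "\<not> (AE s in lborel. ennreal (?u s) \<le> ennreal (?v s))"
    proof
      assume "AE s in lborel. ennreal (?u s) \<le> ennreal (?v s)"
      then have "AE s in lborel. s \<notin> {l<..<r}"
      proof eventually_elim
        case (elim s)
        have "0 \<le> ?v s" by simp
        then have "?u s \<le> ?v s" using elim by (simp only: ennreal_le_iff)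
        then show ?case using less[of s] by (auto simp: not_less[symmetric])
      qed
      then show False using not_AE_outside_interval[OF lr] by simp
    qed
  qed measurable
  also have "(\<integral>\<^sup>+s. ennreal (?v s) \<partial>lborel) = ennreal (A\<^sup>2) * bump_energy chi \<tau> g l r"
    unfolding bump_energy_def by (subst nn_integral_cmult[symmetric], measurable, intro nn_integral_cong ennreal_mult) simp_all
  finally show ?thesis by (simp only: bump_energy_def)
qed

lemma product_datum_energies:
  fixes l r :: "'a::euclidean_space \<Rightarrow> real"
  assumes chi_cont: "continuous_on UNIV chi" and b: "b \<in> Basis" and lr: "\<And>i. i \<in> Basis \<Longrightarrow> l i \<le> r i"
    and nd: "\<And>s. s \<in> {l b..r b} \<Longrightarrow> chi s \<noteq> 0 \<and> deriv f s \<noteq> 0 \<and> deriv g s \<noteq> 0"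
  shows "(\<integral>\<^sup>+t. ennreal ((cmod (evolution (\<lambda>\<xi>. \<xi> \<bullet> b) chi \<sigma> f (product_datum l r) t x))\<^sup>2) \<partial>lborel)
      = ennreal ((cmod (other_waves b l r x))\<^sup>2) * (ennreal (1 / (2 * pi)) * bump_energy chi \<sigma> f (l b) (r b))"
    "(\<integral>\<^sup>+t. ennreal ((cmod (evolution (\<lambda>\<xi>. \<xi> \<bullet> b) chi \<tau> g (product_datum l r) t x))\<^sup>2) \<partial>lborel)
      = ennreal ((cmod (other_waves b l r x))\<^sup>2) * (ennreal (1 / (2 * pi)) * bump_energy chi \<tau> g (l b) (r b))"
proof -
  have sub: "{l b..r b} \<subseteq> supp chi"
    using nd closure_subset[of "{s. chi s \<noteq> 0}"] by (auto simp: subset_iff)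
  show "(\<integral>\<^sup>+t. ennreal ((cmod (evolution (\<lambda>\<xi>. \<xi> \<bullet> b) chi \<sigma> f (product_datum l r) t x))\<^sup>2) \<partial>lborel)
      = ennreal ((cmod (other_waves b l r x))\<^sup>2) * (ennreal (1 / (2 * pi)) * bump_energy chi \<sigma> f (l b) (r b))"
    unfolding bump_energy_def
    by (rule energy_product_datum[where l = l and r = r, OF b lr chi_cont \<sigma> f inj_on_subset[OF f_inj sub]]) (use nd in auto)
  show "(\<integral>\<^sup>+t. ennreal ((cmod (evolution (\<lambda>\<xi>. \<xi> \<bullet> b) chi \<tau> g (product_datum l r) t x))\<^sup>2) \<partial>lborel)
      = ennreal ((cmod (other_waves b l r x))\<^sup>2) * (ennreal (1 / (2 * pi)) * bump_energy chi \<tau> g (l b) (r b))"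
    unfolding bump_energy_def
    by (rule energy_product_datum[where l = l and r = r, OF b lr chi_cont \<tau> g inj_on_subset[OF g_inj sub]]) (use nd in auto)
qed

theorem line_converse:
  assumes chi_cont: "continuous_on UNIV chi"
    and est: "\<And>\<phi> :: real \<Rightarrow> complex. test_datum \<phi> \<Longrightarrow>
        L2norm (\<lambda>t. evolution (\<lambda>\<xi>. \<xi>) chi \<sigma> f \<phi> t x) \<le> ennreal A * L2norm (\<lambda>t. evolution (\<lambda>\<xi>. \<xi>) chi \<tau> g \<phi> t x') \<and>
        L2norm (\<lambda>t. evolution (\<lambda>\<xi>. \<xi>) chi \<sigma> f \<phi> t x) < \<infinity> \<and>
        L2norm (\<lambda>t. evolution (\<lambda>\<xi>. \<xi>) chi \<tau> g \<phi> t x') < \<infinity>"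
  shows "symbol_bound f g chi \<sigma> \<tau> A"
proof (rule ccontr)
  assume "\<not> symbol_bound f g chi \<sigma> \<tau> A"
  from symbol_bound_failure[OF chi_cont this] obtain l r where lr: "l < r"
    and nd: "\<And>s. s \<in> {l..r} \<Longrightarrow> chi s \<noteq> 0 \<and> deriv f s \<noteq> 0 \<and> deriv g s \<noteq> 0"
    and gap: "\<And>s. s \<in> {l..r} \<Longrightarrow> A\<^sup>2 * ((cmod (\<tau> s))\<^sup>2 / \<bar>deriv g s\<bar>) < (cmod (\<sigma> s))\<^sup>2 / \<bar>deriv f s\<bar>"
    by blast
  let ?\<phi> = "product_datum (\<lambda>_. l) (\<lambda>_. r) :: real \<Rightarrow> complex"
  have "test_datum ?\<phi>" using lr by (intro test_datum_product_datum) simp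
  note est = est[OF this]
  note bound = nn_integral_le_of_L2norm_le[OF conjunct1[OF est] A conjunct1[OF conjunct2[OF est]] conjunct2[OF conjunct2[OF est]]]
  have "other_waves 1 (\<lambda>_. l) (\<lambda>_. r) y = 1" for y :: real
    by (simp add: other_waves_def)
  with product_datum_energies[OF chi_cont, of "1::real" "\<lambda>_. l" "\<lambda>_. r"] lr nd
  have energies:
    "(\<integral>\<^sup>+t. ennreal ((cmod (evolution (\<lambda>\<xi>. \<xi>) chi \<sigma> f ?\<phi> t y))\<^sup>2) \<partial>lebesgue) = ennreal (1 / (2 * pi)) * bump_energy chi \<sigma> f l r"
    "(\<integral>\<^sup>+t. ennreal ((cmod (evolution (\<lambda>\<xi>. \<xi>) chi \<tau> g ?\<phi> t y))\<^sup>2) \<partial>lebesgue) = ennreal (1 / (2 * pi)) * bump_energy chi \<tau> g l r" for y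
    by (simp_all add: nn_integral_completion)
  have "ennreal (1 / (2 * pi)) * bump_energy chi \<sigma> f l r \<le> ennreal (A\<^sup>2) * (ennreal (1 / (2 * pi)) * bump_energy chi \<tau> g l r)"
    using bound(1) unfolding energies .
  also have "\<dots> = ennreal (1 / (2 * pi)) * (ennreal (A\<^sup>2) * bump_energy chi \<tau> g l r)"
    by (rule mult.left_commute)
  also have "\<dots> < ennreal (1 / (2 * pi)) * bump_energy chi \<sigma> f l r"
    by (rule ennreal_mult_strict_left_mono[OF bump_energy_gap[OF chi_cont lr nd gap]]) auto
  finally show False by simp
qed

text \<open>The boxes \<open>\<bar>x \<bullet> i\<bar> < n\<close> exhaust the space, so one of them meets \<open>{w \<noteq> 0}\<close> in a set of positive measure.\<close>

lemma weight_visible: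
  fixes w :: "'a::euclidean_space \<Rightarrow> complex"
  assumes [measurable]: "w \<in> borel_measurable borel" and w: "\<not> (AE x in lborel. w x = 0)"
  obtains d where "d > 0" "\<not> (AE x in lborel. w x \<noteq> 0 \<longrightarrow> (\<exists>i\<in>Basis. \<not> \<bar>x \<bullet> i\<bar> * d < 1))"
proof -
  have "\<exists>n. \<not> (AE x in lborel. w x \<noteq> 0 \<longrightarrow> (\<exists>i\<in>Basis. \<not> \<bar>x \<bullet> i\<bar> * (1 / real (Suc n)) < 1))"
  proof (rule ccontr)
    assume "\<not> ?thesis"
    then have "AE x in lborel. \<forall>n. w x \<noteq> 0 \<longrightarrow> (\<exists>i\<in>Basis. \<not> \<bar>x \<bullet> i\<bar> * (1 / real (Suc n)) < 1)"
      by (subst AE_all_countable) blast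
    then have "AE x in lborel. w x = 0"
    proof eventually_elim
      case (elim x)
      obtain n where n: "norm x < real n" using reals_Archimedean2 by blast
      have "\<bar>x \<bullet> i\<bar> * (1 / real (Suc n)) < 1" if "i \<in> Basis" for i
        using Basis_le_norm[OF that, of x] n by (simp add: field_simps)
      then show ?case using elim by blast
    qed
    then show False using w by simp
  qed
  then obtain n where "\<not> (AE x in lborel. w x \<noteq> 0 \<longrightarrow> (\<exists>i\<in>Basis. \<not> \<bar>x \<bullet> i\<bar> * (1 / real (Suc n)) < 1))" ..
  then show ?thesis by (intro that[of "1 / real (Suc n)"]) auto
qed

text \<open>For a product datum both weighted norms contain the same factor \<open>W\<close>. It can be cancelled: the bumps in
the other frequencies are narrow enough for \<open>weight_visible\<close> to make \<open>W\<close> positive, and \<open>W\<close> is finite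
because the left-hand norm is finite while its one-dimensional factor is positive.\<close>

theorem weighted_converse:
  fixes w :: "'a::euclidean_space \<Rightarrow> complex"
  assumes chi_cont: "continuous_on UNIV chi" and b: "b \<in> Basis"
    and w: "w \<in> borel_measurable lebesgue" and w_pos: "emeasure lebesgue {x. w x \<noteq> 0} > 0"
    and est: "\<And>\<phi> :: 'a \<Rightarrow> complex. test_datum \<phi> \<Longrightarrow>
        L2norm (\<lambda>(t, x). w x * evolution (\<lambda>\<xi>. \<xi> \<bullet> b) chi \<sigma> f \<phi> t x)
          \<le> ennreal A * L2norm (\<lambda>(t, x). w x * evolution (\<lambda>\<xi>. \<xi> \<bullet> b) chi \<tau> g \<phi> t x) \<and>
        L2norm (\<lambda>(t, x). w x * evolution (\<lambda>\<xi>. \<xi> \<bullet> b) chi \<sigma> f \<phi> t x) < \<infinity> \<and>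
        L2norm (\<lambda>(t, x). w x * evolution (\<lambda>\<xi>. \<xi> \<bullet> b) chi \<tau> g \<phi> t x) < \<infinity>"
  shows "symbol_bound f g chi \<sigma> \<tau> A"
proof (rule ccontr)
  assume "\<not> symbol_bound f g chi \<sigma> \<tau> A"
  from symbol_bound_failure[OF chi_cont this] obtain l0 r0 where lr0: "l0 < r0"
    and nd: "\<And>s. s \<in> {l0..r0} \<Longrightarrow> chi s \<noteq> 0 \<and> deriv f s \<noteq> 0 \<and> deriv g s \<noteq> 0"
    and gap: "\<And>s. s \<in> {l0..r0} \<Longrightarrow> A\<^sup>2 * ((cmod (\<tau> s))\<^sup>2 / \<bar>deriv g s\<bar>) < (cmod (\<sigma> s))\<^sup>2 / \<bar>deriv f s\<bar>"
    by blast
  obtain w' where w'_meas[measurable]: "w' \<in> borel_measurable borel" and w': "AE x in lborel. w x = w' x"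
    using borel_version[OF w] by blast
  have "\<not> (AE x in lborel. w' x = 0)"
  proof
    assume "AE x in lborel. w' x = 0"
    with w' have "AE x in lborel. w x = 0" by eventually_elim simp
    then have "AE x in lebesgue. w x = 0" by (rule AE_completion)
    moreover have "w -` (- {0}) \<inter> space lebesgue \<in> sets lebesgue" using w by (rule measurable_sets) simp
    then have "{x. w x \<noteq> 0} \<in> sets lebesgue" by (simp add: vimage_def Compl_eq)
    ultimately have "emeasure lebesgue {x. w x \<noteq> 0} = 0"
      by (subst (asm) AE_iff_measurable[where N = "{x. w x \<noteq> 0}"]) auto
    then show False using w_pos by simp
  qed
  then obtain d where d: "d > 0"
    and visible: "\<not> (AE x in lborel. w' x \<noteq> 0 \<longrightarrow> (\<exists>i\<in>Basis. \<not> \<bar>x \<bullet> i\<bar> * d < 1))"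
    using weight_visible[OF w'_meas] by blast
  define l where "l i = (if i = b then l0 else - d)" for i
  define r where "r i = (if i = b then r0 else d)" for i
  have lr: "l i \<le> r i" for i using lr0 d by (simp add: l_def r_def)
  have lb: "l b = l0" "r b = r0" by (simp_all add: l_def r_def)
  let ?\<phi> = "product_datum l r"
  let ?c = "ennreal (1 / (2 * pi))"
  define W where "W = (\<integral>\<^sup>+x. ennreal ((cmod (w' x))\<^sup>2) * ennreal ((cmod (other_waves b l r x))\<^sup>2) \<partial>lborel)"
  have "test_datum ?\<phi>" by (intro test_datum_product_datum lr)
  note est = est[OF this]
  note bound = nn_integral_le_of_L2norm_le[OF conjunct1[OF est] A conjunct1[OF conjunct2[OF est]] conjunct2[OF conjunct2[OF est]]]
  have fc: "continuous_on UNIV f" "continuous_on UNIV g"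
    using DERIV_isCont[OF f_deriv] DERIV_isCont[OF g_deriv] by (simp_all add: continuous_on_eq_continuous_at)
  have nd': "chi s \<noteq> 0 \<and> deriv f s \<noteq> 0 \<and> deriv g s \<noteq> 0" if "s \<in> {l b..r b}" for s
    using that nd unfolding lb by blast
  have en:
    "(\<integral>\<^sup>+t. ennreal ((cmod (evolution (\<lambda>\<xi>. \<xi> \<bullet> b) chi \<sigma> f ?\<phi> t x))\<^sup>2) \<partial>lborel)
      = ennreal ((cmod (other_waves b l r x))\<^sup>2) * (?c * bump_energy chi \<sigma> f l0 r0)"
    "(\<integral>\<^sup>+t. ennreal ((cmod (evolution (\<lambda>\<xi>. \<xi> \<bullet> b) chi \<tau> g ?\<phi> t x))\<^sup>2) \<partial>lborel)
      = ennreal ((cmod (other_waves b l r x))\<^sup>2) * (?c * bump_energy chi \<tau> g l0 r0)" for x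
    using product_datum_energies[where l = l and r = r and x = x, OF chi_cont b lr] nd' unfolding lb by blast+
  have pull: "(\<integral>\<^sup>+x. ennreal ((cmod (w' x))\<^sup>2) * (ennreal ((cmod (other_waves b l r x))\<^sup>2) * K) \<partial>lborel) = W * K" for K
    unfolding W_def by (subst nn_integral_multc[symmetric]) (auto simp: mult.assoc)
  have total_s: "(\<integral>\<^sup>+z. ennreal ((cmod (case z of (t, x) \<Rightarrow> w x * evolution (\<lambda>\<xi>. \<xi> \<bullet> b) chi \<sigma> f ?\<phi> t x))\<^sup>2) \<partial>lebesgue)
      = W * (?c * bump_energy chi \<sigma> f l0 r0)"
    unfolding nn_integral_weighted_spacetime[OF evolution_product_datum(2)[where l = l and r = r, OF b lr chi_cont \<sigma> fc(1)] w'_meas w'] en pull ..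
  have total_t: "(\<integral>\<^sup>+z. ennreal ((cmod (case z of (t, x) \<Rightarrow> w x * evolution (\<lambda>\<xi>. \<xi> \<bullet> b) chi \<tau> g ?\<phi> t x))\<^sup>2) \<partial>lebesgue)
      = W * (?c * bump_energy chi \<tau> g l0 r0)"
    unfolding nn_integral_weighted_spacetime[OF evolution_product_datum(2)[where l = l and r = r, OF b lr chi_cont \<tau> fc(2)] w'_meas w'] en pull ..
  have le: "W * (?c * bump_energy chi \<sigma> f l0 r0) \<le> ennreal (A\<^sup>2) * (W * (?c * bump_energy chi \<tau> g l0 r0))"
    and fin: "W * (?c * bump_energy chi \<sigma> f l0 r0) < \<infinity>"
    using bound unfolding total_s total_t .
  have strict: "ennreal (A\<^sup>2) * bump_energy chi \<tau> g l0 r0 < bump_energy chi \<sigma> f l0 r0"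
    by (rule bump_energy_gap[OF chi_cont lr0 nd gap])
  have "W \<noteq> 0"
  proof
    assume "W = 0"
    then have "AE x in lborel. ennreal ((cmod (w' x))\<^sup>2) * ennreal ((cmod (other_waves b l r x))\<^sup>2) = 0"
      unfolding W_def by (subst (asm) nn_integral_0_iff_AE) auto
    then have "AE x in lborel. w' x \<noteq> 0 \<longrightarrow> (\<exists>i\<in>Basis. \<not> \<bar>x \<bullet> i\<bar> * d < 1)"
    proof eventually_elim
      case (elim x)
      show ?case
      proof (intro impI, rule ccontr)
        assume *: "w' x \<noteq> 0" "\<not> (\<exists>i\<in>Basis. \<not> \<bar>x \<bullet> i\<bar> * d < 1)"
        then have "other_waves b l r x \<noteq> 0"
          using d wave_nonzero[of _ d] by (auto simp: other_waves_def l_def r_def)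
        then show False using * elim by simp
      qed
    qed
    then show False using visible by simp
  qed
  moreover have "W \<noteq> \<infinity>"
  proof
    assume "W = \<infinity>"
    moreover have "?c * bump_energy chi \<sigma> f l0 r0 \<noteq> 0" using strict by (auto simp: not_less_zero)
    ultimately show False using fin by (simp add: ennreal_top_mult)
  qed
  ultimately have W: "0 < W * ?c" "W * ?c < top"
    by (auto simp: zero_less_iff_neq_zero less_top ennreal_mult_less_top)
  have "ennreal (A\<^sup>2) * (W * (?c * bump_energy chi \<tau> g l0 r0)) = (W * ?c) * (ennreal (A\<^sup>2) * bump_energy chi \<tau> g l0 r0)"
    by (simp only: ac_simps)
  also have "\<dots> < (W * ?c) * bump_energy chi \<sigma> f l0 r0"
    by (rule ennreal_mult_strict_left_mono[OF strict W])
  also have "\<dots> = W * (?c * bump_energy chi \<sigma> f l0 r0)" by (rule mult.assoc)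
  finally show False using le by simp
qed

end

theorem corollary2p3:
  fixes f g :: "real \<Rightarrow> real" and chi \<sigma> \<tau> :: "real \<Rightarrow> complex" and A :: real
    and w :: "real ^ 'n \<Rightarrow> complex" and j :: 'n
  assumes "f C1_differentiable_on UNIV" and "g C1_differentiable_on UNIV"
    and "chi \<in> borel_measurable lebesgue"
    and "strict_mono_on (supp chi) f \<or> strict_antimono_on (supp chi) f"
    and "strict_mono_on (supp chi) g \<or> strict_antimono_on (supp chi) g"
    and "continuous_on UNIV \<sigma>" and "continuous_on UNIV \<tau>"
    and "A > 0"
    and "w \<in> borel_measurable lebesgue"
  shows
    "(symbol_bound f g chi \<sigma> \<tau> A \<longrightarrow>
        (\<forall>\<phi> :: real \<Rightarrow> complex. admissible_datum (\<lambda>\<xi>. \<xi>) f g chi \<sigma> \<tau> \<phi> \<longrightarrow>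
           (\<forall>x x'. L2norm (\<lambda>t. evolution (\<lambda>\<xi>. \<xi>) chi \<sigma> f \<phi> t x)
              \<le> ennreal A * L2norm (\<lambda>t. evolution (\<lambda>\<xi>. \<xi>) chi \<tau> g \<phi> t x'))) \<and>
        (\<forall>\<phi> :: real ^ 'n \<Rightarrow> complex. admissible_datum (\<lambda>\<xi>. \<xi> $ j) f g chi \<sigma> \<tau> \<phi> \<longrightarrow>
           L2norm (\<lambda>(t, x). w x * evolution (\<lambda>\<xi>. \<xi> $ j) chi \<sigma> f \<phi> t x)
             \<le> ennreal A * L2norm (\<lambda>(t, x). w x * evolution (\<lambda>\<xi>. \<xi> $ j) chi \<tau> g \<phi> t x)))
     \<and>
     (continuous_on UNIV chi \<and> emeasure lebesgue {x. w x \<noteq> 0} > 0 \<and>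
        ((\<exists>x x'. \<forall>\<phi> :: real \<Rightarrow> complex. test_datum \<phi> \<longrightarrow>
            L2norm (\<lambda>t. evolution (\<lambda>\<xi>. \<xi>) chi \<sigma> f \<phi> t x)
              \<le> ennreal A * L2norm (\<lambda>t. evolution (\<lambda>\<xi>. \<xi>) chi \<tau> g \<phi> t x') \<and>
            L2norm (\<lambda>t. evolution (\<lambda>\<xi>. \<xi>) chi \<sigma> f \<phi> t x) < \<infinity> \<and>
            L2norm (\<lambda>t. evolution (\<lambda>\<xi>. \<xi>) chi \<tau> g \<phi> t x') < \<infinity>) \<or>
         (\<forall>\<phi> :: real ^ 'n \<Rightarrow> complex. test_datum \<phi> \<longrightarrow>
            L2norm (\<lambda>(t, x). w x * evolution (\<lambda>\<xi>. \<xi> $ j) chi \<sigma> f \<phi> t x)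
              \<le> ennreal A * L2norm (\<lambda>(t, x). w x * evolution (\<lambda>\<xi>. \<xi> $ j) chi \<tau> g \<phi> t x) \<and>
            L2norm (\<lambda>(t, x). w x * evolution (\<lambda>\<xi>. \<xi> $ j) chi \<sigma> f \<phi> t x) < \<infinity> \<and>
            L2norm (\<lambda>(t, x). w x * evolution (\<lambda>\<xi>. \<xi> $ j) chi \<tau> g \<phi> t x) < \<infinity>))
      \<longrightarrow> symbol_bound f g chi \<sigma> \<tau> A)"
proof -
  have inj: "inj_on h (supp chi)" if "strict_mono_on (supp chi) h \<or> strict_antimono_on (supp chi) h" for h :: "real \<Rightarrow> real"
    using that unfolding inj_on_def monotone_on_def by (metis less_irrefl linorder_neqE)
  interpret symbol_pair f g chi \<sigma> \<tau> A
    using assms by unfold_locales (auto intro: inj)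
  have coord: "(\<lambda>\<xi> :: real ^ 'n. \<xi> $ j) = (\<lambda>\<xi>. \<xi> \<bullet> axis j 1)"
    by (simp add: cart_eq_inner_axis)
  have b: "axis j 1 \<in> (Basis :: (real ^ 'n) set)"
    by (simp add: axis_in_Basis_iff)
  show ?thesis
    unfolding coord
  proof (intro conjI impI allI)
    fix \<phi> :: "real \<Rightarrow> complex" and x x'
    assume "symbol_bound f g chi \<sigma> \<tau> A" "admissible_datum (\<lambda>\<xi>. \<xi>) f g chi \<sigma> \<tau> \<phi>"
    then show "L2norm (\<lambda>t. evolution (\<lambda>\<xi>. \<xi>) chi \<sigma> f \<phi> t x)
        \<le> ennreal A * L2norm (\<lambda>t. evolution (\<lambda>\<xi>. \<xi>) chi \<tau> g \<phi> t x')"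
      by (rule line_estimate)
  next
    fix \<phi> :: "real ^ 'n \<Rightarrow> complex"
    assume "symbol_bound f g chi \<sigma> \<tau> A" "admissible_datum (\<lambda>\<xi>. \<xi> \<bullet> axis j 1) f g chi \<sigma> \<tau> \<phi>"
    then show "L2norm (\<lambda>(t, x). w x * evolution (\<lambda>\<xi>. \<xi> \<bullet> axis j 1) chi \<sigma> f \<phi> t x)
        \<le> ennreal A * L2norm (\<lambda>(t, x). w x * evolution (\<lambda>\<xi>. \<xi> \<bullet> axis j 1) chi \<tau> g \<phi> t x)"
      by (rule weighted_estimate[OF b assms(9)])
  next
    assume H: "continuous_on UNIV chi \<and> emeasure lebesgue {x. w x \<noteq> 0} > 0 \<and>
        ((\<exists>x x'. \<forall>\<phi> :: real \<Rightarrow> complex. test_datum \<phi> \<longrightarrow>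
            L2norm (\<lambda>t. evolution (\<lambda>\<xi>. \<xi>) chi \<sigma> f \<phi> t x)
              \<le> ennreal A * L2norm (\<lambda>t. evolution (\<lambda>\<xi>. \<xi>) chi \<tau> g \<phi> t x') \<and>
            L2norm (\<lambda>t. evolution (\<lambda>\<xi>. \<xi>) chi \<sigma> f \<phi> t x) < \<infinity> \<and>
            L2norm (\<lambda>t. evolution (\<lambda>\<xi>. \<xi>) chi \<tau> g \<phi> t x') < \<infinity>) \<or>
         (\<forall>\<phi> :: real ^ 'n \<Rightarrow> complex. test_datum \<phi> \<longrightarrow>
            L2norm (\<lambda>(t, x). w x * evolution (\<lambda>\<xi>. \<xi> \<bullet> axis j 1) chi \<sigma> f \<phi> t x)
              \<le> ennreal A * L2norm (\<lambda>(t, x). w x * evolution (\<lambda>\<xi>. \<xi> \<bullet> axis j 1) chi \<tau> g \<phi> t x) \<and>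
            L2norm (\<lambda>(t, x). w x * evolution (\<lambda>\<xi>. \<xi> \<bullet> axis j 1) chi \<sigma> f \<phi> t x) < \<infinity> \<and>
            L2norm (\<lambda>(t, x). w x * evolution (\<lambda>\<xi>. \<xi> \<bullet> axis j 1) chi \<tau> g \<phi> t x) < \<infinity>))"
      (is "?cont \<and> ?pos \<and> (?line \<or> ?space)")
    then have cont: ?cont and pos: ?pos by simp_all
    from H have "?line \<or> ?space" by simp
    then show "symbol_bound f g chi \<sigma> \<tau> A"
    proof
      assume ?line
      then show ?thesis using line_converse[OF cont] by blast
    next
      assume ?space
      then show ?thesis using weighted_converse[OF cont b assms(9) pos] by blast
    qed
  qed
qed

end
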